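(* Let $\alpha,\beta\in\mathbb{R}$, let $J\in\mathbb{Z}_+$ with $J>\alpha$, and let $N\in\mathbb{Z}_+$ be the minimal number such that $N\ge\beta$. Let $g\in \mathrm{H}(\mathbb{D})$ and let $\varphi:\mathbb{D}\to\mathbb{D}$ be a holomorphic mapping. Assume that the weighted composition operator $C_\varphi^g:\Lambda^\beta(\mathbb{D})\to\Lambda^\alpha(\mathbb{D})$ is bounded. Then $$ \|C_\varphi^g\|_{e,\Lambda^\beta\to\Lambda^\alpha}\asymp \max_{N\le j\le J}\ \limsup_{|\varphi(z)|\to 1-}\frac{|G_j[g,\varphi,J](z)|\,\Omega_{j,\beta}(|\varphi(z)|)}{(1-|z|)^{\alpha-J}} =\max_{N\le j\le J}\ \limsup_{n\to\infty}\frac{\|G_j[g,\varphi,J]\,\varphi^n\|_{\Lambda^{\alpha-J}}}{\|z^n\|_{H^\infty_{\Omega_{j,\beta}}}}. $$ In particular, $C_\varphi^g:\Lambda^\beta(\mathbb{D})\to\Lambda^\alpha(\mathbb{D})$ is compact if $N>J$.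
   Context: $\mathbb{D}$ is the open unit disk of $\mathbb{C}$, $\mathrm{H}(\mathbb{D})$ is the space of holomorphic functions on $\mathbb{D}$, and $\mathbb{Z}_+=\{0,1,2,\dots\}$. Spaces $\Lambda^\alpha$: for $\alpha\in\mathbb{R}$, $\Lambda^\alpha(\mathbb{D})$ is the space of $f\in \mathrm{H}(\mathbb{D})$ with $\sup_{z\in\mathbb{D}}|f^{(K)}(z)|(1-|z|)^{K-\alpha}<\infty$, where $K$ is a non-negative integer with $K>\alpha$ (the space does not depend on the choice of such $K$). It is a Banach space with norm $\|f\|_{\Lambda^\alpha}=\sum_{j=0}^{K-1}|f^{(j)}(0)|+\sup_{z\in\mathbb{D}}|f^{(K)}(z)|(1-|z|)^{K-\alpha}$, where $K$ is the smallest element of $\mathbb{Z}_+$ with $K>\alpha$ (the first sum is $0$ if $K=0$). In particular, for $\alpha<0$, $\|f\|_{\Lambda^\alpha}=\sup_{z\in\mathbb{D}}|f(z)|(1-|z|)^{-\alpha}$. Weighted composition operator: $(C_\varphi^g f)(z)=g(z)f(\varphi(z))$, $f\in \mathrm{H}(\mathbb{D})$, $z\in\mathbb{D}$. Functions $G_j$: for $J\in\mathbb{Z}_+$, the holomorphic functions $G_j[g,\varphi,J]$, $j=0,1,\dots,J$, depend only on $g,\varphi,J$ and are defined by the identity, valid for all $f\in \mathrm{H}(\mathbb{D})$ and obtained from the Leibniz rule and Faà di Bruno's formula, $(C_\varphi^g f)^{(J)}(z)=\sum_{j=0}^J G_j[g,\varphi,J](z)\,f^{(j)}(\varphi(z))$,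 $z\in\mathbb{D}$. For example, $G_0[g,\varphi,0]=g$; $G_0[g,\varphi,1]=g'$, $G_1[g,\varphi,1]=g\varphi'$; $G_0[g,\varphi,2]=g''$, $G_1[g,\varphi,2]=2g'\varphi'+g\varphi''$, $G_2[g,\varphi,2]=g(\varphi')^2$. Weight functions $\Omega_{j,\beta}:[0,1)\to(0,+\infty)$, $j=0,1,\dots,J$ (with $N$ the minimal element of $\mathbb{Z}_+$ with $N\ge\beta$): if $N>0$, then $\Omega_{j,\beta}\equiv1$ for $j=0,1,\dots,\min\{N-1,J\}$; if $\beta<N\le J$, then $\Omega_{j,\beta}(t)=(1-t)^{\beta-j}$ for $j=N,\dots,J$; if $\beta=N<J$, then $\Omega_{j,\beta}(t)=(1-t)^{\beta-j}$ for $j=N+1,\dots,J$; if $\beta=N\le J$, then $\Omega_{N,\beta}(t)=\log\frac{e}{1-t}$. Growth space norm: for $\omega:[0,1)\to(0,+\infty)$, $\|f\|_{H^\infty_\omega}=\sup_{z\in\mathbb{D}}|f(z)|/\omega(|z|)$; $z^n$ denotes the monomial function. Essential norm: $\|T\|_{e,X\to Y}=\inf\{\|T-Q\|_{X\to Y}: Q:X\to Y\text{ compact}\}$. Conventions: $A\asymp B$ means $C^{-1}B\le A\le CB$ with a constant $C>0$ depending only on $\alpha,\beta,J$ (not on $g,\varphi$). $\limsup_{|\varphi(z)|\to1-}F(z)=\lim_{\delta\to1-}\sup\{F(z):|\varphi(z)|>\delta\}$, understood as $0$ if $\sup_{\mathbb{D}}|\varphi|<1$. A maximum over an empty index set is $0$.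 *)

theory Defs
  imports "HOL-Complex_Analysis.Complex_Analysis"
begin

abbreviation unit_disk :: "complex set" where
  "unit_disk \<equiv> ball 0 1"

text \<open>Norms take values in \<^typ>\<open>ennreal\<close>, so that every supremum below exists and an infinite
  supremum is really infinite. Functions on the disk are functions on \<^typ>\<open>complex\<close>. The norm only
  looks at their values on the disk, and it is infinite if they are not holomorphic there. Members
  of the space \<open>\<Lambda>\<^sup>\<alpha>\<close> are normalised to be \<open>0\<close> off the disk, which makes the space a genuine vector
  space with a genuine metric (see \<open>Metric_space_Lambda\<close>).\<close>

definition Lambda_order :: "real \<Rightarrow> nat" where
  "Lambda_order \<alpha> = (LEAST K::nat. real K > \<alpha>)"

definition Lambda_norm :: "real \<Rightarrow> (complex \<Rightarrow> complex) \<Rightarrow> ennreal" where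
  "Lambda_norm \<alpha> f =
     (if f holomorphic_on unit_disk then
        (let K = Lambda_order \<alpha> in
          (\<Sum>j<K. ennreal (norm ((deriv ^^ j) f 0))) +
          (SUP z\<in>unit_disk. ennreal (norm ((deriv ^^ K) f z) * (1 - norm z) powr (real K - \<alpha>))))
      else \<infinity>)"

definition Lambda_space :: "real \<Rightarrow> (complex \<Rightarrow> complex) set" where
  "Lambda_space \<alpha> =
     {f. f holomorphic_on unit_disk \<and> (\<forall>z. z \<notin> unit_disk \<longrightarrow> f z = 0) \<and> Lambda_norm \<alpha> f < \<infinity>}"

definition Lambda_dist :: "real \<Rightarrow> (complex \<Rightarrow> complex) \<Rightarrow> (complex \<Rightarrow> complex) \<Rightarrow> real" where
  "Lambda_dist \<alpha> f h = enn2real (Lambda_norm \<alpha> (\<lambda>z. f z - h z))"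

definition Lambda_topology :: "real \<Rightarrow> (complex \<Rightarrow> complex) topology" where
  "Lambda_topology \<alpha> = Metric_space.mtopology (Lambda_space \<alpha>) (Lambda_dist \<alpha>)"

lemma Lambda_norm_0: "Lambda_norm \<alpha> (\<lambda>z. 0) = 0"
  by (simp add: Lambda_norm_def Let_def)

lemma Lambda_norm_cmult:
  assumes "f holomorphic_on unit_disk"
  shows "Lambda_norm \<alpha> (\<lambda>z. c * f z) = ennreal (norm c) * Lambda_norm \<alpha> f"
proof -
  have d: "(deriv ^^ k) (\<lambda>z. c * f z) z = c * (deriv ^^ k) f z" if "z \<in> unit_disk" for k z
    using higher_deriv_cmult[OF assms that] by simp
  have h: "(\<lambda>z. c * f z) holomorphic_on unit_disk"
    using assms by (intro holomorphic_intros)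
  define K where "K = Lambda_order \<alpha>"
  have 1: "(\<Sum>j<K. ennreal (norm ((deriv ^^ j) (\<lambda>z. c * f z) 0)))
      = ennreal (norm c) * (\<Sum>j<K. ennreal (norm ((deriv ^^ j) f 0)))"
    unfolding sum_distrib_left by (intro sum.cong) (simp_all add: d norm_mult ennreal_mult)
  have 2: "(SUP z\<in>unit_disk. ennreal (norm ((deriv ^^ K) (\<lambda>z. c * f z) z) * (1 - norm z) powr (real K - \<alpha>)))
      = ennreal (norm c) *
        (SUP z\<in>unit_disk. ennreal (norm ((deriv ^^ K) f z) * (1 - norm z) powr (real K - \<alpha>)))"
    unfolding SUP_mult_left_ennreal
    by (intro SUP_cong refl, subst d) (simp_all add: norm_mult ennreal_mult mult.assoc)
  show ?thesis
    using assms h 1 2 by (simp only: Lambda_norm_def Let_def K_def[symmetric] if_True distrib_left)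
qed

lemma Lambda_norm_diff_commute:
  "Lambda_norm \<alpha> (\<lambda>z. f z - h z) = Lambda_norm \<alpha> (\<lambda>z. h z - f z)"
proof (cases "(\<lambda>z. f z - h z) holomorphic_on unit_disk")
  case True
  then show ?thesis
    using Lambda_norm_cmult[of "\<lambda>z. f z - h z" \<alpha> "-1"] by simp
next
  case False
  then have "\<not> (\<lambda>z. h z - f z) holomorphic_on unit_disk"
    using holomorphic_on_minus[of "\<lambda>z. h z - f z" unit_disk] by auto
  with False show ?thesis by (simp add: Lambda_norm_def)
qed

lemma Lambda_norm_add:
  assumes f: "f holomorphic_on unit_disk" and h: "h holomorphic_on unit_disk"
  shows "Lambda_norm \<alpha> (\<lambda>z. f z + h z) \<le> Lambda_norm \<alpha> f + Lambda_norm \<alpha> h"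
proof -
  define K where "K = Lambda_order \<alpha>"
  define w where "w z = (1 - norm z) powr (real K - \<alpha>)" for z :: complex
  have d: "(deriv ^^ k) (\<lambda>z. f z + h z) z = (deriv ^^ k) f z + (deriv ^^ k) h z"
    if "z \<in> unit_disk" for k z
    using higher_deriv_add[OF f h _ that] by simp
  have fh: "(\<lambda>z. f z + h z) holomorphic_on unit_disk"
    using f h by (intro holomorphic_intros)
  have tri: "ennreal (norm (a + b) * r) \<le> ennreal (norm a * r) + ennreal (norm b * r)"
    if "r \<ge> 0" for a b :: complex and r
    using that by (simp flip: ennreal_plus distrib_right add: ennreal_leI mult_right_mono norm_triangle_ineq)
  have 1: "(\<Sum>j<K. ennreal (norm ((deriv ^^ j) (\<lambda>z. f z + h z) 0)))
      \<le> (\<Sum>j<K. ennreal (norm ((deriv ^^ j) f 0))) + (\<Sum>j<K. ennreal (norm ((deriv ^^ j) h 0)))"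
    unfolding sum.distrib[symmetric] using tri[of 1] by (intro sum_mono) (simp add: d)
  have 2: "(SUP z\<in>unit_disk. ennreal (norm ((deriv ^^ K) (\<lambda>z. f z + h z) z) * w z))
      \<le> (SUP z\<in>unit_disk. ennreal (norm ((deriv ^^ K) f z) * w z)) +
        (SUP z\<in>unit_disk. ennreal (norm ((deriv ^^ K) h z) * w z))"
  proof (rule SUP_least)
    fix z :: complex assume z: "z \<in> unit_disk"
    have "ennreal (norm ((deriv ^^ K) (\<lambda>z. f z + h z) z) * w z)
      \<le> ennreal (norm ((deriv ^^ K) f z) * w z) + ennreal (norm ((deriv ^^ K) h z) * w z)"
      unfolding d[OF z] by (rule tri) (simp add: w_def)
    also have "\<dots> \<le> (SUP z\<in>unit_disk. ennreal (norm ((deriv ^^ K) f z) * w z)) +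
        (SUP z\<in>unit_disk. ennreal (norm ((deriv ^^ K) h z) * w z))"
      using z by (intro add_mono SUP_upper)
    finally show "ennreal (norm ((deriv ^^ K) (\<lambda>z. f z + h z) z) * w z) \<le> \<dots>" .
  qed
  show ?thesis
    using add_mono[OF 1 2] f h fh
    by (simp add: Lambda_norm_def Let_def K_def w_def add_ac)
qed

lemma Lambda_norm_eq_0D:
  assumes f: "f holomorphic_on unit_disk" and 0: "Lambda_norm \<alpha> f = 0" and z: "z \<in> unit_disk"
  shows "f z = 0"
proof -
  define K where "K = Lambda_order \<alpha>"
  have s: "(\<Sum>j<K. ennreal (norm ((deriv ^^ j) f 0))) = 0"
    and S: "(SUP z\<in>unit_disk. ennreal (norm ((deriv ^^ K) f z) * (1 - norm z) powr (real K - \<alpha>))) = 0"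
    using 0 f by (auto simp: Lambda_norm_def Let_def K_def)
  have low: "(deriv ^^ j) f 0 = 0" if "j < K" for j
    using s that unfolding sum_eq_0_iff[OF finite_lessThan] by simp
  have top0: "(deriv ^^ K) f w = 0" if w: "w \<in> unit_disk" for w
  proof -
    have "ennreal (norm ((deriv ^^ K) f w) * (1 - norm w) powr (real K - \<alpha>)) \<le> 0"
      unfolding S[symmetric] using w by (rule SUP_upper)
    moreover have "(1 - norm w) powr (real K - \<alpha>) > 0" using w by simp
    ultimately show ?thesis
      by (simp add: ennreal_eq_0_iff mult_le_0_iff)
  qed
  have high: "(deriv ^^ (m + K)) f 0 = 0" for m
  proof -
    have "(deriv ^^ m) ((deriv ^^ K) f) 0 = (deriv ^^ m) (\<lambda>_. 0) 0"
      using top0 f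
      by (intro higher_deriv_transform_within_open[where S = unit_disk])
         (auto intro!: holomorphic_intros)
    then show ?thesis by (simp add: funpow_add)
  qed
  have "(deriv ^^ n) f 0 = 0" for n
    using low[of n] high[of "n - K"] by (cases "n < K") auto
  then show ?thesis
    using f z by (intro holomorphic_fun_eq_0_on_ball[of f 0 1]) auto
qed

lemma Lambda_space_diff:
  assumes "f \<in> Lambda_space \<alpha>" "h \<in> Lambda_space \<alpha>"
  shows "(\<lambda>z. f z - h z) \<in> Lambda_space \<alpha>"
proof -
  have f: "f holomorphic_on unit_disk" and h: "h holomorphic_on unit_disk"
    and fin: "Lambda_norm \<alpha> f < \<infinity>" "Lambda_norm \<alpha> h < \<infinity>"
    using assms by (auto simp: Lambda_space_def)
  have "Lambda_norm \<alpha> (\<lambda>z. f z + (- 1) * h z) \<le> Lambda_norm \<alpha> f + Lambda_norm \<alpha> h"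
    using Lambda_norm_add[OF f, of "\<lambda>z. (- 1) * h z" \<alpha>] Lambda_norm_cmult[OF h, of \<alpha> "-1"] h
    by (simp add: holomorphic_on_minus)
  also have "\<dots> < \<infinity>"
    using fin by simp
  finally have "Lambda_norm \<alpha> (\<lambda>z. f z - h z) < \<infinity>"
    by simp
  then show ?thesis
    using assms by (auto simp: Lambda_space_def intro!: holomorphic_intros)
qed

lemma Metric_space_Lambda: "Metric_space (Lambda_space \<alpha>) (Lambda_dist \<alpha>)"
proof
  fix f h :: "complex \<Rightarrow> complex"
  show "0 \<le> Lambda_dist \<alpha> f h" by (simp add: Lambda_dist_def)
  show "Lambda_dist \<alpha> f h = Lambda_dist \<alpha> h f"
    unfolding Lambda_dist_def by (subst Lambda_norm_diff_commute) simp
  assume fh: "f \<in> Lambda_space \<alpha>" "h \<in> Lambda_space \<alpha>"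
  note D = Lambda_space_diff[OF fh]
  show "Lambda_dist \<alpha> f h = 0 \<longleftrightarrow> f = h"
  proof
    assume "Lambda_dist \<alpha> f h = 0"
    then have "Lambda_norm \<alpha> (\<lambda>z. f z - h z) = 0"
      using D by (auto simp: Lambda_dist_def Lambda_space_def enn2real_eq_0_iff)
    then have "f z = h z" if "z \<in> unit_disk" for z
      using Lambda_norm_eq_0D[of "\<lambda>z. f z - h z" \<alpha> z] D that by (auto simp: Lambda_space_def)
    moreover have "f z = h z" if "z \<notin> unit_disk" for z
      using fh that by (auto simp: Lambda_space_def)
    ultimately show "f = h" by blast
  qed (simp add: Lambda_dist_def Lambda_norm_0)
next
  fix f g h :: "complex \<Rightarrow> complex"
  assume m: "f \<in> Lambda_space \<alpha>" "g \<in> Lambda_space \<alpha>" "h \<in> Lambda_space \<alpha>"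
  note D = Lambda_space_diff[OF m(1,2)] Lambda_space_diff[OF m(2,3)]
  have "Lambda_norm \<alpha> (\<lambda>z. f z - h z)
      \<le> Lambda_norm \<alpha> (\<lambda>z. f z - g z) + Lambda_norm \<alpha> (\<lambda>z. g z - h z)"
    using Lambda_norm_add[of "\<lambda>z. f z - g z" "\<lambda>z. g z - h z" \<alpha>] D
    by (simp add: Lambda_space_def)
  then have "Lambda_dist \<alpha> f h
      \<le> enn2real (Lambda_norm \<alpha> (\<lambda>z. f z - g z) + Lambda_norm \<alpha> (\<lambda>z. g z - h z))"
    unfolding Lambda_dist_def using D by (intro enn2real_mono) (auto simp: Lambda_space_def)
  also have "\<dots> = Lambda_dist \<alpha> f g + Lambda_dist \<alpha> g h"
    unfolding Lambda_dist_def using D by (intro enn2real_plus) (auto simp: Lambda_space_def)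
  finally show "Lambda_dist \<alpha> f h \<le> Lambda_dist \<alpha> f g + Lambda_dist \<alpha> g h" .
qed

type_synonym operator = "(complex \<Rightarrow> complex) \<Rightarrow> complex \<Rightarrow> complex"

definition Lambda_linear :: "real \<Rightarrow> real \<Rightarrow> operator \<Rightarrow> bool" where
  "Lambda_linear \<beta> \<alpha> T \<longleftrightarrow>
     T ` Lambda_space \<beta> \<subseteq> Lambda_space \<alpha> \<and>
     (\<forall>f\<in>Lambda_space \<beta>. \<forall>h\<in>Lambda_space \<beta>. T (\<lambda>z. f z + h z) = (\<lambda>z. T f z + T h z)) \<and>
     (\<forall>c. \<forall>f\<in>Lambda_space \<beta>. T (\<lambda>z. c * f z) = (\<lambda>z. c * T f z))"

definition Lambda_unit_ball :: "real \<Rightarrow> (complex \<Rightarrow> complex) set" where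
  "Lambda_unit_ball \<beta> = {f \<in> Lambda_space \<beta>. Lambda_norm \<beta> f \<le> 1}"

definition Lambda_onorm :: "real \<Rightarrow> real \<Rightarrow> operator \<Rightarrow> ennreal" where
  "Lambda_onorm \<beta> \<alpha> T = (SUP f\<in>Lambda_unit_ball \<beta>. Lambda_norm \<alpha> (T f))"

definition Lambda_bounded :: "real \<Rightarrow> real \<Rightarrow> operator \<Rightarrow> bool" where
  "Lambda_bounded \<beta> \<alpha> T \<longleftrightarrow> Lambda_linear \<beta> \<alpha> T \<and> Lambda_onorm \<beta> \<alpha> T < \<infinity>"

definition Lambda_compact :: "real \<Rightarrow> real \<Rightarrow> operator \<Rightarrow> bool" where
  "Lambda_compact \<beta> \<alpha> T \<longleftrightarrow>
     Lambda_linear \<beta> \<alpha> T \<and>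
     compactin (Lambda_topology \<alpha>) (Lambda_topology \<alpha> closure_of (T ` Lambda_unit_ball \<beta>))"

definition Lambda_ess_norm :: "real \<Rightarrow> real \<Rightarrow> operator \<Rightarrow> ennreal" where
  "Lambda_ess_norm \<beta> \<alpha> T =
     (INF Q\<in>{Q. Lambda_compact \<beta> \<alpha> Q}. Lambda_onorm \<beta> \<alpha> (\<lambda>f z. T f z - Q f z))"

text \<open>The value off the disk is \<open>0\<close>, to match the normalisation in \<^const>\<open>Lambda_space\<close>.\<close>

definition wcomp :: "(complex \<Rightarrow> complex) \<Rightarrow> (complex \<Rightarrow> complex) \<Rightarrow> operator" where
  "wcomp g \<phi> f = (\<lambda>z. if z \<in> unit_disk then g z * f (\<phi> z) else 0)"

definition is_G_family ::
  "(complex \<Rightarrow> complex) \<Rightarrow> (complex \<Rightarrow> complex) \<Rightarrow> nat \<Rightarrow> (nat \<Rightarrow> complex \<Rightarrow> complex) \<Rightarrow> bool" where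
  "is_G_family g \<phi> J G \<longleftrightarrow>
     (\<forall>j\<le>J. G j holomorphic_on unit_disk) \<and>
     (\<forall>f. f holomorphic_on unit_disk \<longrightarrow>
        (\<forall>z\<in>unit_disk. (deriv ^^ J) (wcomp g \<phi> f) z = (\<Sum>j\<le>J. G j z * (deriv ^^ j) f (\<phi> z))))"

text \<open>The identity determines \<open>G\<^sub>j\<close> only for \<open>j \<le> J\<close> and on the disk; all other values are fixed to
  be \<open>0\<close>. Lemma \<open>G_fun_family\<close> below shows that the description is proper.\<close>

definition G_fun :: "(complex \<Rightarrow> complex) \<Rightarrow> (complex \<Rightarrow> complex) \<Rightarrow> nat \<Rightarrow> nat \<Rightarrow> complex \<Rightarrow> complex" where
  "G_fun g \<phi> J =
     (THE G. is_G_family g \<phi> J G \<and> (\<forall>j z. \<not> (j \<le> J \<and> z \<in> unit_disk) \<longrightarrow> G j z = 0))"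

lemma ex_G_family:
  assumes g: "g holomorphic_on unit_disk" and \<phi>: "\<phi> holomorphic_on unit_disk"
    and im: "\<phi> ` unit_disk \<subseteq> unit_disk"
  shows "\<exists>G. is_G_family g \<phi> J G"
proof (induction J)
  case 0
  have "is_G_family g \<phi> 0 (\<lambda>_. g)"
    using g by (simp add: is_G_family_def wcomp_def)
  then show ?case by (intro exI[of _ "\<lambda>_. g"])
next
  case (Suc J)
  then obtain G where hol: "\<And>j. j \<le> J \<Longrightarrow> G j holomorphic_on unit_disk"
    and id: "\<And>f z. f holomorphic_on unit_disk \<Longrightarrow> z \<in> unit_disk \<Longrightarrow>
      (deriv ^^ J) (wcomp g \<phi> f) z = (\<Sum>j\<le>J. G j z * (deriv ^^ j) f (\<phi> z))"
    unfolding is_G_family_def by blast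
  define A where "A j z = (if j \<le> J then deriv (G j) z else 0)" for j z
  define B where "B j z = (if j = 0 then 0 else G (j - 1) z * deriv \<phi> z)" for j z
  have "is_G_family g \<phi> (Suc J) (\<lambda>j z. A j z + B j z)"
    unfolding is_G_family_def
  proof (intro conjI allI impI ballI)
    fix j assume j: "j \<le> Suc J"
    have "A j holomorphic_on unit_disk"
      unfolding A_def using hol by (cases "j \<le> J") (auto intro!: holomorphic_intros)
    moreover have "B j holomorphic_on unit_disk"
      unfolding B_def using hol[of "j - 1"] j \<phi> by (cases "j = 0") (auto intro!: holomorphic_intros)
    ultimately show "(\<lambda>z. A j z + B j z) holomorphic_on unit_disk"
      by (rule holomorphic_on_add)
  next
    fix f :: "complex \<Rightarrow> complex" and z :: complex
    assume f: "f holomorphic_on unit_disk" and z: "z \<in> unit_disk"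
    have \<phi>z: "\<phi> z \<in> unit_disk" using im z by blast
    have "((\<lambda>w. \<Sum>j\<le>J. G j w * (deriv ^^ j) f (\<phi> w)) has_field_derivative
        (\<Sum>j\<le>J. G j z * ((deriv ^^ Suc j) f (\<phi> z) * deriv \<phi> z)
          + deriv (G j) z * (deriv ^^ j) f (\<phi> z))) (at z)"
    proof (rule DERIV_sum)
      fix j assume "j \<in> {..J}"
      then have "(G j has_field_derivative deriv (G j) z) (at z)"
        using holomorphic_derivI[OF hol open_ball z] by simp
      moreover have "(\<phi> has_field_derivative deriv \<phi> z) (at z)"
        using \<phi> z holomorphic_derivI[OF _ open_ball] by blast
      then have "((\<lambda>w. (deriv ^^ j) f (\<phi> w)) has_field_derivative
          (deriv ^^ Suc j) f (\<phi> z) * deriv \<phi> z) (at z)"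
        using has_field_derivative_higher_deriv[OF f open_ball \<phi>z, of j]
        by (intro DERIV_chain2)
      ultimately show "((\<lambda>w. G j w * (deriv ^^ j) f (\<phi> w)) has_field_derivative
          (G j z * ((deriv ^^ Suc j) f (\<phi> z) * deriv \<phi> z)
          + deriv (G j) z * (deriv ^^ j) f (\<phi> z))) (at z)"
        by (rule DERIV_mult')
    qed
    then have "((deriv ^^ J) (wcomp g \<phi> f) has_field_derivative
        (\<Sum>j\<le>J. G j z * ((deriv ^^ Suc j) f (\<phi> z) * deriv \<phi> z)
          + deriv (G j) z * (deriv ^^ j) f (\<phi> z))) (at z)"
      by (rule has_field_derivative_transform_within_open[where S = unit_disk])
         (use z id[OF f] in auto)
    then have "(deriv ^^ Suc J) (wcomp g \<phi> f) z =
        (\<Sum>j\<le>J. G j z * ((deriv ^^ Suc j) f (\<phi> z) * deriv \<phi> z)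
          + deriv (G j) z * (deriv ^^ j) f (\<phi> z))"
      by (simp add: DERIV_imp_deriv)
    also have "\<dots> = (\<Sum>j\<le>J. deriv (G j) z * (deriv ^^ j) f (\<phi> z)) +
        (\<Sum>j\<le>J. G j z * deriv \<phi> z * (deriv ^^ Suc j) f (\<phi> z))"
      by (simp add: sum.distrib mult_ac)
    also have "(\<Sum>j\<le>J. deriv (G j) z * (deriv ^^ j) f (\<phi> z)) = (\<Sum>j\<le>Suc J. A j z * (deriv ^^ j) f (\<phi> z))"
      by (simp add: A_def)
    also have "(\<Sum>j\<le>J. G j z * deriv \<phi> z * (deriv ^^ Suc j) f (\<phi> z))
        = (\<Sum>j\<le>Suc J. B j z * (deriv ^^ j) f (\<phi> z))"
      unfolding sum.atMost_Suc_shift by (simp add: B_def)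
    finally show "(deriv ^^ Suc J) (wcomp g \<phi> f) z =
        (\<Sum>j\<le>Suc J. (A j z + B j z) * (deriv ^^ j) f (\<phi> z))"
      by (simp add: sum.distrib distrib_right)
  qed
  then show ?case by blast
qed

lemma G_family_unique:
  assumes "is_G_family g \<phi> J G" "is_G_family g \<phi> J H" and k: "k \<le> J" and z: "z \<in> unit_disk"
  shows "G k z = H k z"
proof -
  define f where "f w = (w - \<phi> z) ^ k" for w
  have d: "(deriv ^^ j) f (\<phi> z) = (if j = k then fact k else 0)" for j
    unfolding f_def higher_deriv_power
    by (auto simp: pochhammer_fact pochhammer_eq_0_iff not_le power_0_left)
  have f: "f holomorphic_on unit_disk" unfolding f_def by (intro holomorphic_intros)
  have "(\<Sum>j\<le>J. G j z * (deriv ^^ j) f (\<phi> z)) = (\<Sum>j\<le>J. H j z * (deriv ^^ j) f (\<phi> z))"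
    using assms(1,2)[unfolded is_G_family_def, THEN conjunct2, rule_format, OF f z] by (rule trans[OF sym])
  then show ?thesis using k by (simp add: d if_distrib[of "(*) _"] cong: if_cong)
qed

lemma G_fun_family:
  assumes "g holomorphic_on unit_disk" "\<phi> holomorphic_on unit_disk" "\<phi> ` unit_disk \<subseteq> unit_disk"
  shows "is_G_family g \<phi> J (G_fun g \<phi> J)"
proof -
  let ?P = "\<lambda>G. is_G_family g \<phi> J G \<and> (\<forall>j z. \<not> (j \<le> J \<and> z \<in> unit_disk) \<longrightarrow> G j z = 0)"
  obtain G where G: "is_G_family g \<phi> J G" using ex_G_family[OF assms] by blast
  let ?G = "\<lambda>j z. if j \<le> J \<and> z \<in> unit_disk then G j z else 0"
  have "?G j holomorphic_on unit_disk" if "j \<le> J" for j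
  proof -
    have "G j holomorphic_on unit_disk" using G that by (simp add: is_G_family_def)
    then show ?thesis by (rule holomorphic_transform) (use that in auto)
  qed
  then have ex: "?P ?G"
    using G by (simp add: is_G_family_def)
  have "H = ?G" if "?P H" for H
    using that G_family_unique[of g \<phi> J H G] G by (intro ext) auto
  then have "\<exists>!G. ?P G" using ex by blast
  then show ?thesis unfolding G_fun_def using theI'[of ?P] by blast
qed

definition N_index :: "real \<Rightarrow> nat" where
  "N_index \<beta> = (LEAST N::nat. real N \<ge> \<beta>)"

text \<open>The weights do not depend on \<open>J\<close>, which only restricts the range of \<open>j\<close>.\<close>

definition Omega :: "nat \<Rightarrow> real \<Rightarrow> real \<Rightarrow> real" where
  "Omega j \<beta> t =
     (if j < N_index \<beta> then 1
      else if j = N_index \<beta> \<and> \<beta> = real (N_index \<beta>) then ln (exp 1 / (1 - t))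
      else (1 - t) powr (\<beta> - real j))"

definition growth_norm :: "(real \<Rightarrow> real) \<Rightarrow> (complex \<Rightarrow> complex) \<Rightarrow> ennreal" where
  "growth_norm \<omega> f = (SUP z\<in>unit_disk. ennreal (norm (f z) / \<omega> (norm z)))"

text \<open>If \<open>\<phi>\<close> is bounded away from the unit circle, the suprema are eventually over the empty set, so
  that the limit is \<open>0\<close>.\<close>

definition Limsup_bdry :: "(complex \<Rightarrow> complex) \<Rightarrow> (complex \<Rightarrow> ennreal) \<Rightarrow> ennreal" where
  "Limsup_bdry \<phi> F = Lim (at_left (1::real)) (\<lambda>\<delta>. SUP z\<in>{z \<in> unit_disk. norm (\<phi> z) > \<delta>}. F z)"

lemma tendsto_Limsup_bdry:
  "((\<lambda>\<delta>. SUP z\<in>{z \<in> unit_disk. norm (\<phi> z) > \<delta>}. F z) \<longlongrightarrow> Limsup_bdry \<phi> F) (at_left (1::real))"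
  (is "(?S \<longlongrightarrow> _) _")
proof -
  have anti: "?S b \<le> ?S a" if "a \<le> b" for a b
    using that by (intro SUP_subset_mono) auto
  have lim: "(?S \<longlongrightarrow> (INF \<delta>\<in>{..<1}. ?S \<delta>)) (at_left 1)"
  proof (rule order_tendstoI)
    fix a assume "a < (INF \<delta>\<in>{..<1}. ?S \<delta>)"
    then have "\<forall>\<delta>\<in>{..<1}. a < ?S \<delta>"
      by (meson INF_lower less_le_trans)
    then show "eventually (\<lambda>\<delta>. a < ?S \<delta>) (at_left 1)"
      by (auto simp: eventually_at_filter)
  next
    fix a assume "(INF \<delta>\<in>{..<1}. ?S \<delta>) < a"
    then obtain d where d: "d < 1" "?S d < a" by (auto simp: INF_less_iff)
    then show "eventually (\<lambda>\<delta>. ?S \<delta> < a) (at_left 1)"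
      unfolding eventually_at_left[OF d(1)] using anti
      by (intro exI[of _ d]) (meson le_less_trans less_imp_le)
  qed
  then have "Limsup_bdry \<phi> F = (INF \<delta>\<in>{..<1}. ?S \<delta>)"
    unfolding Limsup_bdry_def by (intro tendsto_Lim) simp_all
  then show ?thesis using lim by simp
qed

end

theory Submission
  imports Defs "HOL-Real_Asymp.Real_Asymp"
begin

text \<open>Upper bound. Dilations \<open>f \<mapsto> f (r \<cdot>)\<close> give the compact approximants \<open>f \<mapsto> g f (r \<phi>)\<close>, and
  \<open>f - f (r \<cdot>)\<close> is bounded in \<open>\<Lambda>\<^sup>\<beta>\<close> and locally uniformly small. In the expansion of the \<open>J\<close>-th
  derivative of the image, the terms with \<open>j < N\<close> are small because derivatives of order below \<open>\<beta>\<close>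
  are uniformly Hoelder along radii, and the others are small where \<open>\<phi>\<close> stays away from the circle
  and of size \<open>|G\<^sub>j| \<Omega>\<^sub>j\<close> elsewhere. The same estimate and Montel's theorem show that the operator is
  compact whenever the limits superior vanish.

  Lower bound. A compact operator maps bounded locally null sequences of functions in the little space
  to sequences with a subsequence that is null in norm. This needs no duality: by a gliding hump, a
  sparse subsequence has bounded partial sums. It is applied to functions concentrated at points
  \<open>w = \<phi> z\<close> near the circle whose \<open>j\<close>-th derivative at \<open>w\<close> is comparable to \<open>\<Omega>\<^sub>j\<close>.

  Equality of the two right-hand sides. The weights are asymptotically recovered from the norms of
  monomials: for \<open>t\<close> close to \<open>1\<close> there is a large \<open>n\<close> such that \<open>s\<^sup>n / \<omega> s\<close> almost attains its
  supremum at \<open>s = t\<close>.\<close>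

section \<open>Growth of functions in \<open>\<Lambda>\<^sup>\<beta>\<close>\<close>

text \<open>The comparison constant has to be fixed before \<open>g\<close> and
  \<open>\<phi>\<close>. Quantitative facts are therefore packed into predicates such as
  \<open>deriv_growth\<close>, \<open>null_seq_const\<close>, \<open>test_family\<close> and
  \<open>G_limsup_const\<close>, which quantify internally over the functions or operators, so that
  their constants can be obtained first. Boundedness of the operator, tested on monomials, gives sup
  |G_j(z)| (1 - |z|)^(J - \<alpha>) < infinity for all j \<le> J, also for j < N, where the limits
  superior say nothing. This is what makes a term of the expansion small as soon as the derivative
  of f in it is small. The obstacle in the lower bound is that a compact operator need not be
  continuous for locally uniform convergence. On a bounded locally null sequence outside the little
  space it may be constant and nonzero, through a functional that vanishes on the little space.
  Hence the test functions are made holomorphic across the circle, which puts them into the little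
  space.\<close>

lemma Lambda_order_gt: "\<beta> < real (Lambda_order \<beta>)"
  unfolding Lambda_order_def by (rule LeastI_ex) (rule reals_Archimedean2)

lemma Lambda_order_le: "\<beta> < real n \<Longrightarrow> Lambda_order \<beta> \<le> n"
  unfolding Lambda_order_def by (rule Least_le)

lemma less_Lambda_order_iff: "i < Lambda_order \<beta> \<longleftrightarrow> real i \<le> \<beta>"
  using Lambda_order_gt[of \<beta>] Lambda_order_le[of \<beta> i] by (fastforce simp: not_less[symmetric])

text \<open>Compare \<open>less_Lambda_order_iff\<close>: the two thresholds differ exactly when
  \<beta> is a natural number, which is the case with a logarithmic weight.\<close>

lemma less_N_index_iff: "i < N_index \<beta> \<longleftrightarrow> real i < \<beta>"
proof -
  have "\<beta> \<le> real (N_index \<beta>)"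
    unfolding N_index_def by (rule LeastI_ex) (rule real_arch_simple)
  moreover have "N_index \<beta> \<le> i" if "\<beta> \<le> real i"
    unfolding N_index_def using that by (rule Least_le)
  ultimately show ?thesis by (fastforce simp: not_less[symmetric])
qed

text \<open>Eliminates \<open>N_index\<close>: all later case distinctions compare
  \<open>real j\<close> with \<beta>.\<close>

lemma Omega_alt:
  "Omega j \<beta> t = (if real j < \<beta> then 1 else if real j = \<beta> then ln (exp 1 / (1 - t))
     else (1 - t) powr (\<beta> - real j))"
proof -
  have "N_index (real j) = j"
    unfolding N_index_def by (rule Least_equality) auto
  then have "j = N_index \<beta> \<and> \<beta> = real (N_index \<beta>) \<longleftrightarrow> real j = \<beta>"
    by auto
  then show ?thesis by (simp add: Omega_def less_N_index_iff)
qed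

lemma ln_weight: "0 \<le> t \<Longrightarrow> t < 1 \<Longrightarrow> ln (exp 1 / (1 - t)) = 1 - ln (1 - (t::real))"
  by (simp add: ln_div)

lemma Omega_ge_1: "0 \<le> t \<Longrightarrow> t < 1 \<Longrightarrow> 1 \<le> Omega j \<beta> t"
  using powr_mono2'[of "\<beta> - real j" "1 - t" 1]
  by (auto simp: Omega_alt ln_weight)

text \<open>A real bound on each term of the norm separately. It avoids \<open>ennreal\<close>
  arithmetic and agrees with a bound on \<open>Lambda_norm\<close> up to the factor
  \<open>Lambda_order \<beta> + 1\<close>.\<close>

definition Lambda_le :: "real \<Rightarrow> real \<Rightarrow> (complex \<Rightarrow> complex) \<Rightarrow> bool" where
  "Lambda_le \<beta> M f \<longleftrightarrow> f holomorphic_on unit_disk \<and>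
     (\<forall>i<Lambda_order \<beta>. norm ((deriv ^^ i) f 0) \<le> M) \<and>
     (\<forall>z\<in>unit_disk. norm ((deriv ^^ Lambda_order \<beta>) f z) * (1 - norm z) powr (real (Lambda_order \<beta>) - \<beta>) \<le> M)"

lemma Lambda_norm_leD:
  assumes "Lambda_norm \<beta> f \<le> ennreal M" "M \<ge> 0"
  shows "Lambda_le \<beta> M f"
proof -
  let ?K = "Lambda_order \<beta>"
  have hol: "f holomorphic_on unit_disk"
    using assms by (auto simp: Lambda_norm_def top_unique split: if_splits)
  have le: "(\<Sum>j<?K. ennreal (norm ((deriv ^^ j) f 0))) +
     (SUP z\<in>unit_disk. ennreal (norm ((deriv ^^ ?K) f z) * (1 - norm z) powr (real ?K - \<beta>))) \<le> ennreal M"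
    (is "?a + ?b \<le> _")
    using assms hol by (simp add: Lambda_norm_def Let_def)
  have "norm ((deriv ^^ i) f 0) \<le> M" if "i < ?K" for i
  proof -
    have "ennreal (norm ((deriv ^^ i) f 0)) \<le> ?a"
      using that by (intro member_le_sum) auto
    also have "\<dots> \<le> ?a + ?b" by simp
    also note le
    finally show ?thesis using \<open>M \<ge> 0\<close> by simp
  qed
  moreover have "norm ((deriv ^^ ?K) f z) * (1 - norm z) powr (real ?K - \<beta>) \<le> M" if "z \<in> unit_disk" for z
  proof -
    have "ennreal (norm ((deriv ^^ ?K) f z) * (1 - norm z) powr (real ?K - \<beta>)) \<le> ?b"
      using that by (intro SUP_upper)
    also have "\<dots> \<le> ?a + ?b" by simp
    also note le
    finally show ?thesis using \<open>M \<ge> 0\<close> by simp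
  qed
  ultimately show ?thesis using hol by (simp add: Lambda_le_def)
qed

lemma Lambda_le_nonneg: "Lambda_le \<beta> M f \<Longrightarrow> 0 \<le> M"
  unfolding Lambda_le_def by (force intro: order.trans[rotated] dest: bspec[of _ _ 0])

lemma Lambda_norm_leI:
  assumes "Lambda_le \<beta> M f"
  shows "Lambda_norm \<beta> f \<le> ennreal ((real (Lambda_order \<beta>) + 1) * M)"
proof -
  let ?K = "Lambda_order \<beta>"
  have M: "M \<ge> 0" using assms by (rule Lambda_le_nonneg)
  have "(\<Sum>j<?K. ennreal (norm ((deriv ^^ j) f 0))) \<le> (\<Sum>j<?K. ennreal M)"
    using assms by (intro sum_mono ennreal_leI) (auto simp: Lambda_le_def)
  moreover have "(SUP z\<in>unit_disk. ennreal (norm ((deriv ^^ ?K) f z) * (1 - norm z) powr (real ?K - \<beta>))) \<le> ennreal M"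
    using assms by (intro SUP_least ennreal_leI) (auto simp: Lambda_le_def)
  moreover have "(\<Sum>j<?K. ennreal M) + ennreal M = ennreal ((real (Lambda_order \<beta>) + 1) * M)"
    using M by (simp add: ennreal_of_nat_eq_real_of_nat ring_distribs flip: ennreal_mult ennreal_plus)
  ultimately show ?thesis
    using assms by (auto simp: Lambda_norm_def Lambda_le_def Let_def intro: order.trans[OF add_mono])
qed

section \<open>Cauchy estimates and integration along radii\<close>

lemma mult_powr_le_iff: "0 < x \<Longrightarrow> a * x powr c \<le> M \<longleftrightarrow> a \<le> M * x powr (- c)" for a c x M :: real
  by (simp add: powr_minus field_simps)

text \<open>Cauchy's inequality on the circle around z whose radius is half the distance to the
  boundary. There 1 - |x| is at least (1 - |z|) / 2, which costs the power of 2.\<close>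

lemma Cauchy_growth:
  assumes h: "h holomorphic_on unit_disk" and "\<gamma> \<ge> 0" "M \<ge> 0"
    and bound: "\<And>z. z \<in> unit_disk \<Longrightarrow> norm (h z) \<le> M * (1 - norm z) powr (-\<gamma>)"
    and z: "z \<in> unit_disk"
  shows "norm ((deriv ^^ n) h z) \<le> fact n * 2 powr (\<gamma> + n) * M * (1 - norm z) powr (-\<gamma> - n)"
proof -
  define r where "r = (1 - norm z) / 2"
  have r: "r > 0" using z by (simp add: r_def)
  have sub: "1 - norm x \<ge> r" if "norm (z - x) \<le> r" for x
    using that norm_triangle_ineq2[of x z] by (simp add: r_def norm_minus_commute field_simps)
  have cb: "cball z r \<subseteq> unit_disk"
    using sub r by (force simp: dist_norm)
  have "norm ((deriv ^^ n) h z) \<le> fact n * (M * r powr (-\<gamma>)) / r ^ n"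
  proof (rule Cauchy_inequality)
    show "h holomorphic_on ball z r"
      using h cb by (meson holomorphic_on_subset ball_subset_cball order.trans)
    show "continuous_on (cball z r) h"
      using h cb by (meson holomorphic_on_subset holomorphic_on_imp_continuous_on)
    fix x assume x: "norm (z - x) = r"
    have "norm (h x) \<le> M * (1 - norm x) powr (-\<gamma>)"
      using bound[of x] cb x by (auto simp: dist_norm)
    also have "\<dots> \<le> M * r powr (-\<gamma>)"
      using sub[of x] x r \<open>\<gamma> \<ge> 0\<close> \<open>M \<ge> 0\<close> by (intro mult_left_mono powr_mono2') auto
    finally show "norm (h x) \<le> M * r powr (-\<gamma>)" .
  qed (use r in auto)
  also have "\<dots> = fact n * M * r powr (-\<gamma> - n)"
    using r by (simp add: powr_diff powr_realpow)
  also have "r powr (-\<gamma> - n) = 2 powr (\<gamma> + n) * (1 - norm z) powr (-\<gamma> - n)"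
    using z by (simp add: r_def powr_divide powr_diff powr_add powr_minus field_simps)
  finally show ?thesis by (simp add: mult_ac)
qed

text \<open>Mean value inequality along a radius, with a real antiderivative P of the radial
  majorant as comparison function.\<close>

lemma radial_bound:
  assumes h: "h holomorphic_on unit_disk"
    and P: "\<And>t. 0 \<le> t \<Longrightarrow> t < 1 \<Longrightarrow> (P has_real_derivative p t) (at t)"
    and bound: "\<And>z. z \<in> unit_disk \<Longrightarrow> norm (deriv h z) \<le> p (norm z)"
    and \<zeta>: "norm \<zeta> = 1" and ab: "0 \<le> a" "a \<le> b" "b < 1"
  shows "norm (h (of_real b * \<zeta>) - h (of_real a * \<zeta>)) \<le> P b - P a"
proof (cases "a = b")
  case False
  have D: "((\<lambda>t. h (of_real t * \<zeta>)) has_vector_derivative (\<zeta> * deriv h (of_real t * \<zeta>))) (at t)"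
    if "0 \<le> t" "t < 1" for t
  proof -
    have "of_real t * \<zeta> \<in> unit_disk" using that \<zeta> by (simp add: norm_mult)
    then have "(h has_field_derivative deriv h (of_real t * \<zeta>)) (at (of_real t * \<zeta>))"
      using holomorphic_derivI[OF h open_ball] by blast
    moreover have "((\<lambda>t. of_real t * \<zeta>) has_vector_derivative \<zeta>) (at t)"
      by (auto intro!: derivative_eq_intros)
    ultimately show ?thesis
      using field_vector_diff_chain_at[of "\<lambda>t. of_real t * \<zeta>" \<zeta> t h] by (simp add: o_def)
  qed
  show ?thesis
  proof (rule differentiable_bound_general[where \<phi>' = p])
    show "continuous_on {a..b} (\<lambda>t. h (of_real t * \<zeta>))"
      by (intro continuous_at_imp_continuous_on ballI has_vector_derivative_continuous[OF D]) (use ab in auto)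
    show "continuous_on {a..b} P"
      by (intro continuous_at_imp_continuous_on ballI DERIV_isCont[OF P]) (use ab in auto)
    fix t assume t: "a < t" "t < b"
    show "((\<lambda>t. h (of_real t * \<zeta>)) has_vector_derivative (\<zeta> * deriv h (of_real t * \<zeta>))) (at t)"
      using D t ab by simp
    show "(P has_vector_derivative p t) (at t)"
      using P t ab by (simp add: has_real_derivative_iff_has_vector_derivative)
    show "norm (\<zeta> * deriv h (of_real t * \<zeta>)) \<le> p t"
      using bound[of "of_real t * \<zeta>"] t ab \<zeta> by (simp add: norm_mult)
  qed (use ab False in auto)
qed simp

lemma unit_direction:
  obtains \<zeta> :: complex where "norm \<zeta> = 1" "z = of_real (norm z) * \<zeta>"
proof (cases "z = 0")
  case True then show ?thesis using that[of 1] by simp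
next
  case False then show ?thesis using that[of "sgn z"]
    by (simp add: norm_divide sgn_eq)
qed

text \<open>One antiderivative serves both signs of \<gamma> - 1: for \<gamma> < 1 it yields Hoelder
  continuity up to the circle, for \<gamma> > 1 a growth rate with exponent lowered by one.\<close>

lemma radial_powr:
  assumes h: "h holomorphic_on unit_disk" and \<gamma>: "\<gamma> \<noteq> 1"
    and bound: "\<And>z. z \<in> unit_disk \<Longrightarrow> norm (deriv h z) \<le> M * (1 - norm z) powr (-\<gamma>)"
    and \<zeta>: "norm \<zeta> = 1" and ab: "0 \<le> a" "a \<le> b" "b < 1"
  shows "norm (h (of_real b * \<zeta>) - h (of_real a * \<zeta>))
      \<le> M / (\<gamma> - 1) * ((1 - b) powr (1 - \<gamma>) - (1 - a) powr (1 - \<gamma>))"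
proof -
  have "((\<lambda>t. M / (\<gamma> - 1) * (1 - t) powr (1 - \<gamma>)) has_real_derivative M * (1 - t) powr (-\<gamma>)) (at t)"
    if "0 \<le> t" "t < 1" for t
  proof -
    have "((\<lambda>t. (1 - t) powr (1 - \<gamma>)) has_real_derivative (\<gamma> - 1) * (1 - t) powr (-\<gamma>)) (at t)"
      using that by (auto intro!: derivative_eq_intros simp: algebra_simps)
    from DERIV_cmult[OF this, of "M / (\<gamma> - 1)"] show ?thesis using \<gamma> by simp
  qed
  from radial_bound[OF h this bound \<zeta> ab] show ?thesis
    by (simp add: right_diff_distrib)
qed

lemma radial_log:
  assumes h: "h holomorphic_on unit_disk"
    and bound: "\<And>z. z \<in> unit_disk \<Longrightarrow> norm (deriv h z) \<le> M * (1 - norm z) powr (-1)"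
    and z: "z \<in> unit_disk"
  shows "norm (h z - h 0) \<le> - M * ln (1 - norm z)"
proof -
  obtain \<zeta> where \<zeta>: "norm \<zeta> = 1" "z = of_real (norm z) * \<zeta>" by (rule unit_direction)
  have "((\<lambda>t. - M * ln (1 - t)) has_real_derivative M * (1 - t) powr (-1)) (at t)"
    if "0 \<le> t" "t < 1" for t
    using that by (auto intro!: derivative_eq_intros simp: powr_minus field_simps)
  from radial_bound[OF h this bound \<zeta>(1), of 0 "norm z"] z \<zeta>(2)[symmetric] show ?thesis
    by simp
qed

text \<open>The weight of the next derivative is integrable up to the circle. The exponent is 0 for
  a trivial weight, \<open>Suc i - \<beta>\<close> for a power, and for the logarithm 1/2, which
  comes from ln x \<le> x - 1 at x = (1 - t)^(-1/2).\<close>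

lemma Omega_Suc_le_powr:
  assumes "real i < \<beta>"
  obtains C \<gamma> where "C > 0" "0 \<le> \<gamma>" "\<gamma> < 1"
    "\<And>t. 0 \<le> t \<Longrightarrow> t < 1 \<Longrightarrow> Omega (Suc i) \<beta> t \<le> C * (1 - t) powr (-\<gamma>)"
proof (cases "real (Suc i)" \<beta> rule: linorder_cases)
  case less
  show ?thesis by (rule that[of 1 0]) (use less in \<open>auto simp: Omega_alt\<close>)
next
  case equal
  show ?thesis
  proof (rule that[of 2 "1/2"])
    fix t :: real assume t: "0 \<le> t" "t < 1"
    have "- ln (1 - t) / 2 = ln ((1 - t) powr (-1/2))"
      using t by (simp add: ln_powr)
    also have "\<dots> \<le> (1 - t) powr (-1/2) - 1"
      using t by (intro ln_le_minus_one) simp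
    finally have "1 - ln (1 - t) \<le> 2 * (1 - t) powr (-1/2)" by simp
    then show "Omega (Suc i) \<beta> t \<le> 2 * (1 - t) powr (- (1 / 2))"
      using equal ln_weight[OF t] by (simp add: Omega_alt)
  qed auto
next
  case greater
  show ?thesis by (rule that[of 1 "real (Suc i) - \<beta>"]) (use assms greater in \<open>auto simp: Omega_alt\<close>)
qed

section \<open>Growth and radial continuity of the derivatives of every order\<close>

definition deriv_growth :: "real \<Rightarrow> nat \<Rightarrow> real \<Rightarrow> bool" where
  "deriv_growth \<beta> i C \<longleftrightarrow> 0 < C \<and> (\<forall>M f. Lambda_le \<beta> M f \<longrightarrow>
     (\<forall>z\<in>unit_disk. norm ((deriv ^^ i) f z) \<le> C * M * Omega i \<beta> (norm z)))"

lemma deriv_growth_pos: "deriv_growth \<beta> i C \<Longrightarrow> 0 < C"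
  by (simp add: deriv_growth_def)

lemma deriv_growthD: "deriv_growth \<beta> i C \<Longrightarrow> Lambda_le \<beta> M f \<Longrightarrow> z \<in> unit_disk \<Longrightarrow>
    norm ((deriv ^^ i) f z) \<le> C * M * Omega i \<beta> (norm z)"
  by (simp add: deriv_growth_def)

text \<open>The modulus is measured by 1 - a and not by b - a, because what matters later is the
  oscillation on the whole outer part of a radius.\<close>

definition radially_Hoelder :: "real \<Rightarrow> nat \<Rightarrow> real \<Rightarrow> real \<Rightarrow> bool" where
  "radially_Hoelder \<beta> i D \<gamma> \<longleftrightarrow> 0 < D \<and> \<gamma> < 1 \<and>
     (\<forall>M f \<zeta> a b. Lambda_le \<beta> M f \<longrightarrow> norm \<zeta> = 1 \<longrightarrow> 0 \<le> a \<longrightarrow> a \<le> b \<longrightarrow> b < 1 \<longrightarrow>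
       norm ((deriv ^^ i) f (of_real b * \<zeta>) - (deriv ^^ i) f (of_real a * \<zeta>)) \<le> D * M * (1 - a) powr (1 - \<gamma>))"

lemma radially_HoelderD:
  assumes "radially_Hoelder \<beta> i D \<gamma>" "Lambda_le \<beta> M f" "norm \<zeta> = 1" "0 \<le> a" "a \<le> b" "b < 1"
  shows "norm ((deriv ^^ i) f (of_real b * \<zeta>) - (deriv ^^ i) f (of_real a * \<zeta>)) \<le> D * M * (1 - a) powr (1 - \<gamma>)"
  using assms unfolding radially_Hoelder_def by blast

lemma radially_Hoelder_exists:
  assumes C: "deriv_growth \<beta> (Suc i) C" and i: "real i < \<beta>"
  shows "\<exists>D \<gamma>. radially_Hoelder \<beta> i D \<gamma>"
proof -
  note C0 = deriv_growth_pos[OF C]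
  obtain D \<gamma> where D: "D > 0" "0 \<le> \<gamma>" "\<gamma> < 1"
    "\<And>t. 0 \<le> t \<Longrightarrow> t < 1 \<Longrightarrow> Omega (Suc i) \<beta> t \<le> D * (1 - t) powr (-\<gamma>)"
    using Omega_Suc_le_powr[OF i] by blast
  have "radially_Hoelder \<beta> i (C * D / (1 - \<gamma>)) \<gamma>"
    unfolding radially_Hoelder_def
  proof (intro conjI allI impI)
    fix M a b :: real and f and \<zeta> :: complex
    assume f: "Lambda_le \<beta> M f" and \<zeta>: "norm \<zeta> = 1" and ab: "0 \<le> a" "a \<le> b" "b < 1"
    have M: "0 \<le> M" using f by (rule Lambda_le_nonneg)
    have "norm ((deriv ^^ i) f (of_real b * \<zeta>) - (deriv ^^ i) f (of_real a * \<zeta>))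
       \<le> (C * M * D) / (\<gamma> - 1) * ((1 - b) powr (1 - \<gamma>) - (1 - a) powr (1 - \<gamma>))"
    proof (rule radial_powr)
      show "(deriv ^^ i) f holomorphic_on unit_disk"
        using f by (auto simp: Lambda_le_def intro!: holomorphic_intros)
      fix w :: complex assume w: "w \<in> unit_disk"
      have "norm ((deriv ^^ Suc i) f w) \<le> C * M * Omega (Suc i) \<beta> (norm w)"
        using deriv_growthD[OF C f w] .
      also have "\<dots> \<le> C * M * (D * (1 - norm w) powr (-\<gamma>))"
        using w M C0 D by (intro mult_left_mono D) auto
      finally show "norm (deriv ((deriv ^^ i) f) w) \<le> C * M * D * (1 - norm w) powr (-\<gamma>)"
        by (simp add: mult_ac)
    qed (use D \<zeta> ab in auto)
    also have "\<dots> = (C * M * D) / (1 - \<gamma>) * ((1 - a) powr (1 - \<gamma>) - (1 - b) powr (1 - \<gamma>))"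
      using D by (simp add: field_simps)
    also have "\<dots> \<le> (C * M * D) / (1 - \<gamma>) * (1 - a) powr (1 - \<gamma>)"
      using C0 D M by (intro mult_left_mono) auto
    finally show "norm ((deriv ^^ i) f (of_real b * \<zeta>) - (deriv ^^ i) f (of_real a * \<zeta>))
      \<le> C * D / (1 - \<gamma>) * M * (1 - a) powr (1 - \<gamma>)"
      by (simp add: mult_ac)
  qed (use C0 D in auto)
  then show ?thesis by blast
qed

text \<open>Downward induction. From \<open>Lambda_order \<beta>\<close> upwards Cauchy's inequality
  is applied to the derivative that the norm controls. Each order below follows by integrating the
  next one, which gives a logarithm at order \<beta> and boundedness below.\<close>

lemma higher_deriv_growth:
  "\<exists>C. deriv_growth \<beta> i C"
proof (induction "Lambda_order \<beta> - i" arbitrary: i)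
  \<comment> \<open>Subtraction is truncated, so this case covers every order from
    \<open>Lambda_order \<beta>\<close> upwards.\<close>
  case 0
  let ?K = "Lambda_order \<beta>"
  have Ki: "?K \<le> i" using 0 by simp
  have i: "\<beta> < real i" using Lambda_order_gt[of \<beta>] Ki by linarith
  define C where "C = fact (i - ?K) * 2 powr (real ?K - \<beta> + real (i - ?K))"
  have "deriv_growth \<beta> i C"
    unfolding deriv_growth_def
  proof (intro conjI allI impI ballI)
    show "C > 0" by (simp add: C_def)
    fix M f and z :: complex assume f: "Lambda_le \<beta> M f" and z: "z \<in> unit_disk"
    have "norm ((deriv ^^ (i - ?K)) ((deriv ^^ ?K) f) z)
      \<le> fact (i - ?K) * 2 powr (real ?K - \<beta> + real (i - ?K)) * M * (1 - norm z) powr (-(real ?K - \<beta>) - real (i - ?K))"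
    proof (rule Cauchy_growth)
      show "(deriv ^^ ?K) f holomorphic_on unit_disk"
        using f by (auto simp: Lambda_le_def intro!: holomorphic_intros)
      fix w :: complex assume w: "w \<in> unit_disk"
      then show "norm ((deriv ^^ ?K) f w) \<le> M * (1 - norm w) powr (-(real ?K - \<beta>))"
        by (subst mult_powr_le_iff[symmetric]) (use f w in \<open>auto simp: Lambda_le_def\<close>)
    qed (use z Lambda_order_gt[of \<beta>] Lambda_le_nonneg[OF f] in auto)
    also have "(deriv ^^ (i - ?K)) ((deriv ^^ ?K) f) z = (deriv ^^ i) f z"
      using Ki by (simp flip: funpow_add o_apply[of "deriv ^^ _"])
    also have "(-(real ?K - \<beta>) - real (i - ?K)) = \<beta> - real i"
      using Ki by simp
    finally show "norm ((deriv ^^ i) f z) \<le> C * M * Omega i \<beta> (norm z)"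
      using i by (simp add: C_def Omega_alt)
  qed
  then show ?case ..
next
  case (Suc n)
  let ?K = "Lambda_order \<beta>"
  have iK: "i < ?K" using Suc by simp
  then have i: "real i \<le> \<beta>" by (simp add: less_Lambda_order_iff)
  have "n = Lambda_order \<beta> - Suc i" using Suc(2) by simp
  from Suc(1)[OF this] obtain C where Cg: "deriv_growth \<beta> (Suc i) C" ..
  note C = deriv_growth_pos[OF Cg] deriv_growthD[OF Cg]
  have hol: "(deriv ^^ i) f holomorphic_on unit_disk" if "Lambda_le \<beta> M f" for M f
    using that by (auto simp: Lambda_le_def intro!: holomorphic_intros)
  show ?case
  proof (cases "real i = \<beta>")
    case True
    have "deriv_growth \<beta> i (C + 1)"
      unfolding deriv_growth_def
    proof (intro conjI allI impI ballI)
      fix M f and z :: complex assume f: "Lambda_le \<beta> M f" and z: "z \<in> unit_disk"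
      have M: "0 \<le> M" using f by (rule Lambda_le_nonneg)
      have "norm ((deriv ^^ i) f z - (deriv ^^ i) f 0) \<le> - (C * M) * ln (1 - norm z)"
      proof (rule radial_log)
        fix w :: complex assume "w \<in> unit_disk"
        then show "norm (deriv ((deriv ^^ i) f) w) \<le> C * M * (1 - norm w) powr (-1)"
          using C(2)[OF f, of w] by (simp add: Omega_alt True[symmetric])
      qed (use hol[OF f] z in auto)
      moreover have "norm ((deriv ^^ i) f 0) \<le> M"
        using f iK by (auto simp: Lambda_le_def)
      ultimately have "norm ((deriv ^^ i) f z) \<le> M - C * M * ln (1 - norm z)"
        using norm_triangle_ineq2[of "(deriv ^^ i) f z" "(deriv ^^ i) f 0"] by simp
      \<comment> \<open>Used with L = ln (1 - |z|) \<le> 0, for which the last bracket is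
        nonnegative.\<close>
      moreover have "(C + 1) * M * (1 - L) = M - C * M * L + (C * M - M * L)" for L :: real
        by (simp add: ring_distribs)
      moreover have "M * ln (1 - norm z) \<le> 0"
        using M z by (intro mult_nonneg_nonpos) simp_all
      moreover have "0 \<le> C * M" using M C(1) by simp
      ultimately have "norm ((deriv ^^ i) f z) \<le> (C + 1) * M * (1 - ln (1 - norm z))"
        by (metis add_increasing2 diff_ge_0_iff_ge order.trans)
      then show "norm ((deriv ^^ i) f z) \<le> (C + 1) * M * Omega i \<beta> (norm z)"
        using True z by (simp add: Omega_alt ln_div)
    qed (use C in simp)
    then show ?thesis ..
  next
    case False
    with i have i: "real i < \<beta>" by simp
    obtain D \<gamma> where D: "radially_Hoelder \<beta> i D \<gamma>" using radially_Hoelder_exists[OF Cg i] by blast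
    have "deriv_growth \<beta> i (1 + D)"
      unfolding deriv_growth_def
    proof (intro conjI allI impI ballI)
      fix M f and z :: complex assume f: "Lambda_le \<beta> M f" and z: "z \<in> unit_disk"
      obtain \<zeta> where \<zeta>: "norm \<zeta> = 1" "z = of_real (norm z) * \<zeta>" by (rule unit_direction)
      have "norm ((deriv ^^ i) f z - (deriv ^^ i) f 0) \<le> D * M"
        using radially_HoelderD[OF D f \<zeta>(1), of 0 "norm z"] z \<zeta>(2)[symmetric] by simp
      moreover have "norm ((deriv ^^ i) f 0) \<le> M"
        using f iK by (auto simp: Lambda_le_def)
      ultimately have "norm ((deriv ^^ i) f z) \<le> M + D * M"
        using norm_triangle_ineq2[of "(deriv ^^ i) f z" "(deriv ^^ i) f 0"] by simp
      then show "norm ((deriv ^^ i) f z) \<le> (1 + D) * M * Omega i \<beta> (norm z)"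
        using i by (simp add: Omega_alt algebra_simps)
    qed (use D in \<open>simp add: radially_Hoelder_def\<close>)
    then show ?thesis ..
  qed
qed

text \<open>The norm of \<open>\<Lambda>\<^sup>\<alpha>\<close> may be computed with any derivative of order above \<open>\<alpha>\<close>.\<close>

lemma Lambda_leI_higher:
  assumes J: "\<alpha> < real J"
  obtains C where "C > 0"
    "\<And>F m M. F holomorphic_on unit_disk \<Longrightarrow> 0 \<le> m \<Longrightarrow> (\<And>i. i < J \<Longrightarrow> norm ((deriv ^^ i) F 0) \<le> m) \<Longrightarrow>
      (\<And>z. z \<in> unit_disk \<Longrightarrow> norm ((deriv ^^ J) F z) \<le> M * (1 - norm z) powr (\<alpha> - real J)) \<Longrightarrow>
      Lambda_le \<alpha> (C * (m + M)) F"
proof -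
  let ?K = "Lambda_order \<alpha>"
  have KJ: "?K \<le> J" using J by (rule Lambda_order_le)
  \<comment> \<open>The bound is pulled down from order J one order at a time. Each order i on the
    way exceeds \<alpha>, so integration lowers the exponent by exactly one without producing a
    logarithm.\<close>
  have "\<exists>C\<ge>1. \<forall>F m M. F holomorphic_on unit_disk \<longrightarrow> 0 \<le> m \<longrightarrow> (\<forall>i<J. norm ((deriv ^^ i) F 0) \<le> m) \<longrightarrow>
      (\<forall>z\<in>unit_disk. norm ((deriv ^^ J) F z) \<le> M * (1 - norm z) powr (\<alpha> - real J)) \<longrightarrow>
      (\<forall>z\<in>unit_disk. norm ((deriv ^^ i) F z) \<le> C * (m + M) * (1 - norm z) powr (\<alpha> - real i))"
    if "i \<le> J" "?K \<le> i" for i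
    using that
  proof (induction i rule: inc_induct)
    case base
    show ?case by (rule exI[of _ 1]) (auto simp: ring_distribs intro: order.trans)
  next
    case (step i)
    have i\<alpha>: "\<alpha> < real i" using Lambda_order_gt[of \<alpha>] step.prems by linarith
    obtain C where C: "C \<ge> 1" "\<And>F m M z. F holomorphic_on unit_disk \<Longrightarrow> 0 \<le> m \<Longrightarrow> (\<forall>i<J. norm ((deriv ^^ i) F 0) \<le> m) \<Longrightarrow>
      (\<forall>z\<in>unit_disk. norm ((deriv ^^ J) F z) \<le> M * (1 - norm z) powr (\<alpha> - real J)) \<Longrightarrow> z \<in> unit_disk \<Longrightarrow>
      norm ((deriv ^^ Suc i) F z) \<le> C * (m + M) * (1 - norm z) powr (\<alpha> - real (Suc i))"
      using step.IH step.prems by (auto simp del: funpow.simps of_nat_Suc)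
    show ?case
    \<comment> \<open>C / (i - \<alpha>) comes from integrating the power, and the 1 pays for the
      value at 0, which is absorbed because the weight \<open>W\<close> below is at least 1.\<close>
    proof (intro exI[of _ "1 + C / (real i - \<alpha>)"] conjI allI impI ballI)
      show "1 + C / (real i - \<alpha>) \<ge> 1" using C i\<alpha> by simp
      fix F m M and z :: complex
      assume F: "F holomorphic_on unit_disk" and m: "0 \<le> m" "\<forall>i<J. norm ((deriv ^^ i) F 0) \<le> m"
        and M: "\<forall>z\<in>unit_disk. norm ((deriv ^^ J) F z) \<le> M * (1 - norm z) powr (\<alpha> - real J)"
        and z: "z \<in> unit_disk"
      have M0: "0 \<le> M" using M[rule_format, of 0] norm_ge_zero[of "(deriv ^^ J) F 0"] by (simp del: norm_ge_zero)
      define W where "W = (1 - norm z) powr (\<alpha> - real i)"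
      have W: "W \<ge> 1" using powr_mono2'[of "\<alpha> - i" "1 - norm z" 1] i\<alpha> z by (simp add: W_def)
      obtain \<zeta> where \<zeta>: "norm \<zeta> = 1" "z = of_real (norm z) * \<zeta>" by (rule unit_direction)
      have "norm ((deriv ^^ i) F (of_real (norm z) * \<zeta>) - (deriv ^^ i) F (of_real 0 * \<zeta>))
         \<le> (C * (m + M)) / ((real (Suc i) - \<alpha>) - 1) * ((1 - norm z) powr (1 - (real (Suc i) - \<alpha>)) - (1 - 0) powr (1 - (real (Suc i) - \<alpha>)))"
        by (rule radial_powr) (use C(2)[OF F m M] F \<zeta> z i\<alpha> in \<open>auto intro!: holomorphic_intros\<close>)
      also have "\<dots> = C * (m + M) / (real i - \<alpha>) * (W - 1)"
        by (simp add: W_def)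
      finally have "norm ((deriv ^^ i) F z - (deriv ^^ i) F 0) \<le> C * (m + M) / (real i - \<alpha>) * (W - 1)"
        using \<zeta>(2)[symmetric] by simp
      also have "\<dots> \<le> C * (m + M) / (real i - \<alpha>) * W"
        using C m M0 i\<alpha> by (intro mult_left_mono) auto
      finally have "norm ((deriv ^^ i) F z) \<le> m + C * (m + M) / (real i - \<alpha>) * W"
        using norm_triangle_ineq2[of "(deriv ^^ i) F z" "(deriv ^^ i) F 0"] m(2)[rule_format, of i] step.hyps by simp
      moreover have "m \<le> (m + M) * W"
        using mult_mono[of m "m + M" 1 W] W m M0 by simp
      moreover have "(1 + C / (real i - \<alpha>)) * (m + M) * W = (m + M) * W + C * (m + M) / (real i - \<alpha>) * W"
        by (simp add: ring_distribs add_divide_distrib)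
      ultimately show "norm ((deriv ^^ i) F z) \<le> (1 + C / (real i - \<alpha>)) * (m + M) * (1 - norm z) powr (\<alpha> - real i)"
        unfolding W_def by linarith
    qed
  qed
  from this[OF KJ order.refl] obtain C where C: "C \<ge> 1" "\<And>F m M z. F holomorphic_on unit_disk \<Longrightarrow> 0 \<le> m \<Longrightarrow>
      (\<forall>i<J. norm ((deriv ^^ i) F 0) \<le> m) \<Longrightarrow>
      (\<forall>z\<in>unit_disk. norm ((deriv ^^ J) F z) \<le> M * (1 - norm z) powr (\<alpha> - real J)) \<Longrightarrow> z \<in> unit_disk \<Longrightarrow>
      norm ((deriv ^^ ?K) F z) \<le> C * (m + M) * (1 - norm z) powr (\<alpha> - real ?K)"
    by blast
  show ?thesis
  proof (rule that[of C])
    fix F m M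
    assume F: "F holomorphic_on unit_disk" and m: "0 \<le> m" "\<And>i. i < J \<Longrightarrow> norm ((deriv ^^ i) F 0) \<le> m"
      and M: "\<And>z. z \<in> unit_disk \<Longrightarrow> norm ((deriv ^^ J) F z) \<le> M * (1 - norm z) powr (\<alpha> - real J)"
    have M0: "0 \<le> M" using M[of 0] norm_ge_zero[of "(deriv ^^ J) F 0"] by (simp del: norm_ge_zero)
    have "m \<le> C * (m + M)"
      using mult_mono[of 1 C m "m + M"] C m M0 by simp
    then have "norm ((deriv ^^ i) F 0) \<le> C * (m + M)" if "i < ?K" for i
      using m(2)[of i] that KJ by linarith
    moreover have "norm ((deriv ^^ ?K) F z) * (1 - norm z) powr (real ?K - \<alpha>) \<le> C * (m + M)"
      if z: "z \<in> unit_disk" for z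
      by (subst mult_powr_le_iff) (use C(2)[OF F m(1) _ _ z] m(2) M z in auto)
    ultimately show "Lambda_le \<alpha> (C * (m + M)) F"
      using F unfolding Lambda_le_def by blast
  qed (use C in auto)
qed

section \<open>Weighted norms of monomials\<close>

lemma Limsup_bdry_le:
  assumes "\<delta> < 1"
  shows "Limsup_bdry \<phi> F \<le> (SUP z\<in>{z \<in> unit_disk. norm (\<phi> z) > \<delta>}. F z)"
proof (rule tendsto_upperbound[OF tendsto_Limsup_bdry])
  show "\<forall>\<^sub>F \<delta>' in at_left 1. (SUP z\<in>{z \<in> unit_disk. norm (\<phi> z) > \<delta>'}. F z)
      \<le> (SUP z\<in>{z \<in> unit_disk. norm (\<phi> z) > \<delta>}. F z)"
    unfolding eventually_at_left[OF assms] using assms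
    by (intro exI[of _ \<delta>] conjI allI impI SUP_subset_mono) auto
qed simp

lemma Limsup_bdry_less:
  assumes "Limsup_bdry \<phi> F < a"
  obtains \<delta> where "0 \<le> \<delta>" "\<delta> < 1" "\<And>z. z \<in> unit_disk \<Longrightarrow> \<delta> < norm (\<phi> z) \<Longrightarrow> F z < a"
proof -
  have "\<forall>\<^sub>F \<delta> in at_left (1::real). (SUP z\<in>{z \<in> unit_disk. norm (\<phi> z) > \<delta>}. F z) < a"
    using order_tendstoD(2)[OF tendsto_Limsup_bdry assms] .
  moreover have "\<forall>\<^sub>F \<delta> in at_left (1::real). \<delta> \<in> {0..<1}"
    by (rule eventually_at_leftI[of 0]) auto
  ultimately have "\<exists>\<delta>. (SUP z\<in>{z \<in> unit_disk. norm (\<phi> z) > \<delta>}. F z) < a \<and> \<delta> \<in> {0..<1}"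
    by (intro eventually_happens'[OF _ eventually_conj]) auto
  then obtain \<delta> where "(SUP z\<in>{z \<in> unit_disk. norm (\<phi> z) > \<delta>}. F z) < a" "\<delta> \<in> {0..<1}" by blast
  moreover have "F z \<le> (SUP z\<in>{z \<in> unit_disk. norm (\<phi> z) > \<delta>}. F z)"
    if "z \<in> unit_disk" "\<delta> < norm (\<phi> z)" for z
    using that by (intro SUP_upper) auto
  ultimately show ?thesis
    by (intro that[of \<delta>]) (auto dest: le_less_trans)
qed

text \<open>With y = 1 - s one has s^n \<le> exp(-n y), and y^c exp(-n y) is largest at y = c / n.
  The maximum is verified by 1 + x \<le> exp x at x = n y / c - 1.\<close>

lemma powr_weight_peak:
  fixes c :: real
  assumes "0 \<le> s" "s < 1" "n > 0" "c > 0"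
  shows "s ^ n * (1 - s) powr c \<le> (c / n) powr c * exp (- c)"
proof -
  define y where "y = 1 - s"
  have y: "y > 0" using assms by (simp add: y_def)
  have "s \<le> exp (- y)" using exp_ge_add_one_self[of "- y"] by (simp add: y_def)
  then have "s ^ n \<le> exp (- y) ^ n" using assms by (intro power_mono) auto
  also have "\<dots> = exp (- (n * y))" by (simp flip: exp_of_nat_mult)
  finally have 1: "s ^ n \<le> exp (- (n * y))" .
  have "n * y / c \<le> exp (n * y / c - 1)"
    using exp_ge_add_one_self[of "n * y / c - 1"] by simp
  then have "(n * y / c) powr c \<le> exp (n * y / c - 1) powr c"
    using assms y by (intro powr_mono2) auto
  also have "\<dots> = exp (n * y - c)"
    using assms by (simp add: powr_def field_simps)
  finally have "y powr c * exp (- (n * y)) \<le> (c / n) powr c * exp (- c)"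
    using assms y by (simp add: powr_mult powr_divide exp_diff exp_minus field_simps)
  moreover have "s ^ n * y powr c \<le> exp (- (n * y)) * y powr c"
    using 1 by (intro mult_right_mono) auto
  ultimately show ?thesis by (simp add: y_def mult_ac)
qed

text \<open>For \<open>s\<close> ranging over \<open>[0, 1)\<close>, the inequality says that \<open>t ^ n / \<omega> t\<close> is within the factor \<open>c\<close> of
  the norm of the monomial of degree \<open>n\<close>.\<close>

definition monomial_peaks :: "(real \<Rightarrow> real) \<Rightarrow> bool" where
  "monomial_peaks \<omega> \<longleftrightarrow> (\<forall>c<1. \<forall>m. \<forall>\<^sub>F t in at_left (1::real).
     \<exists>n\<ge>m. \<forall>s\<in>{0..<1}. c * (s ^ n * \<omega> t) \<le> t ^ n * \<omega> s)"

lemma at_left_1_compose: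
  assumes "\<forall>\<^sub>F x in at_right (0::real). P x"
  shows "\<forall>\<^sub>F t in at_left (1::real). P (1 - t)"
proof -
  have "filterlim (\<lambda>t::real. 1 - t) (at_right 0) (at_left 1)" by real_asymp
  then show ?thesis using assms by (simp add: filterlim_iff)
qed

text \<open>By \<open>powr_weight_peak\<close> the monomial of degree n peaks where 1 - s is about b
  / n, so for t = 1 - x the degree is b / x rounded down.\<close>

lemma monomial_peaks_powr:
  fixes b :: real
  assumes b: "b > 0"
  shows "monomial_peaks (\<lambda>t. (1 - t) powr (- b))"
  unfolding monomial_peaks_def
proof (intro allI impI)
  fix c :: real and m :: nat assume c: "c < 1"
  \<comment> \<open>A lower bound for the ratio of the value at t = 1 - x to the bound of
    \<open>powr_weight_peak\<close>: the second factor bounds t^n and the third bounds (n x / b)^b,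
    where rounding may lose 1 in n.\<close>
  have lim: "((\<lambda>x. exp b * (1 - x) powr (b / x) * (1 - x / b) powr b) \<longlongrightarrow> 1) (at_right 0)"
    using b by (real_asymp simp add: exp_minus_inverse)
  have "\<forall>\<^sub>F x in at_right 0. c < exp b * (1 - x) powr (b / x) * (1 - x / b) powr b"
    using order_tendstoD(1)[OF lim c] .
  \<comment> \<open>The additional 1 keeps the rounded degree positive even when m = 0.\<close>
  moreover have "\<forall>\<^sub>F x in at_right 0. b / x - 1 \<ge> real m + 1" using b by real_asymp
  moreover have "\<forall>\<^sub>F x in at_right (0::real). x < 1" by real_asymp
  moreover have "\<forall>\<^sub>F x in at_right (0::real). x > 0" by real_asymp
  ultimately have "\<forall>\<^sub>F x in at_right 0. \<exists>n\<ge>m. \<forall>s\<in>{0..<1}. c * (s ^ n * x powr (-b)) \<le> (1 - x) ^ n * (1 - s) powr (-b)"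
  proof eventually_elim
    case (elim x)
    define n where "n = nat \<lfloor>b / x\<rfloor>"
    have n1: "real n \<le> b / x" and n2: "b / x - 1 \<le> real n"
      using b elim unfolding n_def by linarith+
    have n: "m \<le> n" "n > 0" using n2 elim by linarith+
    show ?case
    proof (intro exI[of _ n] conjI ballI n)
      fix s :: real assume s: "s \<in> {0..<1}"
      have "(1 - x) powr (b / x) \<le> (1 - x) powr real n"
        using elim n1 by (intro powr_mono') auto
      then have t: "(1 - x) powr (b / x) \<le> (1 - x) ^ n"
        using elim by (simp add: powr_realpow)
      have "1 \<le> b / x" using elim by linarith
      then have xb: "0 < x / b" "x / b \<le> 1" using b elim by (auto simp: field_simps)
      have "1 - x / b = (b / x - 1) * (x / b)" using elim b by (simp add: field_simps)
      also have "\<dots> \<le> n * (x / b)" using n2 xb by (intro mult_right_mono) auto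
      finally have "1 - x / b \<le> n * x / b" by simp
      then have "(1 - x / b) powr b \<le> (n * x / b) powr b"
        using b xb by (intro powr_mono2) auto
      also have "\<dots> = x powr b / (b / n) powr b"
        using b elim n by (simp add: powr_mult powr_divide field_simps)
      finally have x: "(1 - x / b) powr b \<le> x powr b / (b / n) powr b" .
      have "c * (s ^ n * (1 - s) powr b) \<le> (1 - x) ^ n * x powr b"
      proof (cases "c \<le> 0")
        case True
        then have "c * (s ^ n * (1 - s) powr b) \<le> 0" using s by (intro mult_nonpos_nonneg) auto
        also have "0 \<le> (1 - x) ^ n * x powr b" using elim by simp
        finally show ?thesis .
      next
        case False
        have "c * (s ^ n * (1 - s) powr b) \<le> c * ((b / n) powr b * exp (- b))"
          using s n b False by (intro mult_left_mono powr_weight_peak) auto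
        also have "\<dots> \<le> (exp b * (1 - x) powr (b / x) * (1 - x / b) powr b) * ((b / n) powr b * exp (- b))"
          using elim by (intro mult_right_mono) auto
        also have "\<dots> = (1 - x) powr (b / x) * (1 - x / b) powr b * (b / n) powr b"
          by (simp add: exp_minus)
        also have "\<dots> \<le> (1 - x) ^ n * (x powr b / (b / n) powr b) * (b / n) powr b"
          using t x elim by (intro mult_right_mono mult_mono) auto
        also have "\<dots> = (1 - x) ^ n * x powr b" using b n by simp
        finally show ?thesis .
      qed
      then show "c * (s ^ n * x powr (-b)) \<le> (1 - x) ^ n * (1 - s) powr (-b)"
        using s elim by (simp add: powr_minus field_simps)
    qed
  qed
  from at_left_1_compose[OF this]
  show "\<forall>\<^sub>F t in at_left 1. \<exists>n\<ge>m. \<forall>s\<in>{0..<1}. c * (s ^ n * (1 - t) powr (-b)) \<le> t ^ n * (1 - s) powr (-b)"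
    by simp
qed

text \<open>The logarithm varies slowly, so there is room between two scales. With n close to 1 / (x
  ln(1/x)) the power (1 - x)^n still tends to 1. Where 1 - s exceeds \<epsilon> x, s^n is already
  negligible against 1 - ln x; where it does not, the weight at s is at least 1 - ln (\<epsilon> x),
  which is asymptotic to 1 - ln x.\<close>

lemma monomial_peaks_log: "monomial_peaks (\<lambda>t. 1 - ln (1 - t))"
  unfolding monomial_peaks_def
proof (intro allI impI)
  fix c :: real and m :: nat assume c: "c < 1"
  \<comment> \<open>Multiplied by 1 / (x ln(1/x)) this gives ln(1/x)^2, the exponent of decay in
    \<open>lim2\<close>.\<close>
  define \<epsilon> :: "real \<Rightarrow> real" where "\<epsilon> x = x * ln (1 / x) ^ 3" for x
  have lim1: "((\<lambda>x. (1 - 1 / ln (1 / x)) * (1 - ln (\<epsilon> x)) / (1 - ln x)) \<longlongrightarrow> 1) (at_right 0)"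
    unfolding \<epsilon>_def by real_asymp
  have lim2: "((\<lambda>x. (1 - ln x) * exp (\<epsilon> x - ln (1 / x) ^ 2)) \<longlongrightarrow> 0) (at_right 0)"
    unfolding \<epsilon>_def by real_asymp
  have "\<forall>\<^sub>F x in at_right 0. c < (1 - 1 / ln (1 / x)) * (1 - ln (\<epsilon> x)) / (1 - ln x)"
    using order_tendstoD(1)[OF lim1 c] .
  moreover have "\<forall>\<^sub>F x in at_right 0. (1 - ln x) * exp (\<epsilon> x - ln (1 / x) ^ 2) < 1 / 2"
    by (rule order_tendstoD(2)[OF lim2]) simp
  moreover have "\<forall>\<^sub>F x in at_right (0::real). 1 / ln (1 / x) \<le> 1 / 2" by real_asymp
  moreover have "\<forall>\<^sub>F x in at_right (0::real). 1 / (x * ln (1 / x)) - 1 \<ge> real m" by real_asymp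
  moreover have "\<forall>\<^sub>F x in at_right (0::real). ln (1 / x) > 1" by real_asymp
  moreover have "\<forall>\<^sub>F x in at_right (0::real). \<epsilon> x > 0" unfolding \<epsilon>_def by real_asymp
  moreover have "\<forall>\<^sub>F x in at_right (0::real). \<epsilon> x < 1" unfolding \<epsilon>_def by real_asymp
  moreover have "\<forall>\<^sub>F x in at_right (0::real). x < 1" by real_asymp
  moreover have "\<forall>\<^sub>F x in at_right (0::real). x > 0" by real_asymp
  ultimately have "\<forall>\<^sub>F x in at_right 0. \<exists>n\<ge>m. \<forall>s\<in>{0..<1}. c * (s ^ n * (1 - ln x)) \<le> (1 - x) ^ n * (1 - ln (1 - s))"
  proof eventually_elim
    case (elim x)
    define y where "y = 1 / (x * ln (1 / x))"
    define n where "n = nat \<lfloor>y\<rfloor>"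
    have y: "y > 0" using elim by (simp add: y_def)
    then have n1: "real n \<le> y" and n2: "y - 1 \<le> real n"
      unfolding n_def by linarith+
    have n: "m \<le> n" using n2 elim unfolding y_def by linarith
    have "1 - 1 / ln (1 / x) = 1 - y * x" using elim by (simp add: y_def field_simps)
    also have "\<dots> \<le> 1 + real n * (- x)" using n1 elim by simp
    also have "\<dots> \<le> (1 + (- x)) ^ n" using elim by (intro Bernoulli_inequality) auto
    finally have t: "1 - 1 / ln (1 / x) \<le> (1 - x) ^ n" by simp
    have "ln (\<epsilon> x) < 0" using elim by (intro ln_less_zero)
    then have L\<epsilon>: "0 \<le> 1 - ln (\<epsilon> x)" by linarith
    have Lx: "1 - ln x > 0" using elim by (smt (verit) ln_less_zero)
    show ?case
    proof (intro exI[of _ n] conjI ballI n)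
      fix s :: real assume s: "s \<in> {0..<1}"
      have Ls: "1 - ln (1 - s) \<ge> 1" using s by simp
      show "c * (s ^ n * (1 - ln x)) \<le> (1 - x) ^ n * (1 - ln (1 - s))"
      proof (cases "c \<le> 0")
        case True
        then have "c * (s ^ n * (1 - ln x)) \<le> 0" using s Lx by (intro mult_nonpos_nonneg) auto
        also have "0 \<le> (1 - x) ^ n * (1 - ln (1 - s))" using elim Ls by (intro mult_nonneg_nonneg) auto
        finally show ?thesis .
      next
        case False
        show ?thesis
        proof (cases "1 - s \<le> \<epsilon> x")
          case True
          have "c * (s ^ n * (1 - ln x)) \<le> c * (1 * (1 - ln x))"
            using s Lx False by (intro mult_left_mono mult_right_mono power_le_one) auto
          also have "\<dots> \<le> (1 - 1 / ln (1 / x)) * (1 - ln (\<epsilon> x))"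
            using elim(1) Lx by (simp add: field_simps)
          also have "\<dots> \<le> (1 - x) ^ n * (1 - ln (1 - s))"
            by (rule mult_mono[OF t _ _ L\<epsilon>]) (use elim True s in auto)
          finally show ?thesis .
        next
          case False': False
          have "s \<le> exp (- (1 - s))" using exp_ge_add_one_self[of "- (1 - s)"] by simp
          also have "\<dots> \<le> exp (- \<epsilon> x)" using False' by simp
          finally have "s ^ n \<le> exp (- \<epsilon> x) ^ n" using s by (intro power_mono) auto
          also have "\<dots> = exp (- (n * \<epsilon> x))" by (simp flip: exp_of_nat_mult)
          also have "\<dots> \<le> exp (\<epsilon> x - ln (1 / x) ^ 2)"
          proof -
            have "(y - 1) * \<epsilon> x \<le> n * \<epsilon> x" using n2 elim by (intro mult_right_mono) auto
            moreover have "y * \<epsilon> x = ln (1 / x) ^ 2"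
              using elim by (simp add: y_def \<epsilon>_def power2_eq_square power3_eq_cube)
            ultimately show ?thesis by (simp add: algebra_simps)
          qed
          finally have sn: "s ^ n \<le> exp (\<epsilon> x - ln (1 / x) ^ 2)" .
          have "c * (s ^ n * (1 - ln x)) \<le> 1 * (exp (\<epsilon> x - ln (1 / x) ^ 2) * (1 - ln x))"
            using s Lx False c sn by (intro mult_mono mult_nonneg_nonneg) auto
          \<comment> \<open>The two sides are separated by 1/2.\<close>
          also have "\<dots> \<le> (1 - 1 / ln (1 / x)) * 1"
            unfolding mult_1_left mult_1_right mult.commute[of "exp _"] using elim(2,3) by linarith
          also have "\<dots> \<le> (1 - x) ^ n * (1 - ln (1 - s))"
            using t elim Ls by (intro mult_mono) auto
          finally show ?thesis .
        qed
      qed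
    qed
  qed
  from at_left_1_compose[OF this]
  show "\<forall>\<^sub>F t in at_left 1. \<exists>n\<ge>m. \<forall>s\<in>{0..<1}. c * (s ^ n * (1 - ln (1 - t))) \<le> t ^ n * (1 - ln (1 - s))"
    by simp
qed

lemma monomial_peaks_cong:
  assumes "monomial_peaks \<omega>" "\<And>t. 0 \<le> t \<Longrightarrow> t < 1 \<Longrightarrow> \<omega>' t = \<omega> t"
  shows "monomial_peaks \<omega>'"
  unfolding monomial_peaks_def
proof (intro allI impI)
  fix c :: real and m assume "c < 1"
  then have "\<forall>\<^sub>F t in at_left (1::real). \<exists>n\<ge>m. \<forall>s\<in>{0..<1}. c * (s ^ n * \<omega> t) \<le> t ^ n * \<omega> s"
    using assms(1) by (simp add: monomial_peaks_def)
  moreover have "\<forall>\<^sub>F t in at_left (1::real). t \<in> {0..<1}"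
    by (rule eventually_at_leftI[of 0]) auto
  ultimately show "\<forall>\<^sub>F t in at_left 1. \<exists>n\<ge>m. \<forall>s\<in>{0..<1}. c * (s ^ n * \<omega>' t) \<le> t ^ n * \<omega>' s"
    by eventually_elim (use assms(2) in auto)
qed

lemma monomial_peaks_Omega:
  assumes "N_index \<beta> \<le> j"
  shows "monomial_peaks (Omega j \<beta>)"
proof -
  have "\<beta> \<le> real j" using assms less_N_index_iff[of j \<beta>] by linarith
  then consider "real j = \<beta>" | "\<beta> < real j" by linarith
  then show ?thesis
  proof cases
    case 1
    show ?thesis
      by (rule monomial_peaks_cong[OF monomial_peaks_log]) (use 1 ln_weight in \<open>auto simp: Omega_alt\<close>)
  next
    case 2
    show ?thesis
      by (rule monomial_peaks_cong[OF monomial_peaks_powr[of "real j - \<beta>"]]) (use 2 in \<open>auto simp: Omega_alt\<close>)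
  qed
qed

text \<open>With w_n the weighted norm of the monomial, |\<phi>|^n \<le> w_n \<omega>(|\<phi>|)
  everywhere; this bounds the quotient near the circle, and elsewhere |\<phi>|^n decays faster than
  w_n. Conversely, at a point where u \<omega>(|\<phi>|) nearly attains the limit superior,
  \<open>monomial_peaks\<close> supplies a large n for which this inequality is almost an
  equality.\<close>

lemma Limsup_bdry_eq_limsup_monomials:
  fixes u :: "complex \<Rightarrow> real"
  assumes u: "\<And>z. z \<in> unit_disk \<Longrightarrow> 0 \<le> u z" "\<And>z. z \<in> unit_disk \<Longrightarrow> u z \<le> M"
    and \<phi>: "\<phi> ` unit_disk \<subseteq> unit_disk"
    and \<omega>: "\<And>t. 0 \<le> t \<Longrightarrow> t < 1 \<Longrightarrow> 1 \<le> \<omega> t" and peaks: "monomial_peaks \<omega>"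
  shows "Limsup_bdry \<phi> (\<lambda>z. ennreal (u z * \<omega> (norm (\<phi> z)))) =
    limsup (\<lambda>n. (SUP z\<in>unit_disk. ennreal (u z * norm (\<phi> z) ^ n)) / growth_norm \<omega> (\<lambda>z. z ^ n))"
    (is "?L = limsup (\<lambda>n. ?S n / ?W n)")
proof (rule antisym)
  have \<phi>1: "norm (\<phi> z) < 1" if "z \<in> unit_disk" for z using \<phi> that by (simp add: image_subset_iff)
  have M: "0 \<le> M" using u[of 0] by simp
  have W_le: "?W n \<le> 1" for n
  proof -
    have "norm z ^ n / \<omega> (norm z) \<le> 1" if "z \<in> unit_disk" for z :: complex
      using that \<omega>[of "norm z"] power_le_one[of "norm z" n] by (simp add: divide_le_eq)
    then show ?thesis
      unfolding growth_norm_def by (intro SUP_least) (simp add: norm_power ennreal_le_1)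
  qed
  define w where "w n = enn2real (?W n)" for n
  have W: "?W n = ennreal (w n)" for n
    unfolding w_def using W_le[of n] by (simp add: le_less_trans[OF W_le])
  have w_nonneg: "0 \<le> w n" for n by (simp add: w_def)
  have w_ge: "t ^ n \<le> w n * \<omega> t" if "0 \<le> t" "t < 1" for t n
  proof -
    have "ennreal (norm (of_real t ^ n :: complex) / \<omega> (norm (of_real t :: complex))) \<le> ?W n"
      unfolding growth_norm_def by (rule SUP_upper) (use that in simp)
    then have "t ^ n / \<omega> t \<le> w n"
      using that unfolding W by (simp add: norm_power w_nonneg)
    then show ?thesis using \<omega>[OF that] by (simp add: divide_le_eq)
  qed
  have w_pos: "0 < w n" for n
  proof -
    have "0 < (1 / 2 :: real) ^ n" by simp
    also have "\<dots> \<le> w n * \<omega> (1 / 2)" by (rule w_ge) simp_all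
    finally show ?thesis using \<omega>[of "1/2"] by (simp add: zero_less_mult_iff)
  qed
  have w_le: "w n \<le> B" if "\<And>s. 0 \<le> s \<Longrightarrow> s < 1 \<Longrightarrow> s ^ n / \<omega> s \<le> B" for n B
  proof -
    have "?W n \<le> ennreal B"
      unfolding growth_norm_def by (intro SUP_least ennreal_leI) (simp add: norm_power that)
    moreover have "0 \<le> B" using that[of 0] \<omega>[of 0] by (force intro: order.trans[rotated])
    ultimately show ?thesis by (simp add: W)
  qed
  show "limsup (\<lambda>n. ?S n / ?W n) \<le> ?L"
  proof (rule dense_ge)
    fix y assume y: "?L < y"
    show "limsup (\<lambda>n. ?S n / ?W n) \<le> y"
    proof (cases y)
      case (real a)
      have a: "a > 0" using y real by (auto intro: ccontr simp: not_less)
      obtain \<delta> where \<delta>: "0 \<le> \<delta>" "\<delta> < 1"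
        and lt: "\<And>z. z \<in> unit_disk \<Longrightarrow> \<delta> < norm (\<phi> z) \<Longrightarrow> ennreal (u z * \<omega> (norm (\<phi> z))) < y"
        using Limsup_bdry_less[OF y] by metis
      \<comment> \<open>Strictly between \<delta> and 1: since w_n \<ge> t^n / \<omega> t, the
        contribution of |\<phi>| \<le> \<delta> is geometrically small relative to w_n.\<close>
      define t where "t = (1 + \<delta>) / 2"
      have t: "0 < t" "t < 1" "\<delta> < t" using \<delta> by (auto simp: t_def)
      have "(\<lambda>n. M * \<omega> t * (\<delta> / t) ^ n) \<longlonglongrightarrow> M * \<omega> t * 0"
        using t \<delta> by (intro tendsto_mult tendsto_const LIMSEQ_power_zero) auto
      then have "\<forall>\<^sub>F n in sequentially. M * \<omega> t * (\<delta> / t) ^ n < a"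
        using a by (intro order_tendstoD) auto
      then have "\<forall>\<^sub>F n in sequentially. ?S n / ?W n \<le> y"
      proof eventually_elim
        case (elim n)
        have "u z * norm (\<phi> z) ^ n \<le> a * w n" if z: "z \<in> unit_disk" for z
        proof (cases "\<delta> < norm (\<phi> z)")
          case True
          have "u z * norm (\<phi> z) ^ n \<le> u z * (w n * \<omega> (norm (\<phi> z)))"
            using u[OF z] \<phi>1[OF z] by (intro mult_left_mono w_ge) auto
          also have "\<dots> = (u z * \<omega> (norm (\<phi> z))) * w n" by simp
          also have "\<dots> \<le> a * w n"
            using lt[OF z True] a w_nonneg by (intro mult_right_mono) (auto simp: real ennreal_less_iff dest: less_imp_le)
          finally show ?thesis .
        next
          case False
          have "u z * norm (\<phi> z) ^ n \<le> M * \<delta> ^ n"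
            using u[OF z] False M by (intro mult_mono power_mono) auto
          also have "\<dots> = M * (\<delta> / t) ^ n * t ^ n" using t by (simp add: power_divide)
          also have "\<dots> \<le> M * (\<delta> / t) ^ n * (w n * \<omega> t)"
            using t \<delta> M by (intro mult_left_mono w_ge) auto
          also have "\<dots> = (M * \<omega> t * (\<delta> / t) ^ n) * w n" by simp
          also have "\<dots> \<le> a * w n" using elim w_nonneg by (intro mult_right_mono) auto
          finally show ?thesis .
        qed
        then have "?S n \<le> ennreal (a * w n)" by (intro SUP_least ennreal_leI)
        then have "?S n / ?W n \<le> ennreal (a * w n) / ennreal (w n)"
          unfolding W by (rule divide_right_mono_ennreal)
        also have "\<dots> = y" using a w_pos[of n] by (simp add: divide_ennreal real)
        finally show ?case .
      qed
      then show ?thesis by (rule Limsup_bounded)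
    qed simp
  qed
  show "?L \<le> limsup (\<lambda>n. ?S n / ?W n)"
  proof (rule dense_le)
    fix y assume y: "y < ?L"
    then obtain y' where y': "y < y'" "y' < ?L" using dense by blast
    obtain a where a: "y = ennreal a" "0 \<le> a" using y by (cases y) auto
    obtain a' where a': "y' = ennreal a'" "0 \<le> a'" using y' by (cases y') auto
    have aa': "a < a'" using y' a a' by (simp add: ennreal_less_iff)
    \<comment> \<open>The factor lost in \<open>monomial_peaks\<close> is paid for by the gap
      between y and y'.\<close>
    define c where "c = a / a'"
    have c: "c < 1" "0 \<le> c" "c * a' = a" using aa' a by (auto simp: c_def)
    have "y \<le> (SUP n\<in>{m..}. ?S n / ?W n)" for m
    proof -
      obtain \<delta> where \<delta>: "\<delta> < 1"
        and n: "\<And>t. \<delta> < t \<Longrightarrow> t < 1 \<Longrightarrow> \<exists>n\<ge>m. \<forall>s\<in>{0..<1}. c * (s ^ n * \<omega> t) \<le> t ^ n * \<omega> s"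
        using peaks c(1) unfolding monomial_peaks_def eventually_at_left[OF zero_less_one] by blast
      have "y' < (SUP z\<in>{z \<in> unit_disk. norm (\<phi> z) > \<delta>}. ennreal (u z * \<omega> (norm (\<phi> z))))"
        using y'(2) Limsup_bdry_le[OF \<delta>] by (rule less_le_trans)
      then obtain z where z: "z \<in> unit_disk" "\<delta> < norm (\<phi> z)" "y' < ennreal (u z * \<omega> (norm (\<phi> z)))"
        by (auto simp: less_SUP_iff)
      let ?t = "norm (\<phi> z)"
      have t: "0 \<le> ?t" "?t < 1" using \<phi>1[OF z(1)] by auto
      obtain n where n: "n \<ge> m" "\<And>s. s \<in> {0..<1} \<Longrightarrow> c * (s ^ n * \<omega> ?t) \<le> ?t ^ n * \<omega> s"
        using n[OF z(2) t(2)] by blast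
      have cw: "c * \<omega> ?t * w n \<le> ?t ^ n"
      proof (cases "c = 0")
        case False
        then have c0: "c > 0" using c by simp
        have "w n \<le> ?t ^ n / (c * \<omega> ?t)"
        proof (rule w_le)
          fix s :: real assume s: "0 \<le> s" "s < 1"
          show "s ^ n / \<omega> s \<le> ?t ^ n / (c * \<omega> ?t)"
            using n(2)[of s] s \<omega>[OF s] \<omega>[OF t] c0 by (simp add: field_simps)
        qed
        then show ?thesis using c0 \<omega>[OF t] by (simp add: field_simps)
      qed simp
      have "a \<le> c * (u z * \<omega> ?t)"
        using z(3) a' c by (simp add: ennreal_less_iff flip: c(3)) (intro mult_left_mono, auto)
      also have "\<dots> = u z * (c * \<omega> ?t * w n) / w n" using w_pos[of n] by simp
      also have "\<dots> \<le> u z * ?t ^ n / w n"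
        using u[OF z(1)] w_pos[of n] cw by (intro divide_right_mono mult_left_mono) auto
      finally have "y \<le> ennreal (u z * ?t ^ n) / ?W n"
        unfolding a W using u[OF z(1)] w_pos[of n] by (simp add: divide_ennreal ennreal_leI)
      also have "\<dots> \<le> ?S n / ?W n"
        using z by (intro divide_right_mono_ennreal SUP_upper)
      also have "\<dots> \<le> (SUP n\<in>{m..}. ?S n / ?W n)"
        using n by (intro SUP_upper) auto
      finally show ?thesis .
    qed
    then show "y \<le> limsup (\<lambda>n. ?S n / ?W n)"
      unfolding limsup_INF_SUP by (intro INF_greatest)
  qed
qed

section \<open>Locally null sequences and the upper bound\<close>

lemma Omega_mono:
  assumes "0 \<le> s" "s \<le> t" "t < 1"
  shows "Omega j \<beta> s \<le> Omega j \<beta> t"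
  using assms powr_mono2'[of "\<beta> - real j" "1 - t" "1 - s"] by (auto simp: Omega_alt ln_weight)

lemma Lambda_le_bounded:
  assumes "0 \<le> \<rho>" "\<rho> < 1"
  obtains B where "\<And>f z. Lambda_le \<beta> M f \<Longrightarrow> z \<in> cball 0 \<rho> \<Longrightarrow> norm ((deriv ^^ i) f z) \<le> B"
proof -
  obtain C where "deriv_growth \<beta> i C" using higher_deriv_growth by blast
  note C = deriv_growth_pos[OF this] deriv_growthD[OF this]
  show ?thesis
  proof (rule that[of "C * M * Omega i \<beta> \<rho>"])
    fix f and z :: complex assume f: "Lambda_le \<beta> M f" and z: "z \<in> cball 0 \<rho>"
    have "norm ((deriv ^^ i) f z) \<le> C * M * Omega i \<beta> (norm z)"
      using C(2)[OF f, of z] z assms by simp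
    also have "\<dots> \<le> C * M * Omega i \<beta> \<rho>"
      using z assms C(1) Lambda_le_nonneg[OF f] by (intro mult_left_mono Omega_mono) auto
    finally show "norm ((deriv ^^ i) f z) \<le> C * M * Omega i \<beta> \<rho>" .
  qed
qed

section \<open>Differences, restriction to the disk, functions holomorphic across the circle\<close>

lemma Lambda_le_diff:
  assumes "Lambda_le \<beta> A f" "Lambda_le \<beta> B h"
  shows "Lambda_le \<beta> (A + B) (\<lambda>z. f z - h z)"
proof -
  have hol: "f holomorphic_on unit_disk" "h holomorphic_on unit_disk"
    using assms by (auto simp: Lambda_le_def)
  have d: "norm ((deriv ^^ n) (\<lambda>z. f z - h z) z) \<le> norm ((deriv ^^ n) f z) + norm ((deriv ^^ n) h z)"
    if "z \<in> unit_disk" for n z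
    using higher_deriv_diff[OF hol open_ball that] by (simp add: norm_triangle_ineq4)
  show ?thesis
    unfolding Lambda_le_def
  proof (intro conjI allI impI ballI)
    show "(\<lambda>z. f z - h z) holomorphic_on unit_disk" using hol by (intro holomorphic_intros)
    show "norm ((deriv ^^ i) (\<lambda>z. f z - h z) 0) \<le> A + B" if "i < Lambda_order \<beta>" for i
      using d[of 0 i] assms that unfolding Lambda_le_def by fastforce
    fix z :: complex assume z: "z \<in> unit_disk"
    let ?K = "Lambda_order \<beta>" and ?w = "(1 - norm z) powr (real (Lambda_order \<beta>) - \<beta>)"
    have "norm ((deriv ^^ ?K) (\<lambda>z. f z - h z) z) * ?w \<le> (norm ((deriv ^^ ?K) f z) + norm ((deriv ^^ ?K) h z)) * ?w"
      using d[OF z] by (intro mult_right_mono) auto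
    also have "\<dots> \<le> A + B"
      using assms z unfolding Lambda_le_def distrib_right by (intro add_mono) auto
    finally show "norm ((deriv ^^ ?K) (\<lambda>z. f z - h z) z) * ?w \<le> A + B" .
  qed
qed

text \<open>\<open>Lambda_space\<close> only contains functions that vanish off the disk, which
  monomials, dilations and test functions do not. This normalisation preserves holomorphy,
  derivatives in the disk and norms.\<close>

definition disk_restrict :: "(complex \<Rightarrow> complex) \<Rightarrow> complex \<Rightarrow> complex" where
  "disk_restrict f z = (if z \<in> unit_disk then f z else 0)"

lemma disk_restrict_holomorphic:
  "disk_restrict f holomorphic_on unit_disk \<longleftrightarrow> f holomorphic_on unit_disk"
  by (rule holomorphic_cong) (auto simp: disk_restrict_def)

lemma higher_deriv_disk_restrict:
  assumes "f holomorphic_on unit_disk" "z \<in> unit_disk"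
  shows "(deriv ^^ n) (disk_restrict f) z = (deriv ^^ n) f z"
  by (rule higher_deriv_transform_within_open[where S = unit_disk])
    (use assms in \<open>auto simp: disk_restrict_holomorphic\<close>, simp add: disk_restrict_def)

lemma Lambda_le_disk_restrict: "Lambda_le \<beta> M (disk_restrict f) \<longleftrightarrow> Lambda_le \<beta> M f"
  unfolding Lambda_le_def by (auto simp: disk_restrict_holomorphic higher_deriv_disk_restrict)

lemma Lambda_spaceI:
  assumes "Lambda_le \<beta> M f"
  shows "disk_restrict f \<in> Lambda_space \<beta>"
proof -
  have "Lambda_le \<beta> M (disk_restrict f)" using assms by (simp add: Lambda_le_disk_restrict)
  then have "Lambda_norm \<beta> (disk_restrict f) < \<infinity>"
    using Lambda_norm_leI[of \<beta> M "disk_restrict f"] by (auto intro: le_less_trans)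
  then show ?thesis
    using assms by (simp add: Lambda_space_def disk_restrict_holomorphic Lambda_le_def disk_restrict_def)
qed

lemma Lambda_space_leD:
  assumes "f \<in> Lambda_space \<beta>"
  obtains M where "Lambda_le \<beta> M f"
proof (cases "Lambda_norm \<beta> f")
  case (real r)
  then show ?thesis using Lambda_norm_leD[of \<beta> f r] that by simp
qed (use assms in \<open>auto simp: Lambda_space_def\<close>)

lemma higher_deriv_bounded_disk:
  assumes "f holomorphic_on S" "open S" "cball 0 1 \<subseteq> S"
  shows "\<exists>B\<ge>0. \<forall>z\<in>cball 0 1. norm ((deriv ^^ i) f z) \<le> B"
proof -
  have "continuous_on (cball 0 1) ((deriv ^^ i) f)"
    using assms by (meson holomorphic_higher_deriv holomorphic_on_imp_continuous_on continuous_on_subset)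
  then have "bounded ((deriv ^^ i) f ` cball 0 1)"
    by (intro compact_imp_bounded compact_continuous_image) auto
  then show ?thesis by (auto simp: bounded_pos intro: less_imp_le)
qed

text \<open>All derivatives are bounded on the closed disk, and the weight is at most 1 because its
  exponent \<open>Lambda_order \<beta> - \<beta>\<close> is positive.\<close>

lemma Lambda_le_entire:
  assumes f: "f holomorphic_on S" and S: "open S" "cball 0 1 \<subseteq> S"
  obtains M where "Lambda_le \<beta> M f"
proof -
  obtain B where B: "\<And>i z. z \<in> cball 0 1 \<Longrightarrow> norm ((deriv ^^ i) f z) \<le> B i" and B0: "\<And>i. 0 \<le> B i"
    using higher_deriv_bounded_disk[OF assms] by metis
  let ?K = "Lambda_order \<beta>"
  show ?thesis
  proof (rule that[of "\<Sum>i\<le>?K. B i"], unfold Lambda_le_def, intro conjI allI impI ballI)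
    show "f holomorphic_on unit_disk" using f S by (meson holomorphic_on_subset ball_subset_cball order.trans)
    show "norm ((deriv ^^ i) f 0) \<le> sum B {..?K}" if "i < ?K" for i
      using that B[of 0 i] member_le_sum[of i "{..?K}" B] B0 by force
    fix z :: complex assume z: "z \<in> unit_disk"
    have "norm ((deriv ^^ ?K) f z) * (1 - norm z) powr (real ?K - \<beta>) \<le> B ?K * 1"
      using z B[of z ?K] B0 Lambda_order_gt[of \<beta>] by (intro mult_mono powr_le1) auto
    also have "\<dots> \<le> sum B {..?K}" using member_le_sum[of ?K "{..?K}" B] B0 by force
    finally show "norm ((deriv ^^ ?K) f z) * (1 - norm z) powr (real ?K - \<beta>) \<le> sum B {..?K}" .
  qed
qed

text \<open>Locally uniform convergence to 0 in the disk. Negative radii do no harm, since the ball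
  is then empty.\<close>

definition loc_null :: "(nat \<Rightarrow> complex \<Rightarrow> complex) \<Rightarrow> bool" where
  "loc_null f \<longleftrightarrow> (\<forall>\<rho><1. \<forall>\<epsilon>>0. \<forall>\<^sub>F k in sequentially. \<forall>z\<in>cball 0 \<rho>. norm (f k z) < \<epsilon>)"

lemma loc_nullD:
  "loc_null f \<Longrightarrow> \<rho> < 1 \<Longrightarrow> \<epsilon> > 0 \<Longrightarrow> \<forall>\<^sub>F k in sequentially. \<forall>z\<in>cball 0 \<rho>. norm (f k z) < \<epsilon>"
  by (simp add: loc_null_def)

lemma loc_null_higher_deriv:
  assumes f: "\<And>k. f k holomorphic_on unit_disk" and null: "loc_null f"
  shows "loc_null (\<lambda>k. (deriv ^^ i) (f k))"
  unfolding loc_null_def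
proof (intro allI impI)
  fix \<rho> \<epsilon> :: real assume \<rho>: "\<rho> < 1" and \<epsilon>: "\<epsilon> > 0"
  define r where "r = (1 - \<rho>) / 2"
  have r: "r > 0" "\<rho> + r < 1" using \<rho> by (auto simp: r_def field_simps)
  define e where "e = \<epsilon> * r ^ i / (2 * fact i)"
  have e: "e > 0" using \<epsilon> r by (simp add: e_def)
  show "\<forall>\<^sub>F k in sequentially. \<forall>z\<in>cball 0 \<rho>. norm ((deriv ^^ i) (f k) z) < \<epsilon>"
    using loc_nullD[OF null r(2) e]
  proof eventually_elim
    case (elim k)
    show ?case
    proof
      fix z :: complex assume z: "z \<in> cball 0 \<rho>"
      have sub: "cball z r \<subseteq> cball 0 (\<rho> + r)"
      proof
        fix x assume "x \<in> cball z r"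
        then show "x \<in> cball 0 (\<rho> + r)"
          using norm_triangle_sub[of x z] z by (simp add: dist_norm norm_minus_commute)
      qed
      then have sub': "cball z r \<subseteq> unit_disk" using r by (auto simp: subset_iff)
      have "norm ((deriv ^^ i) (f k) z) \<le> fact i * e / r ^ i"
      proof (rule Cauchy_inequality)
        show "f k holomorphic_on ball z r"
          using f sub' by (meson holomorphic_on_subset ball_subset_cball order.trans)
        show "continuous_on (cball z r) (f k)"
          using f sub' by (meson holomorphic_on_subset holomorphic_on_imp_continuous_on)
        show "norm (f k x) \<le> e" if "norm (z - x) = r" for x
          using elim sub that by (auto simp: subset_iff dist_norm intro: less_imp_le)
      qed (use r in auto)
      also have "\<dots> = \<epsilon> / 2" using r by (simp add: e_def)
      finally show "norm ((deriv ^^ i) (f k) z) < \<epsilon>" using \<epsilon> by simp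
    qed
  qed
qed

text \<open>Beyond a radius a close to 1 the derivatives oscillate little along radii, uniformly in
  k; up to the radius a local nullity applies. So the terms below N become small without any
  condition on \<phi> near the circle.\<close>

lemma low_deriv_uniformly_null:
  assumes i: "real i < \<beta>" and f: "\<And>k. Lambda_le \<beta> M (f k)" and null: "loc_null f" and \<epsilon>: "\<epsilon> > 0"
  shows "\<forall>\<^sub>F k in sequentially. \<forall>z\<in>unit_disk. norm ((deriv ^^ i) (f k) z) < \<epsilon>"
proof -
  obtain C0 where "deriv_growth \<beta> (Suc i) C0" using higher_deriv_growth by blast
  then obtain C \<gamma> where C: "radially_Hoelder \<beta> i C \<gamma>" using radially_Hoelder_exists[OF _ i] by blast
  then have C1: "\<gamma> < 1" by (simp add: radially_Hoelder_def)
  have "((\<lambda>a. C * M * (1 - a) powr (1 - \<gamma>)) \<longlongrightarrow> C * M * 0) (at_left 1)"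
    using C1 by (intro tendsto_mult tendsto_const) real_asymp
  then have "\<forall>\<^sub>F a in at_left 1. C * M * (1 - a) powr (1 - \<gamma>) < \<epsilon> / 2"
    using \<epsilon> by (intro order_tendstoD) auto
  moreover have "\<forall>\<^sub>F a in at_left (1::real). a \<in> {0<..<1}"
    by (rule eventually_at_leftI[of 0]) auto
  ultimately have "\<exists>a. C * M * (1 - a) powr (1 - \<gamma>) < \<epsilon> / 2 \<and> a \<in> {0<..<1}"
    by (intro eventually_happens'[OF _ eventually_conj]) auto
  then obtain a where a: "C * M * (1 - a) powr (1 - \<gamma>) < \<epsilon> / 2" "0 < a" "a < 1" by auto
  have "loc_null (\<lambda>k. (deriv ^^ i) (f k))"
    using f null by (intro loc_null_higher_deriv) (auto simp: Lambda_le_def)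
  from loc_nullD[OF this a(3), of "\<epsilon> / 2"] \<epsilon>
  have "\<forall>\<^sub>F k in sequentially. \<forall>z\<in>cball 0 a. norm ((deriv ^^ i) (f k) z) < \<epsilon> / 2" by simp
  then show ?thesis
  proof eventually_elim
    case (elim k)
    show ?case
    proof
      fix z :: complex assume z: "z \<in> unit_disk"
      show "norm ((deriv ^^ i) (f k) z) < \<epsilon>"
      proof (cases "norm z \<le> a")
        case True
        then have "norm ((deriv ^^ i) (f k) z) < \<epsilon> / 2" using elim by simp
        then show ?thesis using \<epsilon> by linarith
      next
        case False
        obtain \<zeta> where \<zeta>: "norm \<zeta> = 1" "z = of_real (norm z) * \<zeta>" by (rule unit_direction)
        have "norm ((deriv ^^ i) (f k) (of_real (norm z) * \<zeta>) - (deriv ^^ i) (f k) (of_real a * \<zeta>)) < \<epsilon> / 2"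
          using a False z \<zeta> by (intro le_less_trans[OF radially_HoelderD[OF C f]]) auto
        moreover have "norm ((deriv ^^ i) (f k) (of_real a * \<zeta>)) < \<epsilon> / 2"
          using elim \<zeta> a by (simp add: norm_mult)
        ultimately show ?thesis
          using norm_triangle_ineq2[of "(deriv ^^ i) (f k) z" "(deriv ^^ i) (f k) (of_real a * \<zeta>)"]
          unfolding \<zeta>(2)[symmetric] by linarith
      qed
    qed
  qed
qed

section \<open>The coefficient functions \<open>G_fun\<close> and the basic estimate for null
  sequences\<close>

definition admissible :: "real \<Rightarrow> real \<Rightarrow> (complex \<Rightarrow> complex) \<Rightarrow> (complex \<Rightarrow> complex) \<Rightarrow> bool" where
  "admissible \<beta> \<alpha> g \<phi> \<longleftrightarrow> g holomorphic_on unit_disk \<and> \<phi> holomorphic_on unit_disk \<and>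
     \<phi> ` unit_disk \<subseteq> unit_disk \<and> Lambda_bounded \<beta> \<alpha> (wcomp g \<phi>)"

text \<open>Its supremum over the disk is the norm of \<open>G_fun g \<phi> J j\<close> in the space
  of order \<alpha> - J, once \<alpha> < J.\<close>

definition G_weight :: "real \<Rightarrow> nat \<Rightarrow> (complex \<Rightarrow> complex) \<Rightarrow> (complex \<Rightarrow> complex) \<Rightarrow> nat \<Rightarrow> complex \<Rightarrow> real" where
  "G_weight \<alpha> J g \<phi> j z = norm (G_fun g \<phi> J j z) * (1 - norm z) powr (real J - \<alpha>)"

lemma G_weight_nonneg: "0 \<le> G_weight \<alpha> J g \<phi> j z"
  by (simp add: G_weight_def)

lemma wcomp_holomorphic:
  assumes "g holomorphic_on unit_disk" "\<phi> holomorphic_on unit_disk" "\<phi> ` unit_disk \<subseteq> unit_disk"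
    "f holomorphic_on unit_disk"
  shows "wcomp g \<phi> f holomorphic_on unit_disk"
proof -
  have "(\<lambda>z. g z * (f \<circ> \<phi>) z) holomorphic_on unit_disk"
    using assms by (intro holomorphic_on_mult holomorphic_on_compose_gen) auto
  then show ?thesis
    by (rule holomorphic_transform) (auto simp: wcomp_def)
qed

lemma higher_deriv_wcomp:
  assumes "g holomorphic_on unit_disk" "\<phi> holomorphic_on unit_disk" "\<phi> ` unit_disk \<subseteq> unit_disk"
    "f holomorphic_on unit_disk" "z \<in> unit_disk"
  shows "(deriv ^^ J) (wcomp g \<phi> f) z = (\<Sum>j\<le>J. G_fun g \<phi> J j z * (deriv ^^ j) f (\<phi> z))"
  using G_fun_family[OF assms(1-3), of J] assms(4,5) by (simp add: is_G_family_def)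

text \<open>Apply the operator to the monomial of degree j: derivatives above order j vanish and the
  one of order j is \<open>fact j\<close>. The J-th derivative of the image thus expresses G_j
  through a member of the target space and the G_i with i < j, which are bounded by
  induction.\<close>

lemma G_weight_bounded:
  assumes adm: "admissible \<beta> \<alpha> g \<phi>" and J: "\<alpha> < real J" and j: "j \<le> J"
  shows "\<exists>M\<ge>0. \<forall>z\<in>unit_disk. G_weight \<alpha> J g \<phi> j z \<le> M"
  using j
proof (induction j rule: less_induct)
  case (less j)
  have gp: "g holomorphic_on unit_disk" "\<phi> holomorphic_on unit_disk" "\<phi> ` unit_disk \<subseteq> unit_disk"
    and lin: "Lambda_linear \<beta> \<alpha> (wcomp g \<phi>)"
    using adm by (auto simp: admissible_def Lambda_bounded_def)
  have "\<forall>i\<in>{..<j}. \<exists>M\<ge>0. \<forall>z\<in>unit_disk. G_weight \<alpha> J g \<phi> i z \<le> M" using less by simp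
  then obtain M where M: "\<And>i. i < j \<Longrightarrow> 0 \<le> M i" "\<And>i z. i < j \<Longrightarrow> z \<in> unit_disk \<Longrightarrow> G_weight \<alpha> J g \<phi> i z \<le> M i"
    by (metis lessThan_iff)
  define p :: "complex \<Rightarrow> complex" where "p z = z ^ j" for z
  have p: "p holomorphic_on A" for A unfolding p_def by (intro holomorphic_intros)
  define q where "q = disk_restrict p"
  obtain M0 where "Lambda_le \<beta> M0 p" by (rule Lambda_le_entire[OF p, of UNIV]) auto
  then have "q \<in> Lambda_space \<beta>" unfolding q_def by (rule Lambda_spaceI)
  then have "wcomp g \<phi> q \<in> Lambda_space \<alpha>" using lin by (auto simp: Lambda_linear_def)
  then obtain M1 where M1: "Lambda_le \<alpha> M1 (wcomp g \<phi> q)" by (rule Lambda_space_leD)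
  obtain C where "deriv_growth \<alpha> J C" using higher_deriv_growth by blast
  note C = deriv_growth_pos[OF this] deriv_growthD[OF this]
  define c where "c i = norm (pochhammer (of_nat (Suc j - i)) i :: complex)" for i
  have pd: "(deriv ^^ i) p w = pochhammer (of_nat (Suc j - i)) i * w ^ (j - i)" for i w
    using higher_deriv_power[of i 0 j w] by (simp add: p_def[abs_def])
  \<comment> \<open>For i > j the truncated difference \<open>Suc j - i\<close> is 0, and the
    Pochhammer symbol of 0 vanishes.\<close>
  have p0: "(deriv ^^ i) p w = 0" if "j < i" for i w
    unfolding pd using that by (simp add: pochhammer_0_left)
  have pj: "(deriv ^^ j) p w = fact j" for w
    unfolding pd by (simp add: pochhammer_fact)
  have pn: "norm ((deriv ^^ i) p w) \<le> c i" if "w \<in> unit_disk" for i w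
    unfolding pd c_def norm_mult norm_power using that
    by (intro mult_left_le power_le_one) auto
  show ?case
  proof (intro exI[of _ "C * M1 + (\<Sum>i<j. M i * c i)"] conjI ballI)
    show "0 \<le> C * M1 + (\<Sum>i<j. M i * c i)"
      using C(1) Lambda_le_nonneg[OF M1] M(1) by (intro add_nonneg_nonneg sum_nonneg) (auto simp: c_def)
    fix z assume z: "z \<in> unit_disk"
    let ?w = "(1 - norm z) powr (real J - \<alpha>)" and ?G = "G_fun g \<phi> J"
    have \<phi>z: "\<phi> z \<in> unit_disk" using gp z by blast
    have "(deriv ^^ J) (wcomp g \<phi> q) z = (\<Sum>i\<le>J. ?G i z * (deriv ^^ i) q (\<phi> z))"
      using p by (intro higher_deriv_wcomp gp z) (simp add: q_def disk_restrict_holomorphic)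
    also have "\<dots> = (\<Sum>i\<le>J. ?G i z * (deriv ^^ i) p (\<phi> z))"
      unfolding q_def using higher_deriv_disk_restrict[OF p \<phi>z] by simp
    also have "\<dots> = (\<Sum>i\<le>j. ?G i z * (deriv ^^ i) p (\<phi> z))"
      using less.prems by (intro sum.mono_neutral_right) (auto simp: p0)
    also have "\<dots> = (\<Sum>i<j. ?G i z * (deriv ^^ i) p (\<phi> z)) + ?G j z * fact j"
      by (simp add: lessThan_Suc_atMost[symmetric] pj)
    finally have "?G j z * fact j = (deriv ^^ J) (wcomp g \<phi> q) z - (\<Sum>i<j. ?G i z * (deriv ^^ i) p (\<phi> z))"
      by simp
    then have "norm (?G j z) * fact j = norm ((deriv ^^ J) (wcomp g \<phi> q) z - (\<Sum>i<j. ?G i z * (deriv ^^ i) p (\<phi> z)))"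
      by (metis norm_mult norm_fact)
    also have "\<dots> \<le> norm ((deriv ^^ J) (wcomp g \<phi> q) z) + (\<Sum>i<j. norm (?G i z) * norm ((deriv ^^ i) p (\<phi> z)))"
      by (intro order.trans[OF norm_triangle_ineq4] add_left_mono order.trans[OF norm_sum]) (simp add: norm_mult)
    finally have "norm (?G j z) * fact j * ?w \<le>
        (norm ((deriv ^^ J) (wcomp g \<phi> q) z) + (\<Sum>i<j. norm (?G i z) * norm ((deriv ^^ i) p (\<phi> z)))) * ?w"
      by (intro mult_right_mono) auto
    also have "\<dots> = norm ((deriv ^^ J) (wcomp g \<phi> q) z) * ?w + (\<Sum>i<j. G_weight \<alpha> J g \<phi> i z * norm ((deriv ^^ i) p (\<phi> z)))"
      unfolding distrib_right sum_distrib_right G_weight_def by (simp add: mult_ac)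
    also have "\<dots> \<le> C * M1 + (\<Sum>i<j. M i * c i)"
    proof (rule add_mono)
      show "norm ((deriv ^^ J) (wcomp g \<phi> q) z) * ?w \<le> C * M1"
        by (subst mult_powr_le_iff) (use z C(2)[OF M1 z] J in \<open>auto simp: Omega_alt\<close>)
      show "(\<Sum>i<j. G_weight \<alpha> J g \<phi> i z * norm ((deriv ^^ i) p (\<phi> z))) \<le> (\<Sum>i<j. M i * c i)"
        using z M pn[OF \<phi>z] by (intro sum_mono mult_mono) auto
    qed
    finally have "G_weight \<alpha> J g \<phi> j z * fact j \<le> C * M1 + (\<Sum>i<j. M i * c i)"
      by (simp add: G_weight_def mult_ac)
    moreover have "G_weight \<alpha> J g \<phi> j z * 1 \<le> G_weight \<alpha> J g \<phi> j z * fact j"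
      by (intro mult_left_mono G_weight_nonneg fact_ge_1)
    ultimately show "G_weight \<alpha> J g \<phi> j z \<le> C * M1 + (\<Sum>i<j. M i * c i)" by simp
  qed
qed

text \<open>On a smaller closed disk g is bounded, and \<phi> maps that disk into another one of
  radius below 1 by compactness.\<close>

lemma loc_null_wcomp:
  assumes g: "g holomorphic_on unit_disk" and \<phi>: "\<phi> holomorphic_on unit_disk" "\<phi> ` unit_disk \<subseteq> unit_disk"
    and null: "loc_null f"
  shows "loc_null (\<lambda>k. wcomp g \<phi> (f k))"
  unfolding loc_null_def
proof (intro allI impI)
  fix \<rho> \<epsilon> :: real assume \<rho>: "\<rho> < 1" and \<epsilon>: "\<epsilon> > 0"
  have sub: "cball 0 \<rho> \<subseteq> unit_disk" using \<rho> by auto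
  have "compact (g ` cball 0 \<rho>)" "compact (\<phi> ` cball 0 \<rho>)"
    using sub g \<phi> by (auto intro!: compact_continuous_image holomorphic_on_imp_continuous_on intro: holomorphic_on_subset)
  then obtain B where B: "\<And>z. z \<in> cball 0 \<rho> \<Longrightarrow> norm (g z) \<le> B"
    by (force dest!: compact_imp_bounded simp: bounded_iff)
  obtain \<rho>' where \<rho>': "\<rho>' < 1" "\<And>z. z \<in> cball 0 \<rho> \<Longrightarrow> norm (\<phi> z) \<le> \<rho>'"
  proof (cases "\<rho> < 0")
    case True then show ?thesis using that[of 0] by simp
  next
    case False
    have "compact ((\<lambda>z. norm (\<phi> z)) ` cball 0 \<rho>)"
      using sub \<phi> by (intro compact_continuous_image continuous_intros)
        (auto intro!: holomorphic_on_imp_continuous_on intro: holomorphic_on_subset)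
    from compact_attains_sup[OF this] False obtain z where
      "z \<in> cball 0 \<rho>" "\<And>w. w \<in> cball 0 \<rho> \<Longrightarrow> norm (\<phi> w) \<le> norm (\<phi> z)" by force
    moreover have "norm (\<phi> z) < 1" using calculation(1) sub \<phi>(2) by (auto simp: image_subset_iff)
    ultimately show ?thesis using that by blast
  qed
  define e where "e = \<epsilon> / (\<bar>B\<bar> + 1)"
  have e: "e > 0" using \<epsilon> by (simp add: e_def)
  show "\<forall>\<^sub>F k in sequentially. \<forall>z\<in>cball 0 \<rho>. norm (wcomp g \<phi> (f k) z) < \<epsilon>"
    using loc_nullD[OF null \<rho>'(1) e]
  proof eventually_elim
    case (elim k)
    show ?case
    proof
      fix z :: complex assume z: "z \<in> cball 0 \<rho>"
      have "norm (wcomp g \<phi> (f k) z) = norm (g z) * norm (f k (\<phi> z))"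
        using z sub by (simp add: wcomp_def norm_mult subset_iff)
      also have "\<dots> \<le> \<bar>B\<bar> * norm (f k (\<phi> z))" using B[OF z] by (intro mult_right_mono) auto
      also have "\<dots> \<le> \<bar>B\<bar> * e" using elim \<rho>'(2)[OF z] by (intro mult_left_mono) (auto intro: less_imp_le)
      also have "\<dots> < \<epsilon>" using \<epsilon> by (simp add: e_def field_simps)
      finally show "norm (wcomp g \<phi> (f k) z) < \<epsilon>" .
    qed
  qed
qed

text \<open>Slightly more than limits superior at most a: the bound already holds beyond some common
  radius \<delta>. If N > J, only \<open>0 \<le> a\<close> is left of it.\<close>

definition tail_bound :: "real \<Rightarrow> real \<Rightarrow> nat \<Rightarrow> (complex \<Rightarrow> complex) \<Rightarrow> (complex \<Rightarrow> complex) \<Rightarrow> real \<Rightarrow> bool" where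
  "tail_bound \<beta> \<alpha> J g \<phi> a \<longleftrightarrow> 0 \<le> a \<and> (\<exists>\<delta>. 0 \<le> \<delta> \<and> \<delta> < 1 \<and> (\<forall>j\<in>{N_index \<beta>..J}. \<forall>z\<in>unit_disk. \<delta> < norm (\<phi> z) \<longrightarrow>
     G_weight \<alpha> J g \<phi> j z * Omega j \<beta> (norm (\<phi> z)) \<le> a))"

definition null_seq_const :: "real \<Rightarrow> real \<Rightarrow> nat \<Rightarrow> real \<Rightarrow> bool" where
  "null_seq_const \<beta> \<alpha> J C \<longleftrightarrow> 0 < C \<and> (\<forall>g \<phi> a M f. \<forall>\<epsilon>>0. admissible \<beta> \<alpha> g \<phi> \<longrightarrow>
     tail_bound \<beta> \<alpha> J g \<phi> a \<longrightarrow> (\<forall>k. Lambda_le \<beta> M (f k)) \<longrightarrow> loc_null f \<longrightarrow>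
     (\<forall>\<^sub>F k in sequentially. Lambda_norm \<alpha> (wcomp g \<phi> (f k)) \<le> ennreal (C * M * a + \<epsilon>)))"

lemma wcomp_null_sequence:
  assumes "null_seq_const \<beta> \<alpha> J C" "admissible \<beta> \<alpha> g \<phi>" "tail_bound \<beta> \<alpha> J g \<phi> a"
    "\<And>k. Lambda_le \<beta> M (f k)" "loc_null f" "\<epsilon> > 0"
  shows "\<forall>\<^sub>F k in sequentially. Lambda_norm \<alpha> (wcomp g \<phi> (f k)) \<le> ennreal (C * M * a + \<epsilon>)"
  using assms unfolding null_seq_const_def by blast

text \<open>The norm is recovered from the J-th derivative by \<open>Lambda_leI_higher\<close>,
  which also asks for small derivatives at 0. Those are null because composition preserves local
  nullity.\<close>

lemma null_seq_const_exists:
  assumes J: "\<alpha> < real J"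
  shows "\<exists>C. null_seq_const \<beta> \<alpha> J C"
proof -
  obtain C1 where C1: "C1 > 0"
    "\<And>F m M. F holomorphic_on unit_disk \<Longrightarrow> 0 \<le> m \<Longrightarrow> (\<And>i. i < J \<Longrightarrow> norm ((deriv ^^ i) F 0) \<le> m) \<Longrightarrow>
      (\<And>z. z \<in> unit_disk \<Longrightarrow> norm ((deriv ^^ J) F z) \<le> M * (1 - norm z) powr (\<alpha> - real J)) \<Longrightarrow>
      Lambda_le \<alpha> (C1 * (m + M)) F"
    using Lambda_leI_higher[OF J] by metis
  obtain C2 where "\<And>i. deriv_growth \<beta> i (C2 i)" using higher_deriv_growth by metis
  note C2 = deriv_growth_pos[OF this] deriv_growthD[OF this]
  define K1 where "K1 = real (Lambda_order \<alpha>) + 1"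
  have K1: "K1 > 0" by (simp add: K1_def)
  have "null_seq_const \<beta> \<alpha> J (K1 * C1 * (\<Sum>j\<le>J. C2 j))"
    unfolding null_seq_const_def
  proof (intro conjI allI impI)
    show "K1 * C1 * (\<Sum>j\<le>J. C2 j) > 0" using C1 C2 K1 by (intro mult_pos_pos sum_pos) auto
    fix g \<phi> a M f and \<epsilon> :: real
    assume adm: "admissible \<beta> \<alpha> g \<phi>" and a: "tail_bound \<beta> \<alpha> J g \<phi> a"
      and "\<forall>k. Lambda_le \<beta> M (f k)" and null: "loc_null f" and \<epsilon>: "\<epsilon> > 0"
    then have f: "\<And>k. Lambda_le \<beta> M (f k)" by blast
    have gp: "g holomorphic_on unit_disk" "\<phi> holomorphic_on unit_disk" "\<phi> ` unit_disk \<subseteq> unit_disk"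
      using adm by (auto simp: admissible_def)
    have hf: "f k holomorphic_on unit_disk" for k using f by (auto simp: Lambda_le_def)
    have M: "0 \<le> M" using f by (rule Lambda_le_nonneg)
    obtain \<delta> where \<delta>: "0 \<le> \<delta>" "\<delta> < 1" "\<And>j z. j \<in> {N_index \<beta>..J} \<Longrightarrow> z \<in> unit_disk \<Longrightarrow> \<delta> < norm (\<phi> z) \<Longrightarrow>
        G_weight \<alpha> J g \<phi> j z * Omega j \<beta> (norm (\<phi> z)) \<le> a" and a0: "0 \<le> a"
      using a unfolding tail_bound_def by blast
    have "\<forall>j\<in>{..J}. \<exists>M\<ge>0. \<forall>z\<in>unit_disk. G_weight \<alpha> J g \<phi> j z \<le> M"
      using G_weight_bounded[OF adm J] by auto
    then obtain U where U: "\<And>j z. j \<le> J \<Longrightarrow> z \<in> unit_disk \<Longrightarrow> G_weight \<alpha> J g \<phi> j z \<le> U j"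
      "\<And>j. j \<le> J \<Longrightarrow> 0 \<le> U j"
      by (metis atMost_iff)
    \<comment> \<open>The J + 1 terms of the expansion and the derivatives at 0 contribute one
      \<eta> each; K1 * C1 is the cost of passing from the J-th derivative to the norm.\<close>
    define \<eta> where "\<eta> = \<epsilon> / (K1 * C1 * (real J + 2))"
    have \<eta>: "\<eta> > 0" using \<epsilon> K1 C1 by (simp add: \<eta>_def)
    define F where "F k = wcomp g \<phi> (f k)" for k
    have F: "F k holomorphic_on unit_disk" for k unfolding F_def by (intro wcomp_holomorphic gp hf)
    have "loc_null F" unfolding F_def by (intro loc_null_wcomp gp null)
    then have "loc_null (\<lambda>k. (deriv ^^ i) (F k))" for i by (rule loc_null_higher_deriv[OF F])
    from loc_nullD[OF this, of 0 \<eta>] \<eta>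
    have "\<forall>\<^sub>F k in sequentially. norm ((deriv ^^ i) (F k) 0) < \<eta>" for i by simp
    then have "\<forall>\<^sub>F k in sequentially. norm ((deriv ^^ i) (F k) 0) \<le> \<eta>" for i
      by (rule eventually_mono) (rule less_imp_le)
    then have low: "\<forall>\<^sub>F k in sequentially. \<forall>i\<in>{..<J}. norm ((deriv ^^ i) (F k) 0) \<le> \<eta>"
      by (intro eventually_ball_finite) auto
    \<comment> \<open>The denominators are U j + 1 because U j may be 0.\<close>
    have small: "\<forall>\<^sub>F k in sequentially. \<forall>z\<in>unit_disk. (j < N_index \<beta> \<or> norm (\<phi> z) \<le> \<delta>) \<longrightarrow>
        norm ((deriv ^^ j) (f k) (\<phi> z)) < \<eta> / (U j + 1)" if "j \<le> J" for j
    proof (cases "j < N_index \<beta>")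
      case True
      have "\<forall>\<^sub>F k in sequentially. \<forall>z\<in>unit_disk. norm ((deriv ^^ j) (f k) z) < \<eta> / (U j + 1)"
        by (rule low_deriv_uniformly_null[OF _ f null])
          (use True U(2)[OF that] \<eta> in \<open>auto simp: less_N_index_iff\<close>)
      then show ?thesis
        by eventually_elim (use gp in blast)
    next
      case False
      have "\<forall>\<^sub>F k in sequentially. \<forall>z\<in>cball 0 \<delta>. norm ((deriv ^^ j) (f k) z) < \<eta> / (U j + 1)"
        using U(2)[OF that] \<eta> \<delta> by (intro loc_nullD[OF loc_null_higher_deriv[OF hf null]]) auto
      then show ?thesis
        by eventually_elim (use False in auto)
    qed
    have small': "\<forall>\<^sub>F k in sequentially. \<forall>j\<in>{..J}. \<forall>z\<in>unit_disk. (j < N_index \<beta> \<or> norm (\<phi> z) \<le> \<delta>) \<longrightarrow>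
        norm ((deriv ^^ j) (f k) (\<phi> z)) < \<eta> / (U j + 1)"
      using small by (intro eventually_ball_finite) auto
    show "\<forall>\<^sub>F k in sequentially. Lambda_norm \<alpha> (wcomp g \<phi> (f k)) \<le> ennreal (K1 * C1 * (\<Sum>j\<le>J. C2 j) * M * a + \<epsilon>)"
      using low small'
    proof eventually_elim
      case (elim k)
      have "norm ((deriv ^^ J) (F k) z) \<le> (\<Sum>j\<le>J. C2 j * M * a + \<eta>) * (1 - norm z) powr (\<alpha> - real J)"
        if z: "z \<in> unit_disk" for z
      proof -
        let ?w = "(1 - norm z) powr (real J - \<alpha>)"
        have \<phi>z: "\<phi> z \<in> unit_disk" using gp z by blast
        have "norm ((deriv ^^ J) (F k) z) * ?w = norm (\<Sum>j\<le>J. G_fun g \<phi> J j z * (deriv ^^ j) (f k) (\<phi> z)) * ?w"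
          unfolding F_def by (subst higher_deriv_wcomp[OF gp hf z]) simp
        also have "\<dots> \<le> (\<Sum>j\<le>J. norm (G_fun g \<phi> J j z * (deriv ^^ j) (f k) (\<phi> z))) * ?w"
          by (intro mult_right_mono norm_sum) auto
        also have "\<dots> = (\<Sum>j\<le>J. G_weight \<alpha> J g \<phi> j z * norm ((deriv ^^ j) (f k) (\<phi> z)))"
          unfolding sum_distrib_right G_weight_def norm_mult by (simp add: mult_ac)
        also have "\<dots> \<le> (\<Sum>j\<le>J. C2 j * M * a + \<eta>)"
        proof (rule sum_mono)
          fix j assume "j \<in> {..J}"
          then have j: "j \<le> J" by simp
          have nn: "0 \<le> C2 j * M * a" using C2(1)[of j] M a0 by simp
          show "G_weight \<alpha> J g \<phi> j z * norm ((deriv ^^ j) (f k) (\<phi> z)) \<le> C2 j * M * a + \<eta>"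
          proof (cases "j < N_index \<beta> \<or> norm (\<phi> z) \<le> \<delta>")
            case True
            then have "norm ((deriv ^^ j) (f k) (\<phi> z)) < \<eta> / (U j + 1)" using elim(2) j z by blast
            then have "G_weight \<alpha> J g \<phi> j z * norm ((deriv ^^ j) (f k) (\<phi> z)) \<le> U j * (\<eta> / (U j + 1))"
              using U[OF j] z G_weight_nonneg by (intro mult_mono) auto
            also have "\<dots> \<le> \<eta>" using U(2)[OF j] \<eta> by (simp add: field_simps)
            finally show ?thesis using nn by linarith
          next
            case False
            have "G_weight \<alpha> J g \<phi> j z * norm ((deriv ^^ j) (f k) (\<phi> z))
              \<le> G_weight \<alpha> J g \<phi> j z * (C2 j * M * Omega j \<beta> (norm (\<phi> z)))"
              by (intro mult_left_mono C2(2) f \<phi>z G_weight_nonneg)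
            also have "\<dots> = C2 j * M * (G_weight \<alpha> J g \<phi> j z * Omega j \<beta> (norm (\<phi> z)))" by simp
            also have "\<dots> \<le> C2 j * M * a"
              using C2(1)[of j] M False j z by (intro mult_left_mono \<delta>(3)) auto
            finally show ?thesis using \<eta> by linarith
          qed
        qed
        finally show ?thesis
          using z by (subst (asm) mult_powr_le_iff) auto
      qed
      then have "Lambda_le \<alpha> (C1 * (\<eta> + (\<Sum>j\<le>J. C2 j * M * a + \<eta>))) (F k)"
        using elim(1) \<eta> by (intro C1(2) F) auto
      then have "Lambda_norm \<alpha> (F k) \<le> ennreal (K1 * (C1 * (\<eta> + (\<Sum>j\<le>J. C2 j * M * a + \<eta>))))"
        unfolding K1_def by (rule Lambda_norm_leI)
      also have "K1 * (C1 * (\<eta> + (\<Sum>j\<le>J. C2 j * M * a + \<eta>))) = K1 * C1 * (\<Sum>j\<le>J. C2 j) * M * a + (K1 * C1 * (real J + 2)) * \<eta>"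
      proof -
        have "(\<Sum>j\<le>J. C2 j * M * a + \<eta>) = (\<Sum>j\<le>J. C2 j) * M * a + (real J + 1) * \<eta>"
          by (simp add: sum.distrib sum_distrib_right)
        then show ?thesis by (simp add: algebra_simps)
      qed
      also have "(K1 * C1 * (real J + 2)) * \<eta> = \<epsilon>"
        using K1 C1 by (simp add: \<eta>_def)
      finally show ?case by (simp add: F_def)
    qed
  qed
  then show ?thesis ..
qed

section \<open>Compactness by normal families\<close>

lemma Lambda_unit_ball_le:
  assumes "f \<in> Lambda_unit_ball \<beta>"
  shows "Lambda_le \<beta> 1 f"
  using assms Lambda_norm_leD[of \<beta> f 1] by (simp add: Lambda_unit_ball_def)

lemma wcomp_add: "wcomp g \<phi> (\<lambda>z. f z + h z) = (\<lambda>z. wcomp g \<phi> f z + wcomp g \<phi> h z)"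
  by (auto simp: wcomp_def distrib_left)

lemma wcomp_diff: "wcomp g \<phi> (\<lambda>z. f z - h z) = (\<lambda>z. wcomp g \<phi> f z - wcomp g \<phi> h z)"
  by (auto simp: wcomp_def right_diff_distrib)

lemma wcomp_cmult: "wcomp g \<phi> (\<lambda>z. c * f z) = (\<lambda>z. c * wcomp g \<phi> f z)"
  by (auto simp: wcomp_def)

text \<open>Keeps a Montel limit inside the unit ball. For fixed z the terms of the norm involve
  finitely many derivatives, which converge; the supremum over z is taken afterwards.\<close>

lemma Lambda_norm_lower_semicontinuous:
  assumes f: "\<And>k. f k holomorphic_on unit_disk" "\<And>k. Lambda_norm \<beta> (f k) \<le> ennreal M" and M: "0 \<le> M"
    and h: "h holomorphic_on unit_disk" and null: "loc_null (\<lambda>k z. f k z - h z)"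
  shows "Lambda_norm \<beta> h \<le> ennreal M"
proof -
  let ?K = "Lambda_order \<beta>"
  have lim: "(\<lambda>k. (deriv ^^ i) (f k) z) \<longlonglongrightarrow> (deriv ^^ i) h z" if z: "z \<in> unit_disk" for i z
  proof (rule tendstoI)
    fix e :: real assume e: "e > 0"
    have d: "(deriv ^^ i) (\<lambda>z. f k z - h z) z = (deriv ^^ i) (f k) z - (deriv ^^ i) h z" for k
      by (rule higher_deriv_diff[OF f(1) h open_ball z])
    have "loc_null (\<lambda>k. (deriv ^^ i) (\<lambda>z. f k z - h z))"
      using f h null by (intro loc_null_higher_deriv holomorphic_intros)
    from loc_nullD[OF this, of "norm z" e] e z
    have "\<forall>\<^sub>F k in sequentially. \<forall>w\<in>cball 0 (norm z). norm ((deriv ^^ i) (\<lambda>z. f k z - h z) w) < e" by simp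
    then show "\<forall>\<^sub>F k in sequentially. dist ((deriv ^^ i) (f k) z) ((deriv ^^ i) h z) < e"
      by eventually_elim (simp add: dist_norm d[symmetric])
  qed
  have "(\<Sum>j<?K. ennreal (norm ((deriv ^^ j) h 0))) + ennreal (norm ((deriv ^^ ?K) h z) * (1 - norm z) powr (real ?K - \<beta>)) \<le> ennreal M"
    if z: "z \<in> unit_disk" for z
  proof -
    let ?V = "\<lambda>f. (\<Sum>j<?K. norm ((deriv ^^ j) f 0)) + norm ((deriv ^^ ?K) f z) * (1 - norm z) powr (real ?K - \<beta>)"
    have V: "(\<Sum>j<?K. ennreal (norm ((deriv ^^ j) f 0))) + ennreal (norm ((deriv ^^ ?K) f z) * (1 - norm z) powr (real ?K - \<beta>))
        = ennreal (?V f)" for f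
      by (simp add: sum_ennreal sum_nonneg)
    have "?V h \<le> M"
    proof (rule tendsto_upperbound)
      show "(\<lambda>k. ?V (f k)) \<longlonglongrightarrow> ?V h"
        using z by (intro tendsto_add tendsto_sum tendsto_mult tendsto_const tendsto_norm lim) auto
      have "?V (f k) \<le> M" for k
      proof -
        have "ennreal (?V (f k)) \<le> Lambda_norm \<beta> (f k)"
          unfolding V[symmetric] Lambda_norm_def Let_def using f(1) z
          by (simp only: if_True) (intro add_left_mono SUP_upper)
        also have "\<dots> \<le> ennreal M" by (rule f(2))
        finally show ?thesis using M by simp
      qed
      then show "\<forall>\<^sub>F k in sequentially. ?V (f k) \<le> M" by simp
    qed simp
    then show ?thesis unfolding V by (rule ennreal_leI)
  qed
  then show ?thesis
    using h unfolding Lambda_norm_def Let_def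
    by (simp only: if_True) (subst ennreal_SUP_add_right, auto intro!: SUP_least simp del: sum_ennreal)
qed

lemma Lambda_norm_disk_restrict: "Lambda_norm \<beta> (disk_restrict f) = Lambda_norm \<beta> f"
  unfolding Lambda_norm_def Let_def disk_restrict_holomorphic
  by (cases "f holomorphic_on unit_disk")
    (simp_all add: higher_deriv_disk_restrict cong: SUP_cong_simp)

lemma Lambda_le_Montel:
  assumes "\<And>k. Lambda_le \<beta> M (f k)"
  obtains h r where "h holomorphic_on unit_disk" "strict_mono (r :: nat \<Rightarrow> nat)" "loc_null (\<lambda>k z. f (r k) z - h z)"
proof -
  have hol: "h holomorphic_on unit_disk" if "h \<in> Collect (Lambda_le \<beta> M)" for h
    using that by (simp add: Lambda_le_def)
  have "\<exists>B. \<forall>h\<in>Collect (Lambda_le \<beta> M). \<forall>z\<in>A. norm (h z) \<le> B" if A: "compact A" "A \<subseteq> unit_disk" for A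
  proof (cases "A = {}")
    case False
    have "compact (norm ` A)" using A by (intro compact_continuous_image continuous_intros)
    from compact_attains_sup[OF this] False obtain z where z: "z \<in> A" "\<And>w. w \<in> A \<Longrightarrow> norm w \<le> norm z" by auto
    then have "norm z < 1" using A by auto
    then obtain B where B: "\<And>f w. Lambda_le \<beta> M f \<Longrightarrow> w \<in> cball 0 (norm z) \<Longrightarrow> norm ((deriv ^^ 0) f w) \<le> B"
      using Lambda_le_bounded[of "norm z" \<beta> M 0] by auto
    then show ?thesis using z(2) by (intro exI[of _ B]) auto
  qed simp
  note bnd = this
  have rng: "range f \<subseteq> Collect (Lambda_le \<beta> M)" using assms by auto
  obtain h r where h: "h holomorphic_on unit_disk" "strict_mono (r :: nat \<Rightarrow> nat)"
    "\<And>A. compact A \<Longrightarrow> A \<subseteq> unit_disk \<Longrightarrow> uniform_limit A (f \<circ> r) h sequentially"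
    by (rule Montel[OF open_ball hol bnd rng]) blast+
  have "loc_null (\<lambda>k z. f (r k) z - h z)"
    unfolding loc_null_def
  proof (intro allI impI)
    fix \<rho> \<epsilon> :: real assume "\<rho> < 1" "\<epsilon> > 0"
    moreover have "uniform_limit (cball 0 \<rho>) (f \<circ> r) h sequentially" using \<open>\<rho> < 1\<close> by (intro h) auto
    ultimately show "\<forall>\<^sub>F k in sequentially. \<forall>z\<in>cball 0 \<rho>. norm (f (r k) z - h z) < \<epsilon>"
      by (auto dest: uniform_limitD simp: dist_norm)
  qed
  then show ?thesis using h that by blast
qed

text \<open>The image of the unit ball is itself compact and hence closed: the locally uniform limit
  stays in the ball, and the null-sequence estimate turns local convergence into convergence in norm
  of the images.\<close>

lemma wcomp_compact:
  assumes J: "\<alpha> < real J" and adm: "admissible \<beta> \<alpha> g \<phi>"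
    and tail: "\<And>a. a > 0 \<Longrightarrow> tail_bound \<beta> \<alpha> J g \<phi> a"
  shows "Lambda_compact \<beta> \<alpha> (wcomp g \<phi>)"
proof -
  interpret X: Metric_space "Lambda_space \<alpha>" "Lambda_dist \<alpha>" by (rule Metric_space_Lambda)
  have lin: "Lambda_linear \<beta> \<alpha> (wcomp g \<phi>)"
    using adm by (simp add: admissible_def Lambda_bounded_def)
  then have im: "wcomp g \<phi> f \<in> Lambda_space \<alpha>" if "f \<in> Lambda_space \<beta>" for f
    using that by (auto simp: Lambda_linear_def)
  obtain C where C: "null_seq_const \<beta> \<alpha> J C" using null_seq_const_exists[OF J] by blast
  have C0: "0 < C" using C by (simp add: null_seq_const_def)
  have "compactin X.mtopology (wcomp g \<phi> ` Lambda_unit_ball \<beta>)"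
    unfolding X.compactin_sequentially
  proof (intro conjI allI impI)
    show "wcomp g \<phi> ` Lambda_unit_ball \<beta> \<subseteq> Lambda_space \<alpha>"
      using im by (auto simp: Lambda_unit_ball_def)
    fix \<sigma> :: "nat \<Rightarrow> complex \<Rightarrow> complex"
    assume "range \<sigma> \<subseteq> wcomp g \<phi> ` Lambda_unit_ball \<beta>"
    then have "\<forall>k. \<exists>f. f \<in> Lambda_unit_ball \<beta> \<and> \<sigma> k = wcomp g \<phi> f" by blast
    then obtain f where f: "\<And>k. f k \<in> Lambda_unit_ball \<beta>" "\<And>k. \<sigma> k = wcomp g \<phi> (f k)" by metis
    have f1: "Lambda_le \<beta> 1 (f k)" for k using f(1) by (rule Lambda_unit_ball_le)
    obtain h r where h: "h holomorphic_on unit_disk" "strict_mono (r :: nat \<Rightarrow> nat)"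
      "loc_null (\<lambda>k z. f (r k) z - h z)"
      by (rule Lambda_le_Montel[where f = f and \<beta> = \<beta> and M = 1]) (use f1 in auto)
    have hn: "Lambda_norm \<beta> h \<le> ennreal 1"
    proof (rule Lambda_norm_lower_semicontinuous[where f = "\<lambda>k. f (r k)"])
      show "f (r k) holomorphic_on unit_disk" for k using f1[of "r k"] by (simp add: Lambda_le_def)
      show "Lambda_norm \<beta> (f (r k)) \<le> ennreal 1" for k using f(1)[of "r k"] by (simp add: Lambda_unit_ball_def)
    qed (use h in simp_all)
    define l where "l = disk_restrict h"
    have l: "l \<in> Lambda_space \<beta>"
      unfolding l_def by (rule Lambda_spaceI[OF Lambda_norm_leD[OF hn]]) simp
    then have lB: "l \<in> Lambda_unit_ball \<beta>"
      using hn by (simp add: Lambda_unit_ball_def l_def Lambda_norm_disk_restrict)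
    then have l1: "Lambda_le \<beta> 1 l" by (rule Lambda_unit_ball_le)
    have null: "loc_null (\<lambda>k z. f (r k) z - l z)"
      unfolding loc_null_def
    proof (intro allI impI)
      fix \<rho> e :: real assume \<rho>: "\<rho> < 1" and e: "e > 0"
      show "\<forall>\<^sub>F k in sequentially. \<forall>z\<in>cball 0 \<rho>. norm (f (r k) z - l z) < e"
        using loc_nullD[OF h(3) \<rho> e] by eventually_elim (use \<rho> in \<open>auto simp: l_def disk_restrict_def\<close>)
    qed
    have d2: "Lambda_le \<beta> 2 (\<lambda>z. f (r k) z - l z)" for k
      using Lambda_le_diff[OF f1 l1, of "r k"] by simp
    have "limitin X.mtopology (\<sigma> \<circ> r) (wcomp g \<phi> l) sequentially"
      unfolding X.limit_metric_sequentially
    proof (intro conjI allI impI im l)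
      fix e :: real assume e: "e > 0"
      \<comment> \<open>Differences of two members of the ball satisfy \<open>Lambda_le\<close> with
        bound 2, so the main term C * 2 * a is e / 4.\<close>
      define a where "a = e / (8 * C)"
      have a: "a > 0" using e C0 by (simp add: a_def)
      have Ca: "C * 2 * a + e / 4 = e / 2" using C0 by (simp add: a_def)
      have "\<forall>\<^sub>F k in sequentially. Lambda_norm \<alpha> (wcomp g \<phi> (\<lambda>z. f (r k) z - l z)) \<le> ennreal (C * 2 * a + e / 4)"
        using e by (intro wcomp_null_sequence[OF C adm tail[OF a] d2 null]) auto
      then obtain n where n: "\<And>k. k \<ge> n \<Longrightarrow> Lambda_norm \<alpha> (\<lambda>z. wcomp g \<phi> (f (r k)) z - wcomp g \<phi> l z) \<le> ennreal (e / 2)"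
        unfolding Ca wcomp_diff eventually_sequentially by blast
      show "\<exists>N. \<forall>n\<ge>N. (\<sigma> \<circ> r) n \<in> Lambda_space \<alpha> \<and> Lambda_dist \<alpha> ((\<sigma> \<circ> r) n) (wcomp g \<phi> l) < e"
      proof (intro exI[of _ n] allI impI conjI)
        fix k assume k: "k \<ge> n"
        show "(\<sigma> \<circ> r) k \<in> Lambda_space \<alpha>" using f im by (auto simp: Lambda_unit_ball_def)
        have "Lambda_dist \<alpha> ((\<sigma> \<circ> r) k) (wcomp g \<phi> l) \<le> enn2real (ennreal (e / 2))"
          unfolding Lambda_dist_def using n[OF k] by (intro enn2real_mono) (auto simp: f)
        also have "\<dots> < e" using e by simp
        finally show "Lambda_dist \<alpha> ((\<sigma> \<circ> r) k) (wcomp g \<phi> l) < e" .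
      qed
    qed
    then show "\<exists>l r. l \<in> wcomp g \<phi> ` Lambda_unit_ball \<beta> \<and> strict_mono r \<and> limitin X.mtopology (\<sigma> \<circ> r) l sequentially"
      using lB h(2) by blast
  qed
  moreover from this have "closedin X.mtopology (wcomp g \<phi> ` Lambda_unit_ball \<beta>)"
    by (intro compactin_imp_closedin X.Hausdorff_space_mtopology)
  ultimately show ?thesis
    using lin by (simp add: Lambda_compact_def Lambda_topology_def closure_of_closedin)
qed

text \<open>Scaling into the unit ball. It is applied to \<open>wcomp\<close> and to its difference
  from a compact operator.\<close>

lemma Lambda_norm_image_le:
  assumes T: "\<And>c f. f \<in> Lambda_space \<beta> \<Longrightarrow> T (\<lambda>z. c * f z) = (\<lambda>z. c * T f z)"
    and hol: "\<And>f. f \<in> Lambda_space \<beta> \<Longrightarrow> T f holomorphic_on unit_disk"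
    and f: "f \<in> Lambda_space \<beta>" "Lambda_norm \<beta> f \<le> ennreal M" and M: "M > 0"
  shows "Lambda_norm \<alpha> (T f) \<le> ennreal M * Lambda_onorm \<beta> \<alpha> T"
proof -
  define h where "h z = complex_of_real (1 / M) * f z" for z
  have fh: "f holomorphic_on unit_disk" using f by (simp add: Lambda_space_def)
  have "Lambda_norm \<beta> h = ennreal (1 / M) * Lambda_norm \<beta> f"
    unfolding h_def using M by (subst Lambda_norm_cmult[OF fh]) (simp add: norm_divide)
  also have "\<dots> \<le> ennreal (1 / M) * ennreal M" using f(2) by (intro mult_left_mono) auto
  also have "\<dots> = 1" using M by (simp flip: ennreal_mult)
  finally have hn: "Lambda_norm \<beta> h \<le> 1" .
  have "h holomorphic_on unit_disk" unfolding h_def[abs_def] using fh by (intro holomorphic_intros)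
  then have h: "h \<in> Lambda_unit_ball \<beta>"
    using hn f(1) le_less_trans[OF hn, of top] by (simp add: Lambda_unit_ball_def Lambda_space_def h_def)
  have hs: "h \<in> Lambda_space \<beta>" using h by (simp add: Lambda_unit_ball_def)
  have "T f = T (\<lambda>z. of_real M * h z)" using M by (simp add: h_def)
  also have "\<dots> = (\<lambda>z. of_real M * T h z)" by (rule T[OF hs])
  finally have "Lambda_norm \<alpha> (T f) = ennreal M * Lambda_norm \<alpha> (T h)"
    using M by (simp add: Lambda_norm_cmult[OF hol[OF hs]])
  also have "\<dots> \<le> ennreal M * Lambda_onorm \<beta> \<alpha> T"
    unfolding Lambda_onorm_def using h by (intro mult_left_mono SUP_upper) auto
  finally show ?thesis .
qed

text \<open>The bound M is not enlarged: the chain rule contributes r^n \<le> 1, and the weight at z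
  is at most the weight at r z because its exponent is positive.\<close>

lemma Lambda_le_dilation:
  assumes f: "Lambda_le \<beta> M f" and r: "0 < r" "r < 1"
  shows "Lambda_le \<beta> M (\<lambda>z. f (of_real r * z))"
proof -
  let ?K = "Lambda_order \<beta>"
  have fh: "f holomorphic_on unit_disk" using f by (simp add: Lambda_le_def)
  have rz: "of_real r * z \<in> unit_disk" "norm (of_real r * z) \<le> norm z" if "z \<in> unit_disk" for z
  proof -
    have "r * norm z \<le> 1 * norm z" using r by (intro mult_right_mono) auto
    then show "of_real r * z \<in> unit_disk" "norm (of_real r * z) \<le> norm z"
      using that r by (simp_all add: norm_mult)
  qed
  have d: "norm ((deriv ^^ n) (\<lambda>z. f (of_real r * z)) z) \<le> norm ((deriv ^^ n) f (of_real r * z))" if "z \<in> unit_disk" for n z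
  proof -
    have "norm ((deriv ^^ n) (\<lambda>z. f (of_real r * z)) z) = r ^ n * norm ((deriv ^^ n) f (of_real r * z))"
      using r rz by (subst higher_deriv_compose_linear[OF fh open_ball open_ball that]) (auto simp: norm_mult norm_power)
    also have "\<dots> \<le> 1 * norm ((deriv ^^ n) f (of_real r * z))"
      using r by (intro mult_right_mono power_le_one) auto
    finally show ?thesis by simp
  qed
  show ?thesis
    unfolding Lambda_le_def
  proof (intro conjI allI impI ballI)
    have "(f \<circ> (\<lambda>z. of_real r * z)) holomorphic_on unit_disk"
      using rz fh by (intro holomorphic_on_compose_gen[of _ _ _ unit_disk] holomorphic_intros) auto
    then show "(\<lambda>z. f (of_real r * z)) holomorphic_on unit_disk" by (simp add: o_def)
    show "norm ((deriv ^^ i) (\<lambda>z. f (of_real r * z)) 0) \<le> M" if "i < ?K" for i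
      using d[of 0 i] f that by (auto simp: Lambda_le_def intro: order.trans)
    fix z :: complex assume z: "z \<in> unit_disk"
    have "norm ((deriv ^^ ?K) (\<lambda>z. f (of_real r * z)) z) * (1 - norm z) powr (real ?K - \<beta>)
        \<le> norm ((deriv ^^ ?K) f (of_real r * z)) * (1 - norm (of_real r * z)) powr (real ?K - \<beta>)"
      using d[OF z] z rz[OF z] Lambda_order_gt[of \<beta>] by (intro mult_mono powr_mono2) auto
    also have "\<dots> \<le> M" using f rz[OF z] by (simp add: Lambda_le_def)
    finally show "norm ((deriv ^^ ?K) (\<lambda>z. f (of_real r * z)) z) * (1 - norm z) powr (real ?K - \<beta>) \<le> M" .
  qed
qed

lemma wcomp_dilation:
  assumes "\<phi> ` unit_disk \<subseteq> unit_disk"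
  shows "wcomp g (\<lambda>z. of_real r * \<phi> z) f = wcomp g \<phi> (disk_restrict (\<lambda>z. f (of_real r * z)))"
  using assms by (auto simp: wcomp_def disk_restrict_def fun_eq_iff image_subset_iff)

text \<open>Replacing \<phi> by r \<phi> amounts to applying the original operator to a dilated
  function, so boundedness is inherited.\<close>

lemma admissible_dilation:
  assumes adm: "admissible \<beta> \<alpha> g \<phi>" and r: "0 < r" "r < 1"
  shows "admissible \<beta> \<alpha> g (\<lambda>z. of_real r * \<phi> z)"
proof -
  have gp: "g holomorphic_on unit_disk" "\<phi> holomorphic_on unit_disk" "\<phi> ` unit_disk \<subseteq> unit_disk"
    and b: "Lambda_bounded \<beta> \<alpha> (wcomp g \<phi>)"
    using adm by (auto simp: admissible_def)
  note dil = wcomp_dilation[OF gp(3)]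
  have im: "wcomp g \<phi> f \<in> Lambda_space \<alpha>" if "f \<in> Lambda_space \<beta>" for f
    using b that by (auto simp: Lambda_bounded_def Lambda_linear_def)
  have "wcomp g (\<lambda>z. of_real r * \<phi> z) f \<in> Lambda_space \<alpha>" if f: "f \<in> Lambda_space \<beta>" for f
  proof -
    obtain M where "Lambda_le \<beta> M f" using f by (rule Lambda_space_leD)
    from Lambda_le_dilation[OF this r] show ?thesis
      unfolding dil by (intro im Lambda_spaceI)
  qed
  moreover have "Lambda_onorm \<beta> \<alpha> (wcomp g (\<lambda>z. of_real r * \<phi> z)) < \<infinity>"
  proof -
    let ?K1 = "real (Lambda_order \<beta>) + 1"
    have "Lambda_onorm \<beta> \<alpha> (wcomp g (\<lambda>z. of_real r * \<phi> z)) \<le> ennreal ?K1 * Lambda_onorm \<beta> \<alpha> (wcomp g \<phi>)"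
      unfolding Lambda_onorm_def[of _ _ "wcomp g (\<lambda>z. of_real r * \<phi> z)"]
    proof (rule SUP_least)
      fix f assume "f \<in> Lambda_unit_ball \<beta>"
      from Lambda_le_dilation[OF Lambda_unit_ball_le[OF this] r]
      have d: "Lambda_le \<beta> 1 (\<lambda>z. f (of_real r * z))" .
      then have "Lambda_norm \<beta> (disk_restrict (\<lambda>z. f (of_real r * z))) \<le> ennreal ?K1"
        using Lambda_norm_leI[of \<beta> 1 "disk_restrict (\<lambda>z. f (of_real r * z))"] by (simp add: Lambda_le_disk_restrict)
      then show "Lambda_norm \<alpha> (wcomp g (\<lambda>z. of_real r * \<phi> z) f) \<le> ennreal ?K1 * Lambda_onorm \<beta> \<alpha> (wcomp g \<phi>)"
        unfolding dil using im
        by (intro Lambda_norm_image_le wcomp_cmult Lambda_spaceI[OF d]) (auto simp: Lambda_space_def)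
    qed
    also have "\<dots> < \<infinity>" using b by (simp add: Lambda_bounded_def ennreal_mult_less_top)
    finally show ?thesis .
  qed
  ultimately have "Lambda_bounded \<beta> \<alpha> (wcomp g (\<lambda>z. of_real r * \<phi> z))"
    by (auto simp: Lambda_bounded_def Lambda_linear_def wcomp_add wcomp_cmult)
  moreover have "(\<lambda>z. of_real r * \<phi> z) ` unit_disk \<subseteq> unit_disk"
  proof safe
    fix z :: complex assume "z \<in> unit_disk"
    then have "norm (\<phi> z) < 1" using gp(3) by (simp add: image_subset_iff)
    moreover have "r * norm (\<phi> z) \<le> 1 * norm (\<phi> z)" using r by (intro mult_right_mono) auto
    ultimately show "of_real r * \<phi> z \<in> unit_disk" using r by (simp add: norm_mult)
  qed
  ultimately show ?thesis using gp by (auto simp: admissible_def intro!: holomorphic_intros)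
qed

text \<open>Since |r \<phi>| \<le> r, the tail conditions are void beyond \<delta> = r.\<close>

lemma dilation_compact:
  assumes J: "\<alpha> < real J" and adm: "admissible \<beta> \<alpha> g \<phi>" and r: "0 < r" "r < 1"
  shows "Lambda_compact \<beta> \<alpha> (wcomp g (\<lambda>z. of_real r * \<phi> z))"
proof (rule wcomp_compact[OF J admissible_dilation[OF adm r]])
  fix a :: real assume a: "a > 0"
  have "norm (of_real r * \<phi> z) \<le> r" if "z \<in> unit_disk" for z
  proof -
    have "norm (\<phi> z) \<le> 1" using adm that by (auto simp: admissible_def image_subset_iff intro: less_imp_le)
    then show ?thesis using r by (simp add: norm_mult mult_left_le)
  qed
  then show "tail_bound \<beta> \<alpha> J g (\<lambda>z. of_real r * \<phi> z) a"
    unfolding tail_bound_def using a r by (intro conjI exI[of _ r]) (auto simp: not_less[symmetric])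
qed

text \<open>The derivatives are bounded on smaller disks uniformly over the whole sequence, so f_k
  and the dilation factor may vary together.\<close>

lemma dilation_diff_null:
  fixes s :: "nat \<Rightarrow> real"
  assumes f: "\<And>k. Lambda_le \<beta> M (f k)" and s: "\<And>k. 0 < s k" "\<And>k. s k < 1" "s \<longlonglongrightarrow> 1"
  shows "loc_null (\<lambda>k z. f k z - f k (of_real (s k) * z))"
  unfolding loc_null_def
proof (intro allI impI)
  fix \<rho> \<epsilon> :: real assume \<rho>: "\<rho> < 1" and \<epsilon>: "\<epsilon> > 0"
  show "\<forall>\<^sub>F k in sequentially. \<forall>z\<in>cball 0 \<rho>. norm (f k z - f k (of_real (s k) * z)) < \<epsilon>"
  proof (cases "\<rho> < 0")
    case False
    obtain B where B: "\<And>f z. Lambda_le \<beta> M f \<Longrightarrow> z \<in> cball 0 \<rho> \<Longrightarrow> norm ((deriv ^^ 1) f z) \<le> B"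
      using Lambda_le_bounded[of \<rho> \<beta> M 1] \<rho> False by auto
    have "(\<lambda>k. \<bar>B\<bar> * (1 - s k)) \<longlonglongrightarrow> \<bar>B\<bar> * (1 - 1)"
      by (intro tendsto_intros s)
    then have "\<forall>\<^sub>F k in sequentially. \<bar>B\<bar> * (1 - s k) < \<epsilon>" using \<epsilon> by (intro order_tendstoD) auto
    then show ?thesis
    proof eventually_elim
      case (elim k)
      show ?case
      proof
        fix z :: complex assume z: "z \<in> cball 0 \<rho>"
        have "s k * norm z \<le> 1 * norm z" using s(1,2)[of k] by (intro mult_right_mono) auto
        then have sz: "of_real (s k) * z \<in> cball 0 \<rho>" using z s(1)[of k] by (simp add: norm_mult)
        have "norm (f k z - f k (of_real (s k) * z)) \<le> B * norm (z - of_real (s k) * z)"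
        proof (rule field_differentiable_bound[OF convex_cball _ _ z sz])
          fix w :: complex assume w: "w \<in> cball 0 \<rho>"
          have "(f k has_field_derivative deriv (f k) w) (at w)"
            using f w \<rho> by (intro holomorphic_derivI[of _ unit_disk]) (auto simp: Lambda_le_def)
          then show "(f k has_field_derivative deriv (f k) w) (at w within cball 0 \<rho>)"
            by (rule has_field_derivative_at_within)
          show "norm (deriv (f k) w) \<le> B" using B[OF f w] by simp
        qed
        also have "\<dots> = B * ((1 - s k) * norm z)"
        proof -
          have "z - of_real (s k) * z = of_real (1 - s k) * z" by (simp add: algebra_simps)
          then show ?thesis using s(2)[of k] by (simp only: norm_mult norm_of_real)
        qed
        also have "\<dots> \<le> \<bar>B\<bar> * ((1 - s k) * 1)"
          using z \<rho> s(2)[of k] by (intro mult_mono) auto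
        also have "\<dots> < \<epsilon>" using elim by simp
        finally show "norm (f k z - f k (of_real (s k) * z)) < \<epsilon>" .
      qed
    qed
  qed simp
qed

text \<open>Argued by contradiction, which turns the supremum over the unit ball into a sequence:
  each dilation factor s_k fails to approximate at some f_k, but f_k - f_k (s_k z) is a locally null
  sequence with bound 2. Hence the constant C * 2.\<close>

lemma ess_norm_upper:
  assumes J: "\<alpha> < real J"
  obtains C where "C > 0"
    "\<And>g \<phi> a. admissible \<beta> \<alpha> g \<phi> \<Longrightarrow> tail_bound \<beta> \<alpha> J g \<phi> a \<Longrightarrow>
      Lambda_ess_norm \<beta> \<alpha> (wcomp g \<phi>) \<le> ennreal (C * a)"
proof -
  obtain C where C: "null_seq_const \<beta> \<alpha> J C" using null_seq_const_exists[OF J] by blast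
  have C0: "0 < C" using C by (simp add: null_seq_const_def)
  show ?thesis
  proof (rule that[of "C * 2"])
    fix g \<phi> a assume adm: "admissible \<beta> \<alpha> g \<phi>" and tail: "tail_bound \<beta> \<alpha> J g \<phi> a"
    have im: "\<phi> ` unit_disk \<subseteq> unit_disk" using adm by (simp add: admissible_def)
    have a: "0 \<le> a" using tail by (simp add: tail_bound_def)
    show "Lambda_ess_norm \<beta> \<alpha> (wcomp g \<phi>) \<le> ennreal (C * 2 * a)"
    proof (rule ennreal_le_epsilon)
      fix \<epsilon> :: real assume \<epsilon>: "0 < \<epsilon>"
      show "Lambda_ess_norm \<beta> \<alpha> (wcomp g \<phi>) \<le> ennreal (C * 2 * a) + ennreal \<epsilon>"
      proof (rule ccontr)
        assume neg: "\<not> ?thesis"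
        define s where "s k = 1 - 1 / (real k + 2)" for k
        have s: "0 < s k" "s k < 1" for k by (auto simp: s_def field_simps)
        have s1: "s \<longlonglongrightarrow> 1" unfolding s_def by real_asymp
        let ?Q = "\<lambda>k. wcomp g (\<lambda>z. of_real (s k) * \<phi> z)"
        have "\<exists>f\<in>Lambda_unit_ball \<beta>. ennreal (C * 2 * a + \<epsilon>) < Lambda_norm \<alpha> (\<lambda>z. wcomp g \<phi> f z - ?Q k f z)" for k
        proof -
          have "ennreal (C * 2 * a + \<epsilon>) = ennreal (C * 2 * a) + ennreal \<epsilon>"
            using C0 a \<epsilon> by (intro ennreal_plus) auto
          also have "\<dots> < Lambda_ess_norm \<beta> \<alpha> (wcomp g \<phi>)" using neg by (simp add: not_le)
          also have "\<dots> \<le> Lambda_onorm \<beta> \<alpha> (\<lambda>f z. wcomp g \<phi> f z - ?Q k f z)"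
            unfolding Lambda_ess_norm_def using dilation_compact[OF J adm s] by (intro INF_lower) simp
          finally show ?thesis by (simp add: Lambda_onorm_def less_SUP_iff)
        qed
        then obtain f where f: "\<And>k. f k \<in> Lambda_unit_ball \<beta>"
          "\<And>k. ennreal (C * 2 * a + \<epsilon>) < Lambda_norm \<alpha> (\<lambda>z. wcomp g \<phi> (f k) z - ?Q k (f k) z)"
          by metis
        have f1: "Lambda_le \<beta> 1 (f k)" for k using f(1) by (rule Lambda_unit_ball_le)
        define h where "h k z = f k z - f k (of_real (s k) * z)" for k z
        have h2: "Lambda_le \<beta> 2 (h k)" for k
          unfolding h_def using Lambda_le_diff[OF f1 Lambda_le_dilation[OF f1 s], of k k k] by simp
        have hn: "loc_null h" unfolding h_def by (rule dilation_diff_null[OF f1 s s1])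
        have wh: "wcomp g \<phi> (h k) = (\<lambda>z. wcomp g \<phi> (f k) z - ?Q k (f k) z)" for k
          unfolding h_def by (auto simp: wcomp_def right_diff_distrib)
        from wcomp_null_sequence[OF C adm tail h2 hn \<epsilon>]
        obtain k where "Lambda_norm \<alpha> (wcomp g \<phi> (h k)) \<le> ennreal (C * 2 * a + \<epsilon>)"
          by (auto simp: eventually_sequentially)
        with f(2)[of k] show False unfolding wh by simp
      qed
    qed
  qed (use C0 in simp)
qed

section \<open>Compact operators and locally null sequences\<close>

lemma Lambda_space_add:
  assumes "f \<in> Lambda_space \<beta>" "h \<in> Lambda_space \<beta>"
  shows "(\<lambda>z. f z + h z) \<in> Lambda_space \<beta>"
proof -
  have "Lambda_norm \<beta> (\<lambda>z. f z + h z) \<le> Lambda_norm \<beta> f + Lambda_norm \<beta> h"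
    using assms by (intro Lambda_norm_add) (auto simp: Lambda_space_def)
  also have "\<dots> < \<infinity>" using assms by (simp add: Lambda_space_def)
  finally show ?thesis using assms by (auto simp: Lambda_space_def intro!: holomorphic_intros)
qed

lemma Lambda_space_cmult:
  assumes "f \<in> Lambda_space \<beta>"
  shows "(\<lambda>z. c * f z) \<in> Lambda_space \<beta>"
proof -
  have "Lambda_norm \<beta> (\<lambda>z. c * f z) = ennreal (norm c) * Lambda_norm \<beta> f"
    using assms by (intro Lambda_norm_cmult) (auto simp: Lambda_space_def)
  also have "\<dots> < \<infinity>" using assms by (simp add: Lambda_space_def ennreal_mult_less_top)
  finally show ?thesis using assms by (auto simp: Lambda_space_def intro!: holomorphic_intros)
qed

lemma Lambda_space_0: "(\<lambda>z. 0) \<in> Lambda_space \<beta>"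
  by (simp add: Lambda_space_def Lambda_norm_0)

text \<open>The finite norm as a real number, for use on \<open>Lambda_space\<close>, where the
  gliding hump needs subtraction.\<close>

definition rnorm :: "real \<Rightarrow> (complex \<Rightarrow> complex) \<Rightarrow> real" where
  "rnorm \<alpha> f = enn2real (Lambda_norm \<alpha> f)"

lemma Lambda_norm_eq_rnorm: "f \<in> Lambda_space \<alpha> \<Longrightarrow> Lambda_norm \<alpha> f = ennreal (rnorm \<alpha> f)"
  by (simp add: rnorm_def Lambda_space_def)

lemma rnorm_nonneg: "0 \<le> rnorm \<alpha> f"
  by (simp add: rnorm_def)

lemma rnorm_add:
  assumes "f \<in> Lambda_space \<alpha>" "h \<in> Lambda_space \<alpha>"
  shows "rnorm \<alpha> (\<lambda>z. f z + h z) \<le> rnorm \<alpha> f + rnorm \<alpha> h"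
proof -
  have "ennreal (rnorm \<alpha> (\<lambda>z. f z + h z)) \<le> ennreal (rnorm \<alpha> f) + ennreal (rnorm \<alpha> h)"
    using Lambda_norm_add[of f h \<alpha>] assms Lambda_space_add[OF assms]
    by (simp add: Lambda_norm_eq_rnorm[symmetric] Lambda_space_def)
  then show ?thesis using rnorm_nonneg by (simp flip: ennreal_plus)
qed

lemma rnorm_cmult:
  assumes "f \<in> Lambda_space \<alpha>"
  shows "rnorm \<alpha> (\<lambda>z. c * f z) = norm c * rnorm \<alpha> f"
  using Lambda_norm_cmult[of f \<alpha> c] assms by (simp add: rnorm_def Lambda_space_def enn2real_mult)

text \<open>The little-o condition at the circle, as for the little Bloch space.\<close>

definition little :: "real \<Rightarrow> (complex \<Rightarrow> complex) \<Rightarrow> bool" where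
  "little \<beta> f \<longleftrightarrow> (\<forall>\<epsilon>>0. \<exists>\<rho><1. \<forall>z\<in>unit_disk. \<rho> < norm z \<longrightarrow>
     norm ((deriv ^^ Lambda_order \<beta>) f z) * (1 - norm z) powr (real (Lambda_order \<beta>) - \<beta>) < \<epsilon>)"

lemma little_add:
  assumes "little \<beta> f" "little \<beta> h" "f holomorphic_on unit_disk" "h holomorphic_on unit_disk"
  shows "little \<beta> (\<lambda>z. f z + h z)"
  unfolding little_def
proof (intro allI impI)
  fix \<epsilon> :: real assume \<epsilon>: "\<epsilon> > 0"
  let ?K = "Lambda_order \<beta>"
  let ?w = "\<lambda>z::complex. (1 - norm z) powr (real ?K - \<beta>)"
  obtain \<rho>1 where \<rho>1: "\<rho>1 < 1" "\<And>z. z \<in> unit_disk \<Longrightarrow> \<rho>1 < norm z \<Longrightarrow> norm ((deriv ^^ ?K) f z) * ?w z < \<epsilon> / 2"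
    using assms(1)[unfolded little_def, rule_format, of "\<epsilon> / 2"] \<epsilon> by auto
  obtain \<rho>2 where \<rho>2: "\<rho>2 < 1" "\<And>z. z \<in> unit_disk \<Longrightarrow> \<rho>2 < norm z \<Longrightarrow> norm ((deriv ^^ ?K) h z) * ?w z < \<epsilon> / 2"
    using assms(2)[unfolded little_def, rule_format, of "\<epsilon> / 2"] \<epsilon> by auto
  show "\<exists>\<rho><1. \<forall>z\<in>unit_disk. \<rho> < norm z \<longrightarrow> norm ((deriv ^^ ?K) (\<lambda>z. f z + h z) z) * ?w z < \<epsilon>"
  proof (intro exI[of _ "max \<rho>1 \<rho>2"] conjI ballI impI)
    fix z :: complex assume z: "z \<in> unit_disk" "max \<rho>1 \<rho>2 < norm z"
    have "norm ((deriv ^^ ?K) (\<lambda>z. f z + h z) z) * ?w z \<le> (norm ((deriv ^^ ?K) f z) + norm ((deriv ^^ ?K) h z)) * ?w z"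
      using higher_deriv_add[OF assms(3,4) open_ball z(1)] by (intro mult_right_mono) (simp_all add: norm_triangle_ineq)
    also have "\<dots> < \<epsilon>" using \<rho>1(2)[of z] \<rho>2(2)[of z] z by (simp add: distrib_right)
    finally show "norm ((deriv ^^ ?K) (\<lambda>z. f z + h z) z) * ?w z < \<epsilon>" .
  qed (use \<rho>1 \<rho>2 in simp)
qed

lemma little_0: "little \<beta> (\<lambda>z. 0)"
  unfolding little_def by (auto intro: exI[of _ 0])

lemma little_entire:
  assumes f: "f holomorphic_on S" and S: "open S" "cball 0 1 \<subseteq> S"
  shows "little \<beta> f"
proof -
  let ?K = "Lambda_order \<beta>"
  obtain B where B: "\<And>z. z \<in> cball 0 1 \<Longrightarrow> norm ((deriv ^^ ?K) f z) \<le> B" and B0: "0 \<le> B"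
    using higher_deriv_bounded_disk[OF assms] by metis
  show ?thesis
    unfolding little_def
  proof (intro allI impI)
    fix \<epsilon> :: real assume \<epsilon>: "\<epsilon> > 0"
    have "((\<lambda>t. B * (1 - t) powr (real ?K - \<beta>)) \<longlongrightarrow> B * 0) (at_left 1)"
      using Lambda_order_gt[of \<beta>] by (intro tendsto_mult tendsto_const) real_asymp
    then have "\<forall>\<^sub>F t in at_left 1. B * (1 - t) powr (real ?K - \<beta>) < \<epsilon>"
      using \<epsilon> by (intro order_tendstoD) auto
    then obtain \<rho> where \<rho>: "\<rho> < 1" "\<And>t. \<rho> < t \<Longrightarrow> t < 1 \<Longrightarrow> B * (1 - t) powr (real ?K - \<beta>) < \<epsilon>"
      unfolding eventually_at_left[OF zero_less_one] by blast
    show "\<exists>\<rho><1. \<forall>z\<in>unit_disk. \<rho> < norm z \<longrightarrow> norm ((deriv ^^ ?K) f z) * (1 - norm z) powr (real ?K - \<beta>) < \<epsilon>"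
    proof (intro exI[of _ \<rho>] conjI ballI impI \<rho>)
      fix z :: complex assume z: "z \<in> unit_disk" "\<rho> < norm z"
      have "norm ((deriv ^^ ?K) f z) * (1 - norm z) powr (real ?K - \<beta>) \<le> B * (1 - norm z) powr (real ?K - \<beta>)"
        using B[of z] z by (intro mult_right_mono) auto
      also have "\<dots> < \<epsilon>" using \<rho>(2)[of "norm z"] z by simp
      finally show "norm ((deriv ^^ ?K) f z) * (1 - norm z) powr (real ?K - \<beta>) < \<epsilon>" .
    qed
  qed
qed

text \<open>A gliding-hump argument: suitable terms of the sequence have long sums of bounded norm, whereas
  their images under \<open>Q\<close> would all be close to one non-zero limit.\<close>

lemma compact_null_sequence:
  assumes Q: "Lambda_compact \<beta> \<alpha> Q" and f: "\<And>k. f k \<in> Lambda_space \<beta>" "\<And>k. Lambda_le \<beta> M (f k)"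
    and lit: "\<And>k. little \<beta> (f k)" and null: "loc_null f" and \<eta>: "\<eta> > 0"
  shows "\<exists>k\<ge>m. Lambda_norm \<alpha> (Q (f k)) < ennreal \<eta>"
proof (rule ccontr)
  interpret X: Metric_space "Lambda_space \<alpha>" "Lambda_dist \<alpha>" by (rule Metric_space_Lambda)
  assume "\<not> ?thesis"
  then have big: "ennreal \<eta> \<le> Lambda_norm \<alpha> (Q (f k))" if "k \<ge> m" for k using that by (auto simp: not_less)
  let ?K = "Lambda_order \<beta>"
  let ?w = "\<lambda>z::complex. (1 - norm z) powr (real ?K - \<beta>)"
  have M: "0 \<le> M" using f(2) by (rule Lambda_le_nonneg)
  have Qim: "Q h \<in> Lambda_space \<alpha>" if "h \<in> Lambda_space \<beta>" for h
    using Q that by (auto simp: Lambda_compact_def Lambda_linear_def)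
  have Qadd: "Q (\<lambda>z. h1 z + h2 z) = (\<lambda>z. Q h1 z + Q h2 z)" if "h1 \<in> Lambda_space \<beta>" "h2 \<in> Lambda_space \<beta>" for h1 h2
    using Q that by (auto simp: Lambda_compact_def Lambda_linear_def)
  have Qcmult: "Q (\<lambda>z. c * h z) = (\<lambda>z. c * Q h z)" if "h \<in> Lambda_space \<beta>" for h c
    using Q that by (auto simp: Lambda_compact_def Lambda_linear_def)
  \<comment> \<open>The sums built below satisfy \<open>Lambda_le\<close> with bound M + 2; division
    by \<open>B\<close> puts them into the unit ball.\<close>
  define B where "B = (real ?K + 1) * (M + 2)"
  have B: "B > 0" using M by (simp add: B_def)
  have unit: "(\<lambda>z. of_real (1 / B) * h z) \<in> Lambda_unit_ball \<beta>" if "h \<in> Lambda_space \<beta>" "Lambda_le \<beta> (M + 2) h" for h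
  proof -
    have "Lambda_norm \<beta> (\<lambda>z. of_real (1 / B) * h z) = ennreal (1 / B) * Lambda_norm \<beta> h"
      using that(2) B by (subst Lambda_norm_cmult) (auto simp: Lambda_le_def norm_divide)
    also have "\<dots> \<le> ennreal (1 / B) * ennreal B"
      unfolding B_def by (intro mult_left_mono Lambda_norm_leI that) auto
    also have "\<dots> = 1" using B by (simp flip: ennreal_mult)
    finally show ?thesis using Lambda_space_cmult[OF that(1)] unfolding Lambda_unit_ball_def by blast
  qed
  let ?Z = "Lambda_topology \<alpha> closure_of (Q ` Lambda_unit_ball \<beta>)"
  have comp: "compactin X.mtopology ?Z"
    using Q by (simp add: Lambda_compact_def Lambda_topology_def)
  have sub: "Q ` Lambda_unit_ball \<beta> \<subseteq> ?Z"
    unfolding Lambda_topology_def by (rule closure_of_subset) (use Qim in \<open>auto simp: Lambda_unit_ball_def\<close>)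
  have "X.mbounded ?Z" using comp by (rule X.compactin_imp_mbounded)
  then obtain R where R: "\<And>x y. x \<in> ?Z \<Longrightarrow> y \<in> ?Z \<Longrightarrow> Lambda_dist \<alpha> x y \<le> R" by (auto simp: X.mbounded_alt)
  have bound: "rnorm \<alpha> (Q h) \<le> B * R" if h: "h \<in> Lambda_space \<beta>" "Lambda_le \<beta> (M + 2) h" for h
  proof -
    have "Q (\<lambda>z. 0) = (\<lambda>z. 0)" using Qcmult[OF Lambda_space_0, of 0] by simp
    moreover have "(\<lambda>z. 0) \<in> Lambda_unit_ball \<beta>" by (simp add: Lambda_unit_ball_def Lambda_space_0 Lambda_norm_0)
    ultimately have "(\<lambda>z. 0) \<in> ?Z" using sub by force
    moreover have "Q (\<lambda>z. of_real (1 / B) * h z) \<in> ?Z" using unit[OF h] sub by blast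
    ultimately have "Lambda_dist \<alpha> (Q (\<lambda>z. of_real (1 / B) * h z)) (\<lambda>z. 0) \<le> R" by (intro R)
    then have "rnorm \<alpha> (\<lambda>z. of_real (1 / B) * Q h z) \<le> R"
      by (simp only: Lambda_dist_def rnorm_def Qcmult[OF h(1)] diff_0_right)
    then have "1 / B * rnorm \<alpha> (Q h) \<le> R"
      using B by (subst (asm) rnorm_cmult[OF Qim[OF h(1)]]) (simp add: norm_divide)
    then show ?thesis using B by (simp add: field_simps)
  qed
  have f2: "Lambda_le \<beta> (M + 2) (f k)" for k
    using f(2)[of k] unfolding Lambda_le_def by (force intro: order.trans)
  define \<sigma> where "\<sigma> k = Q (\<lambda>z. of_real (1 / B) * f (m + k) z)" for k
  have "range \<sigma> \<subseteq> ?Z" using unit[OF f(1) f2] sub by (auto simp: \<sigma>_def)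
  then obtain l r where l: "l \<in> ?Z" "strict_mono r" "limitin X.mtopology (\<sigma> \<circ> r) l sequentially"
    using comp unfolding X.compactin_sequentially by blast
  \<comment> \<open>The limit of Q (f (m + r k)), with the normalisation by \<open>B\<close> undone.
    Its norm is at least 3/4 of \<eta>.\<close>
  define L where "L z = of_real B * l z" for z
  have lX: "l \<in> Lambda_space \<alpha>" using l(3) by (auto simp: X.limit_metric_sequentially)
  have LX: "L \<in> Lambda_space \<alpha>" unfolding L_def[abs_def] by (rule Lambda_space_cmult[OF lX])
  obtain n0 where n0: "\<And>k. k \<ge> n0 \<Longrightarrow> Lambda_dist \<alpha> ((\<sigma> \<circ> r) k) l < \<eta> / (4 * B)"
    using l(3)[unfolded X.limit_metric_sequentially, THEN conjunct2, rule_format, of "\<eta> / (4 * B)"] \<eta> B by auto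
  have near: "rnorm \<alpha> (\<lambda>z. Q (f (m + r k)) z + (-1) * L z) \<le> \<eta> / 4" if "k \<ge> n0" for k
  proof -
    have D: "(\<lambda>z. \<sigma> (r k) z - l z) \<in> Lambda_space \<alpha>"
      unfolding \<sigma>_def by (intro Lambda_space_diff Qim Lambda_space_cmult f lX)
    have "(\<lambda>z. Q (f (m + r k)) z + (-1) * L z) = (\<lambda>z. of_real B * (\<sigma> (r k) z - l z))"
      unfolding \<sigma>_def Qcmult[OF f(1)] L_def using B by (simp add: right_diff_distrib)
    then have "rnorm \<alpha> (\<lambda>z. Q (f (m + r k)) z + (-1) * L z) = B * rnorm \<alpha> (\<lambda>z. \<sigma> (r k) z - l z)"
      using rnorm_cmult[OF D, of "of_real B"] B by simp
    also have "\<dots> \<le> B * (\<eta> / (4 * B))"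
      using n0[OF that] B by (intro mult_left_mono) (auto simp: rnorm_def Lambda_dist_def)
    finally show ?thesis using B by simp
  qed
  have nL: "3 / 4 * \<eta> \<le> rnorm \<alpha> L"
  proof -
    let ?q = "Q (f (m + r n0))"
    have q: "?q \<in> Lambda_space \<alpha>" by (intro Qim f)
    have "ennreal \<eta> \<le> ennreal (rnorm \<alpha> ?q)" using big[of "m + r n0"] Lambda_norm_eq_rnorm[OF q] by simp
    then have "\<eta> \<le> rnorm \<alpha> ?q" using rnorm_nonneg by simp
    also have "?q = (\<lambda>z. (?q z + (-1) * L z) + L z)" by simp
    also have "rnorm \<alpha> \<dots> \<le> rnorm \<alpha> (\<lambda>z. ?q z + (-1) * L z) + rnorm \<alpha> L"
      by (intro rnorm_add Lambda_space_add Lambda_space_cmult q LX)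
    also have "\<dots> \<le> \<eta> / 4 + rnorm \<alpha> L" using near[of n0] by simp
    finally show ?thesis by simp
  qed
  \<comment> \<open>The bound is M + 1 + n \<epsilon> and not n M: beyond a radius \<rho> the old
    sum is below 1, since it is little, and only the new term may reach M; within \<rho> the new
    term is below \<epsilon>.\<close>
  have sums: "\<exists>S\<in>Lambda_space \<beta>. little \<beta> S \<and> (\<forall>z\<in>unit_disk. norm ((deriv ^^ ?K) S z) * ?w z \<le> M + 1 + real n * \<epsilon>) \<and>
      (\<forall>i<?K. norm ((deriv ^^ i) S 0) \<le> real n * \<epsilon>) \<and> rnorm \<alpha> (\<lambda>z. Q S z + (- of_nat n) * L z) \<le> real n * (\<eta> / 4)"
    if \<epsilon>: "\<epsilon> > 0" for n \<epsilon>
  proof (induction n)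
    case 0
    have "Q (\<lambda>z. 0) = (\<lambda>z. 0)" using Qcmult[OF Lambda_space_0, of 0] by simp
    then show ?case
      using M by (intro bexI[of _ "\<lambda>z. 0"] conjI) (auto simp: Lambda_space_0 little_0 rnorm_def Lambda_norm_0)
  next
    case (Suc n)
    then obtain S where S: "S \<in> Lambda_space \<beta>" "little \<beta> S"
      "\<And>z. z \<in> unit_disk \<Longrightarrow> norm ((deriv ^^ ?K) S z) * ?w z \<le> M + 1 + real n * \<epsilon>"
      "\<And>i. i < ?K \<Longrightarrow> norm ((deriv ^^ i) S 0) \<le> real n * \<epsilon>"
      "rnorm \<alpha> (\<lambda>z. Q S z + (- of_nat n) * L z) \<le> real n * (\<eta> / 4)"
      by blast
    have hS: "S holomorphic_on unit_disk" using S(1) by (simp add: Lambda_space_def)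
    have hf: "f k holomorphic_on unit_disk" for k using f(1)[of k] by (simp add: Lambda_space_def)
    obtain \<rho> where \<rho>: "\<rho> < 1" "\<And>z. z \<in> unit_disk \<Longrightarrow> \<rho> < norm z \<Longrightarrow> norm ((deriv ^^ ?K) S z) * ?w z < 1"
      using S(2)[unfolded little_def, rule_format, of 1] by auto
    have "\<forall>\<^sub>F k in sequentially. \<forall>z\<in>cball 0 \<rho>. norm ((deriv ^^ ?K) (f k) z) < \<epsilon>"
      by (intro loc_nullD[OF loc_null_higher_deriv[OF hf null]] \<rho> \<epsilon>)
    moreover have "\<forall>\<^sub>F k in sequentially. \<forall>i\<in>{..<?K}. \<forall>z\<in>cball 0 0. norm ((deriv ^^ i) (f k) z) < \<epsilon>"
      by (intro eventually_ball_finite ballI loc_nullD[OF loc_null_higher_deriv[OF hf null]] \<epsilon>) auto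
    ultimately have "\<forall>\<^sub>F k in sequentially. (\<forall>z\<in>cball 0 \<rho>. norm ((deriv ^^ ?K) (f k) z) < \<epsilon>) \<and>
        (\<forall>i\<in>{..<?K}. \<forall>z\<in>cball 0 0. norm ((deriv ^^ i) (f k) z) < \<epsilon>)"
      by (rule eventually_conj)
    then obtain n1 where n1': "\<forall>k\<ge>n1. (\<forall>z\<in>cball 0 \<rho>. norm ((deriv ^^ ?K) (f k) z) < \<epsilon>) \<and>
        (\<forall>i\<in>{..<?K}. \<forall>z\<in>cball 0 0. norm ((deriv ^^ i) (f k) z) < \<epsilon>)"
      unfolding eventually_sequentially by blast
    have n1: "norm ((deriv ^^ ?K) (f k) z) < \<epsilon>" if "k \<ge> n1" "z \<in> cball 0 \<rho>" for k z
      using n1' that by blast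
    have n1'': "norm ((deriv ^^ i) (f k) 0) < \<epsilon>" if "k \<ge> n1" "i < ?K" for k i
      using n1' that by simp
    define k where "k = max n0 n1"
    define p where "p = f (m + r k)"
    \<comment> \<open>A strictly increasing r satisfies r k \<ge> k.\<close>
    have rk: "m + r k \<ge> n1" using strict_mono_imp_increasing[OF l(2), of k] by (simp add: k_def)
    have p: "p \<in> Lambda_space \<beta>" "p holomorphic_on unit_disk" "little \<beta> p" unfolding p_def by (rule f hf lit)+
    have p1: "norm ((deriv ^^ ?K) p z) * ?w z \<le> M" if "z \<in> unit_disk" for z
      using f(2)[of "m + r k"] that by (simp add: Lambda_le_def p_def)
    show ?case
    proof (intro bexI[of _ "\<lambda>z. S z + p z"] conjI ballI allI impI)
      show "(\<lambda>z. S z + p z) \<in> Lambda_space \<beta>" by (intro Lambda_space_add S p)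
      show "little \<beta> (\<lambda>z. S z + p z)" by (intro little_add S p hS)
    next
      fix z :: complex assume z: "z \<in> unit_disk"
      have w1: "?w z \<le> 1" using z Lambda_order_gt[of \<beta>] by (intro powr_le1) auto
      have "norm ((deriv ^^ ?K) (\<lambda>z. S z + p z) z) * ?w z \<le> (norm ((deriv ^^ ?K) S z) + norm ((deriv ^^ ?K) p z)) * ?w z"
        using higher_deriv_add[OF hS p(2) open_ball z] by (intro mult_right_mono) (simp_all add: norm_triangle_ineq)
      also have "\<dots> = norm ((deriv ^^ ?K) S z) * ?w z + norm ((deriv ^^ ?K) p z) * ?w z" by (rule distrib_right)
      also have "\<dots> \<le> M + 1 + real (Suc n) * \<epsilon>"
      proof (cases "\<rho> < norm z")
        case True
        have "0 \<le> real (Suc n) * \<epsilon>" using \<epsilon> by (intro mult_nonneg_nonneg) auto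
        then show ?thesis using \<rho>(2)[OF z True] p1[OF z] by linarith
      next
        case False
        have "norm ((deriv ^^ ?K) p z) * ?w z \<le> \<epsilon> * 1"
          using n1[OF rk, of z] False w1 \<epsilon> by (intro mult_mono) (auto simp: p_def)
        then show ?thesis using S(3)[OF z] by (simp add: distrib_right)
      qed
      finally show "norm ((deriv ^^ ?K) (\<lambda>z. S z + p z) z) * ?w z \<le> M + 1 + real (Suc n) * \<epsilon>" .
    next
      fix i assume i: "i < ?K"
      have "norm ((deriv ^^ i) (\<lambda>z. S z + p z) 0) \<le> norm ((deriv ^^ i) S 0) + norm ((deriv ^^ i) p 0)"
        using higher_deriv_add[OF hS p(2) open_ball, of 0 i] by (simp add: norm_triangle_ineq)
      also have "\<dots> \<le> real n * \<epsilon> + \<epsilon>" using S(4)[OF i] n1''[OF rk i] by (simp add: p_def)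
      finally show "norm ((deriv ^^ i) (\<lambda>z. S z + p z) 0) \<le> real (Suc n) * \<epsilon>" by (simp add: distrib_right)
    next
      have "(\<lambda>z. Q (\<lambda>z. S z + p z) z + (- of_nat (Suc n)) * L z)
        = (\<lambda>z. (Q S z + (- of_nat n) * L z) + (Q p z + (-1) * L z))"
        by (simp add: Qadd[OF S(1) p(1)] algebra_simps)
      then have "rnorm \<alpha> (\<lambda>z. Q (\<lambda>z. S z + p z) z + (- of_nat (Suc n)) * L z)
        \<le> rnorm \<alpha> (\<lambda>z. Q S z + (- of_nat n) * L z) + rnorm \<alpha> (\<lambda>z. Q p z + (-1) * L z)"
        by (simp only:) (intro rnorm_add Lambda_space_add Lambda_space_cmult Qim LX S p)
      also have "\<dots> \<le> real n * (\<eta> / 4) + \<eta> / 4"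
        using S(5) near[of k] by (intro add_mono) (auto simp: p_def k_def)
      finally show "rnorm \<alpha> (\<lambda>z. Q (\<lambda>z. S z + p z) z + (- of_nat (Suc n)) * L z) \<le> real (Suc n) * (\<eta> / 4)"
        by (simp add: distrib_right)
    qed
  qed
  \<comment> \<open>Q S lies within n \<eta> / 4 of n L, whose norm is at least 3 n \<eta> / 4, so
    its norm is at least n \<eta> / 2, more than the bound B * R allows. The maximum with 1 in n'
    permits the choice \<epsilon> = 1 / n'.\<close>
  obtain n :: nat where n: "B * R < real n * (\<eta> / 2)"
    using reals_Archimedean3[of "\<eta> / 2"] \<eta> by auto
  define n' where "n' = max n 1"
  have n': "n' > 0" "B * R < real n' * (\<eta> / 2)"
  proof -
    have "real n * (\<eta> / 2) \<le> real n' * (\<eta> / 2)" using \<eta> by (intro mult_right_mono) (auto simp: n'_def)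
    then show "B * R < real n' * (\<eta> / 2)" using n by linarith
  qed (simp add: n'_def)
  obtain S where S: "S \<in> Lambda_space \<beta>"
      "\<And>z. z \<in> unit_disk \<Longrightarrow> norm ((deriv ^^ ?K) S z) * ?w z \<le> M + 1 + 1"
      "\<And>i. i < ?K \<Longrightarrow> norm ((deriv ^^ i) S 0) \<le> 1"
      "rnorm \<alpha> (\<lambda>z. Q S z + (- of_nat n') * L z) \<le> real n' * (\<eta> / 4)"
    using sums[of "1 / real n'" n'] n'(1) by auto
  have "Lambda_le \<beta> (M + 2) S"
    unfolding Lambda_le_def using S M by (force simp: Lambda_space_def intro: order.trans)
  then have QS: "rnorm \<alpha> (Q S) \<le> B * R" by (rule bound[OF S(1)])
  have "real n' * (3 / 4 * \<eta>) \<le> real n' * rnorm \<alpha> L" using nL by (intro mult_left_mono) auto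
  also have "\<dots> = rnorm \<alpha> (\<lambda>z. of_nat n' * L z)" by (simp add: rnorm_cmult[OF LX])
  also have "(\<lambda>z. of_nat n' * L z) = (\<lambda>z. Q S z + (-1) * (Q S z + (- of_nat n') * L z))"
    by (simp add: algebra_simps)
  also have "rnorm \<alpha> \<dots> \<le> rnorm \<alpha> (Q S) + rnorm \<alpha> (\<lambda>z. (-1) * (Q S z + (- of_nat n') * L z))"
    by (intro rnorm_add Lambda_space_cmult Lambda_space_add Qim S LX)
  also have "rnorm \<alpha> (\<lambda>z. (-1) * (Q S z + (- of_nat n') * L z)) = rnorm \<alpha> (\<lambda>z. Q S z + (- of_nat n') * L z)"
    by (subst rnorm_cmult) (intro Lambda_space_cmult Lambda_space_add Qim S LX, simp)
  also have "rnorm \<alpha> (Q S) + \<dots> \<le> B * R + real n' * (\<eta> / 4)"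
    using QS S(4) by (rule add_mono)
  finally show False using n'(2) by (simp add: algebra_simps)
qed

section \<open>Test functions\<close>

text \<open>The bound 1/2 keeps w away from 0, and only the limit |w| \<rightarrow> 1 matters.
  Derivatives at w are required to vanish in the limit below order j only; the orders above j are
  treated in \<open>G_limsup_le_step\<close>.\<close>

definition test_family :: "real \<Rightarrow> nat \<Rightarrow> real \<Rightarrow> real \<Rightarrow> (complex \<Rightarrow> complex \<Rightarrow> complex) \<Rightarrow> bool" where
  "test_family \<beta> j c M F \<longleftrightarrow> c > 0 \<and>
     (\<forall>w\<in>unit_disk. 1 / 2 \<le> norm w \<longrightarrow> Lambda_le \<beta> M (F w) \<and> little \<beta> (F w) \<and>
        c * Omega j \<beta> (norm w) \<le> norm ((deriv ^^ j) (F w) w)) \<and>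
     (\<forall>w. (\<forall>k. w k \<in> unit_disk \<and> 1 / 2 \<le> norm (w k)) \<longrightarrow> (\<lambda>k. norm (w k)) \<longlonglongrightarrow> 1 \<longrightarrow>
        loc_null (\<lambda>k. F (w k)) \<and> (\<forall>i<j. (\<lambda>k. (deriv ^^ i) (F (w k)) (w k)) \<longlonglongrightarrow> 0))"

lemma norm_1_minus_cnj_mult_ge:
  assumes "norm w \<le> 1" "norm z \<le> 1"
  shows "1 - norm z \<le> norm (1 - cnj w * z)" "1 - norm w \<le> norm (1 - cnj w * z)"
proof -
  have "norm w * norm z \<le> 1 * norm z" using assms by (intro mult_right_mono) auto
  moreover have "norm w * norm z \<le> norm w * 1" using assms by (intro mult_left_mono) auto
  ultimately show "1 - norm z \<le> norm (1 - cnj w * z)" "1 - norm w \<le> norm (1 - cnj w * z)"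
    using norm_triangle_ineq2[of 1 "cnj w * z"] by (auto simp: norm_mult)
qed

text \<open>In the power case the test function is
  \<open>(1 - |w|\<^sup>2)\<^bsup>s + \<beta>\<^esup> cnj w\<^sup>j (z - w)\<^sup>j / (1 - cnj w z)\<^bsup>s + j\<^esup>\<close> with \<open>s > - \<beta>\<close>; the zero of order \<open>j\<close> at \<open>w\<close>
  isolates the \<open>j\<close>-th derivative from the lower ones.\<close>

lemma power_weight_test_family:
  assumes j: "\<beta> < real j"
  shows "\<exists>c M F. test_family \<beta> j c M F"
proof -
  \<comment> \<open>s + \<beta> > 0 makes the factor \<open>A w\<close> tend to 0, and a natural
    number s avoids branches of the power.\<close>
  obtain s :: nat where s: "- \<beta> < real s" using reals_Archimedean2 by blast
  define A where "A w = (1 - norm w ^ 2) powr (real s + \<beta>)" for w :: complex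
  define q where "q w z = inverse ((1 - cnj w * z) ^ (s + j))" for w z :: complex
  define p where "p w z = of_real (A w) * cnj w ^ j * q w z" for w z :: complex
  define F where "F w z = (z - w) ^ j * p w z" for w z :: complex
  let ?K = "Lambda_order \<beta>"
  let ?S = "\<lambda>w. {z. 1 - cnj w * z \<noteq> 0}"
  \<comment> \<open>Constants from Cauchy's inequality on the circle of radius D / 2 around z, where
    D = |1 - cnj w z|: there |\<zeta> - w| \<le> 4 D and |1 - cnj w \<zeta>| \<ge> D / 2. The radius
    contributes the 2^n in \<open>C n\<close>.\<close>
  define b where "b = 4 ^ j * (2::real) ^ (s + j)"
  define C where "C n = fact n * b * 2 ^ n" for n
  have b: "b > 0" by (simp add: b_def)
  have C: "C n > 0" for n using b by (simp add: C_def)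
  have S: "open (?S w)" for w by (intro open_Collect_neq continuous_intros)
  have qh: "q w holomorphic_on ?S w" for w
    unfolding q_def[abs_def] by (intro holomorphic_intros) auto
  have ph: "p w holomorphic_on ?S w" for w
    unfolding p_def[abs_def] by (intro holomorphic_intros qh)
  have Fh: "F w holomorphic_on ?S w" for w
    unfolding F_def[abs_def] by (intro holomorphic_intros ph)
  have nz: "1 - cnj w * z \<noteq> 0" if "norm w < 1" "norm z \<le> 1" for w z :: complex
    using norm_1_minus_cnj_mult_ge(2)[of w z] that by auto
  have growth: "norm ((deriv ^^ n) (F w) z) \<le> C n * A w / norm (1 - cnj w * z) ^ (s + n)"
    if w: "norm w < 1" and z: "norm z \<le> 1" for w z n
  proof -
    define D where "D = norm (1 - cnj w * z)"
    have D: "D > 0" using nz[OF w z] by (simp add: D_def)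
    have zeta: "D / 2 \<le> norm (1 - cnj w * \<zeta>)" "norm (\<zeta> - w) \<le> 4 * D" if "norm (z - \<zeta>) \<le> D / 2" for \<zeta>
    proof -
      have "1 - cnj w * z = (1 - cnj w * \<zeta>) + cnj w * (\<zeta> - z)" by (simp add: algebra_simps)
      then have "D \<le> norm (1 - cnj w * \<zeta>) + norm w * norm (z - \<zeta>)"
        unfolding D_def by (metis norm_triangle_ineq norm_mult complex_mod_cnj norm_minus_commute)
      also have "norm w * norm (z - \<zeta>) \<le> 1 * (D / 2)" using that w by (intro mult_mono) auto
      finally show "D / 2 \<le> norm (1 - cnj w * \<zeta>)" by simp
      have "1 - norm w ^ 2 = (1 - norm w) * (1 + norm w)" by (simp add: power2_eq_square algebra_simps)
      also have "\<dots> \<le> D * 2"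
        using norm_1_minus_cnj_mult_ge(2)[of w z] w z by (intro mult_mono) (auto simp: D_def)
      finally have w2: "1 - norm w ^ 2 \<le> 2 * D" by simp
      have "z - w = z * of_real (1 - norm w ^ 2) - w * (1 - cnj w * z)"
        by (simp add: algebra_simps complex_norm_square[symmetric])
      then have "norm (z - w) \<le> norm (z * of_real (1 - norm w ^ 2)) + norm (w * (1 - cnj w * z))"
        by (metis norm_triangle_ineq4)
      also have "\<dots> = norm z * (1 - norm w ^ 2) + norm w * D"
        using w power_le_one[of "norm w" 2] unfolding norm_mult norm_of_real D_def by simp
      also have "\<dots> \<le> 1 * (2 * D) + 1 * D"
        using w z w2 D power_le_one[of "norm w" 2] by (intro add_mono mult_mono) auto
      finally have "norm (z - w) \<le> 3 * D" by simp
      moreover have "norm (\<zeta> - w) \<le> norm (z - w) + norm (z - \<zeta>)"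
        using norm_triangle_ineq4[of "z - w" "z - \<zeta>"] by simp
      ultimately show "norm (\<zeta> - w) \<le> 4 * D" using that D by linarith
    qed
    have cb: "cball z (D / 2) \<subseteq> ?S w"
      using zeta(1) D by (force simp: dist_norm)
    have "norm ((deriv ^^ n) (F w) z) \<le> fact n * (b * A w / D ^ s) / (D / 2) ^ n"
    proof (rule Cauchy_inequality)
      show "F w holomorphic_on ball z (D / 2)"
        using Fh cb by (meson holomorphic_on_subset ball_subset_cball order.trans)
      show "continuous_on (cball z (D / 2)) (F w)"
        using Fh cb by (meson holomorphic_on_subset holomorphic_on_imp_continuous_on)
      fix \<zeta> assume \<zeta>: "norm (z - \<zeta>) = D / 2"
      have "norm (F w \<zeta>) = norm (\<zeta> - w) ^ j * (A w * norm w ^ j / norm (1 - cnj w * \<zeta>) ^ (s + j))"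
        by (simp add: F_def p_def q_def norm_mult norm_power norm_inverse A_def divide_inverse)
      also have "\<dots> \<le> (4 * D) ^ j * (A w * 1 / (D / 2) ^ (s + j))"
        using zeta[of \<zeta>] \<zeta> D w by (intro mult_mono power_mono frac_le power_le_one) (auto simp: A_def)
      also have "\<dots> = b * A w / D ^ s"
        using D by (simp add: b_def power_mult_distrib power_divide power_add field_simps)
      finally show "norm (F w \<zeta>) \<le> b * A w / D ^ s" .
    qed (use D in auto)
    also have "\<dots> = C n * A w / D ^ (s + n)"
      using D by (simp add: C_def power_divide power_add field_simps)
    finally show ?thesis unfolding D_def .
  qed
  have A_le: "A w \<le> 2 powr (real s + \<beta>) * norm (1 - cnj w * z) powr (real s + \<beta>)"
    if "norm w < 1" "norm z \<le> 1" for w z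
  proof -
    have "1 - norm w ^ 2 = (1 - norm w) * (1 + norm w)" by (simp add: power2_eq_square algebra_simps)
    also have "\<dots> \<le> norm (1 - cnj w * z) * 2"
      using norm_1_minus_cnj_mult_ge(2)[of w z] that by (intro mult_mono) auto
    finally have "A w \<le> (2 * norm (1 - cnj w * z)) powr (real s + \<beta>)"
      unfolding A_def using s that power_le_one[of "norm w" 2] by (intro powr_mono2) auto
    then show ?thesis by (simp add: powr_mult)
  qed
  \<comment> \<open>The 1 is for the derivatives at 0, where \<open>A w\<close> is at most 1; the
    power of 2 comes from \<open>A_le\<close> and is for the top order.\<close>
  define M where "M = (\<Sum>n\<le>?K. C n) * (1 + 2 powr (real s + \<beta>))"
  have C_sum: "C n \<le> (\<Sum>n\<le>?K. C n)" if "n \<le> ?K" for n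
    using that C by (intro member_le_sum) (auto intro: less_imp_le)
  have sum0: "0 \<le> (\<Sum>n\<le>?K. C n)" using C by (intro sum_nonneg) (auto intro: less_imp_le)
  have le: "Lambda_le \<beta> M (F w)" if w: "norm w < 1" for w
    unfolding Lambda_le_def
  proof (intro conjI allI impI ballI)
    show "F w holomorphic_on unit_disk"
      by (rule holomorphic_on_subset[OF Fh]) (use nz[OF w] in auto)
    fix i assume i: "i < ?K"
    have "A w \<le> 1" unfolding A_def using s w power_le_one[of "norm w" 2] by (intro powr_le1) auto
    then have "C i * A w \<le> C i * 1" using C[of i] by (intro mult_left_mono) auto
    moreover have "norm ((deriv ^^ i) (F w) 0) \<le> C i * A w" using growth[OF w, of 0 i] by simp
    moreover have "C i * 1 \<le> M"
      unfolding M_def using C_sum[of i] i sum0 by (intro mult_mono) auto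
    ultimately show "norm ((deriv ^^ i) (F w) 0) \<le> M" by linarith
  next
    fix z :: complex assume z: "z \<in> unit_disk"
    define D where "D = norm (1 - cnj w * z)"
    have D: "D > 0" using nz[OF w, of z] z by (simp add: D_def)
    have "norm ((deriv ^^ ?K) (F w) z) * (1 - norm z) powr (real ?K - \<beta>)
      \<le> (C ?K * A w / D ^ (s + ?K)) * D powr (real ?K - \<beta>)"
      using growth[OF w, of z ?K] norm_1_minus_cnj_mult_ge(1)[of w z] z w Lambda_order_gt[of \<beta>] C[of ?K] D
      by (intro mult_mono powr_mono2) (auto simp: D_def A_def)
    also have "\<dots> \<le> (C ?K * (2 powr (real s + \<beta>) * D powr (real s + \<beta>)) / D ^ (s + ?K)) * D powr (real ?K - \<beta>)"
      using A_le[OF w, of z] C[of ?K] D z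
      by (intro mult_right_mono divide_right_mono mult_left_mono) (auto simp: D_def)
    also have "\<dots> = C ?K * 2 powr (real s + \<beta>) * (D powr (real s + \<beta>) * D powr (real ?K - \<beta>) / D powr real (s + ?K))"
      unfolding powr_realpow[OF D] by simp
    also have "\<dots> = C ?K * 2 powr (real s + \<beta>)"
      using D by (simp flip: powr_add powr_diff)
    also have "\<dots> \<le> M"
      unfolding M_def using C_sum[of ?K] sum0 C[of ?K] by (intro mult_mono) auto
    finally show "norm ((deriv ^^ ?K) (F w) z) * (1 - norm z) powr (real ?K - \<beta>) \<le> M" .
  qed
  have deriv_w: "(deriv ^^ i) (F w) w = (if i = j then fact j * p w w else 0)" if "i \<le> j" "norm w < 1" for i w
  proof -
    have pow: "(deriv ^^ l) (\<lambda>z. (z - w) ^ j) w = (if l = j then fact j else 0)" for l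
      unfolding higher_deriv_power by (auto simp: pochhammer_fact pochhammer_eq_0_iff not_le power_0_left)
    have "(deriv ^^ i) (F w) w = (\<Sum>l = 0..i. of_nat (i choose l) * (deriv ^^ l) (\<lambda>z. (z - w) ^ j) w * (deriv ^^ (i - l)) (p w) w)"
      unfolding F_def[abs_def]
      by (rule higher_deriv_mult[OF _ ph S]) (use nz[of w w] that in \<open>auto intro!: holomorphic_intros\<close>)
    also have "\<dots> = (\<Sum>l = 0..i. if l = j then of_nat (i choose l) * fact j * (deriv ^^ (i - l)) (p w) w else 0)"
      unfolding pow by (intro sum.cong) auto
    also have "\<dots> = (if i = j then fact j * p w w else 0)"
      using that by (auto simp: sum.delta)
    finally show ?thesis .
  qed
  \<comment> \<open>The first factor is from |w| \<ge> 1/2, the second from 1 - |w|^2 \<le> 2 (1 -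
    |w|) raised to the negative exponent \<beta> - j.\<close>
  have "test_family \<beta> j ((1 / 2) ^ j * 2 powr (\<beta> - real j)) M F"
    unfolding test_family_def
  proof (intro conjI ballI impI allI)
    fix w :: complex assume w: "w \<in> unit_disk" and w2: "1 / 2 \<le> norm w"
    have w1: "norm w < 1" using w by simp
    show "Lambda_le \<beta> M (F w)" by (rule le[OF w1])
    show "little \<beta> (F w)" by (rule little_entire[OF Fh S]) (use nz[OF w1] in auto)
    have pos: "1 - norm w ^ 2 > 0" using w1 by (simp add: power_less_one_iff)
    have cw: "1 - cnj w * w = of_real (1 - norm w ^ 2)"
      by (simp add: complex_norm_square[symmetric] mult.commute)
    have "norm ((deriv ^^ j) (F w) w) = fact j * (A w * norm w ^ j / (1 - norm w ^ 2) ^ (s + j))"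
      using deriv_w[of j w] w1 pos
      by (simp add: p_def q_def cw norm_mult norm_power norm_inverse A_def divide_inverse del: of_real_diff of_real_power)
    also have "A w / (1 - norm w ^ 2) ^ (s + j) = (1 - norm w ^ 2) powr (\<beta> - real j)"
      using pos by (simp add: A_def powr_realpow[symmetric] flip: powr_diff)
    then have "A w * norm w ^ j / (1 - norm w ^ 2) ^ (s + j) = norm w ^ j * (1 - norm w ^ 2) powr (\<beta> - real j)"
      by (metis mult.commute times_divide_eq_right)
    finally have eq: "norm ((deriv ^^ j) (F w) w) = fact j * (norm w ^ j * (1 - norm w ^ 2) powr (\<beta> - real j))" .
    have "1 - norm w ^ 2 = (1 - norm w) * (1 + norm w)" by (simp add: power2_eq_square algebra_simps)
    also have "\<dots> \<le> (1 - norm w) * 2" using w1 by (intro mult_left_mono) auto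
    finally have "((1 - norm w) * 2) powr (\<beta> - real j) \<le> (1 - norm w ^ 2) powr (\<beta> - real j)"
      using pos j by (intro powr_mono2') auto
    moreover have "((1 - norm w) * 2) powr (\<beta> - real j) = (1 - norm w) powr (\<beta> - real j) * 2 powr (\<beta> - real j)"
      by (rule powr_mult)
    ultimately have "(1 / 2) ^ j * ((1 - norm w) powr (\<beta> - real j) * 2 powr (\<beta> - real j)) \<le> norm w ^ j * (1 - norm w ^ 2) powr (\<beta> - real j)"
      using w1 w2 by (intro mult_mono power_mono) auto
    also have "\<dots> \<le> norm ((deriv ^^ j) (F w) w)"
      unfolding eq by (rule mult_right_mono[of 1 "fact j", simplified]) auto
    finally show "(1 / 2) ^ j * 2 powr (\<beta> - real j) * Omega j \<beta> (norm w) \<le> norm ((deriv ^^ j) (F w) w)"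
      using j by (simp add: Omega_alt mult_ac)
  next
    fix w :: "nat \<Rightarrow> complex"
    assume w: "\<forall>k. w k \<in> unit_disk \<and> 1 / 2 \<le> norm (w k)" and lim: "(\<lambda>k. norm (w k)) \<longlonglongrightarrow> 1"
    have w1: "norm (w k) < 1" for k using w by simp
    have "(\<lambda>k. 1 - norm (w k) ^ 2) \<longlonglongrightarrow> 1 - 1 ^ 2" by (intro tendsto_intros lim)
    then have A0: "(\<lambda>k. A (w k)) \<longlonglongrightarrow> 0"
      unfolding A_def using s
      by (intro tendsto_zero_powrI[where b = "real s + \<beta>"] tendsto_const) (auto simp: power_le_one w1 less_imp_le)
    show "loc_null (\<lambda>k. F (w k))"
      unfolding loc_null_def
    proof (intro allI impI)
      fix \<rho> \<epsilon> :: real assume \<rho>: "\<rho> < 1" and \<epsilon>: "\<epsilon> > 0"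
      have "(\<lambda>k. C 0 * A (w k) / (1 - \<rho>) ^ s) \<longlonglongrightarrow> C 0 * 0 / (1 - \<rho>) ^ s"
        using \<rho> by (intro tendsto_intros A0) auto
      then have "\<forall>\<^sub>F k in sequentially. C 0 * A (w k) / (1 - \<rho>) ^ s < \<epsilon>" using \<epsilon> by (intro order_tendstoD) auto
      then show "\<forall>\<^sub>F k in sequentially. \<forall>z\<in>cball 0 \<rho>. norm (F (w k) z) < \<epsilon>"
      proof eventually_elim
        case (elim k)
        show ?case
        proof
          fix z :: complex assume z: "z \<in> cball 0 \<rho>"
          have "norm (F (w k) z) \<le> C 0 * A (w k) / norm (1 - cnj (w k) * z) ^ s"
            using growth[OF w1, of z 0 k] z \<rho> by simp
          also have "\<dots> \<le> C 0 * A (w k) / (1 - \<rho>) ^ s"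
            using norm_1_minus_cnj_mult_ge(1)[of "w k" z] z \<rho> w1[of k] C[of 0]
            by (intro divide_left_mono power_mono mult_pos_pos zero_less_power mult_nonneg_nonneg) (auto simp: A_def nz)
          also have "\<dots> < \<epsilon>" by (rule elim)
          finally show "norm (F (w k) z) < \<epsilon>" .
        qed
      qed
    qed
    fix i assume "i < j"
    then show "(\<lambda>k. (deriv ^^ i) (F (w k)) (w k)) \<longlonglongrightarrow> 0"
      using deriv_w[of i "w _"] w1 by simp
  qed simp
  then show ?thesis by blast
qed

text \<open>Used to prescribe the j-th derivative of the logarithmic test functions. The zero
  initial values let local nullity pass from that derivative to the function.\<close>

lemma iterated_primitive:
  fixes S :: "complex set"
  assumes S: "open S" "convex S" and f: "f holomorphic_on S" and 0: "0 \<in> S"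
  shows "\<exists>F. F holomorphic_on S \<and> (\<forall>z\<in>S. (deriv ^^ n) F z = f z) \<and> (\<forall>i<n. (deriv ^^ i) F 0 = 0)"
  using f
proof (induction n arbitrary: f)
  case 0
  then show ?case by (intro exI[of _ f]) auto
next
  case (Suc n)
  obtain g where g: "\<And>z. z \<in> S \<Longrightarrow> (g has_field_derivative f z) (at z within S)"
    using holomorphic_convex_primitive'[OF S(2,1) Suc.prems] by blast
  define h where "h z = g z - g 0" for z
  have h: "(h has_field_derivative f z) (at z)" if "z \<in> S" for z
  proof -
    have "(g has_field_derivative f z) (at z)" using g[OF that] unfolding at_within_open[OF that S(1)] .
    from DERIV_diff[OF this DERIV_const[of "g 0"]] show ?thesis unfolding h_def by simp
  qed
  then have "h holomorphic_on S" using S(1) by (auto simp: holomorphic_on_open)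
  from Suc.IH[OF this] obtain F where F: "F holomorphic_on S" "\<And>z. z \<in> S \<Longrightarrow> (deriv ^^ n) F z = h z"
    "\<And>i. i < n \<Longrightarrow> (deriv ^^ i) F 0 = 0" by blast
  have "(deriv ^^ Suc n) F z = f z" if z: "z \<in> S" for z
  proof -
    have "((deriv ^^ n) F has_field_derivative f z) (at z)"
      by (rule has_field_derivative_transform_within_open[OF h S(1)]) (use z F in auto)
    then show ?thesis by (simp add: DERIV_imp_deriv)
  qed
  moreover have "(deriv ^^ n) F 0 = 0" using F(2)[OF 0] by (simp add: h_def)
  ultimately show ?case
    using F by (intro exI[of _ F]) (auto simp: less_Suc_eq)
qed

text \<open>Each integration starts from the value 0 at the origin and has length below 1, so the
  bound never grows.\<close>

lemma norm_le_iterated_deriv: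
  assumes F: "F holomorphic_on unit_disk" and \<rho>: "0 \<le> \<rho>" "\<rho> < 1" and low: "\<And>i. i < n \<Longrightarrow> (deriv ^^ i) F 0 = 0"
    and bnd: "\<And>z. z \<in> cball 0 \<rho> \<Longrightarrow> norm ((deriv ^^ n) F z) \<le> e" and z: "z \<in> cball 0 \<rho>"
  shows "norm (F z) \<le> e"
proof -
  have "\<forall>z\<in>cball 0 \<rho>. norm ((deriv ^^ m) F z) \<le> e" if "m \<le> n" for m
    using that
  proof (induction m rule: inc_induct)
    case base
    then show ?case using bnd by blast
  next
    case (step m)
    show ?case
    proof
      fix z :: complex assume z: "z \<in> cball 0 \<rho>"
      have "norm ((deriv ^^ Suc m) F 0) \<le> e" using step.IH \<rho> by (simp del: funpow.simps)
      then have e: "0 \<le> e" by (rule order.trans[OF norm_ge_zero])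
      have "norm ((deriv ^^ m) F z - (deriv ^^ m) F 0) \<le> e * norm (z - 0)"
      proof (rule field_differentiable_bound[OF convex_cball _ _ z])
        fix w :: complex assume w: "w \<in> cball 0 \<rho>"
        have "((deriv ^^ m) F has_field_derivative (deriv ^^ Suc m) F w) (at w)"
          using F w \<rho> by (intro has_field_derivative_higher_deriv[of _ unit_disk]) auto
        then show "((deriv ^^ m) F has_field_derivative (deriv ^^ Suc m) F w) (at w within cball 0 \<rho>)"
          by (rule has_field_derivative_at_within)
        show "norm ((deriv ^^ Suc m) F w) \<le> e" using step.IH w by blast
      qed (use \<rho> in auto)
      also have "\<dots> \<le> e * 1" using z \<rho> e by (intro mult_left_mono) auto
      finally show "norm ((deriv ^^ m) F z) \<le> e" using low[of m] step.hyps by simp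
    qed
  qed
  from this[of 0] z show ?thesis by simp
qed

lemma norm_Ln_le:
  assumes "0 < r" "r \<le> norm u" "norm u \<le> 2" "r \<le> 1"
  shows "norm (Ln u) \<le> 1 - ln r + pi"
proof -
  have u: "u \<noteq> 0" using assms by auto
  have "\<bar>ln (norm u)\<bar> \<le> 1 - ln r"
  proof -
    have "ln r \<le> ln (norm u)" using assms by (intro ln_mono) auto
    moreover have "ln (norm u) \<le> norm u - 1" using u by (intro ln_le_minus_one) auto
    moreover have "ln r \<le> 0" using assms by simp
    ultimately show ?thesis using assms(3) by linarith
  qed
  moreover have "\<bar>Im (Ln u)\<bar> \<le> pi" using mpi_less_Im_Ln[OF u] Im_Ln_le_pi[OF u] by linarith
  moreover have "norm (Ln u) \<le> \<bar>Re (Ln u)\<bar> + \<bar>Im (Ln u)\<bar>" by (rule cmod_le)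
  ultimately show ?thesis using u by simp
qed

text \<open>The \<open>j\<close>-th derivative of the test function is the square of a logarithm divided by its size at \<open>w\<close>.
  The square keeps the next derivative, and hence the norm, bounded, while the division makes the functions
  locally null as \<open>w\<close> tends to the circle.\<close>

lemma log_weight_test_family:
  assumes j: "\<beta> = real j"
  shows "\<exists>c M F. test_family \<beta> j c M F"
proof -
  define L where "L w z = 1 - Ln (1 - cnj w * z)" for w z :: complex
  define W where "W w = 1 - ln (1 - norm w)" for w :: complex
  \<comment> \<open>This disk contains the closed unit disk when 0 < |w| < 1, and 1 - cnj w z has
    positive real part on it, so the principal branch is holomorphic. For w = 0 it would be empty
    because 1 / 0 = 0.\<close>
  let ?S = "\<lambda>w::complex. ball 0 (1 / norm w) :: complex set"
  have K: "Lambda_order \<beta> = Suc j"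
    using less_Lambda_order_iff[of j \<beta>] Lambda_order_le[of \<beta> "Suc j"] j by simp
  have W: "Omega j \<beta> (norm w) = W w" if "norm w < 1" for w using j that ln_weight[of "norm w"] by (simp add: Omega_alt W_def)
  have W1: "1 \<le> W w" if "norm w < 1" for w using that by (simp add: W_def)
  have Re: "0 < Re (1 - cnj w * z)" if "w \<noteq> 0" "z \<in> ?S w" for w z
  proof -
    have "norm (cnj w * z) < 1" using that by (simp add: norm_mult field_simps)
    moreover have "Re (cnj w * z) \<le> norm (cnj w * z)" by (rule complex_Re_le_cmod)
    ultimately show ?thesis by simp
  qed
  have Lh: "L w holomorphic_on ?S w" if "w \<noteq> 0" for w
    unfolding L_def[abs_def] by (intro holomorphic_intros) (use Re[OF that] in \<open>force simp: complex_nonpos_Reals_iff\<close>)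
  have "\<exists>F. F holomorphic_on ?S w \<and> (\<forall>z\<in>?S w. (deriv ^^ j) F z = L w z ^ 2 / of_real (W w)) \<and> (\<forall>i<j. (deriv ^^ i) F 0 = 0)"
    if "w \<in> unit_disk - {0}" for w
    using that W1[of w] by (intro iterated_primitive holomorphic_intros Lh) auto
  then obtain F where F: "\<And>w. w \<in> unit_disk - {0} \<Longrightarrow> F w holomorphic_on ?S w"
    "\<And>w z. w \<in> unit_disk - {0} \<Longrightarrow> z \<in> ?S w \<Longrightarrow> (deriv ^^ j) (F w) z = L w z ^ 2 / of_real (W w)"
    "\<And>w i. w \<in> unit_disk - {0} \<Longrightarrow> i < j \<Longrightarrow> (deriv ^^ i) (F w) 0 = 0"
    by metis
  have sub: "cball 0 1 \<subseteq> ?S w" if "w \<in> unit_disk - {0}" for w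
  proof -
    have "1 < 1 / norm w" using that by simp
    then show ?thesis by auto
  qed
  have Fd: "F w holomorphic_on unit_disk" if "w \<in> unit_disk - {0}" for w
    using F(1)[OF that] sub[OF that] by (meson holomorphic_on_subset ball_subset_cball order.trans)
  have L_le: "norm (L w z) \<le> 2 - ln r + pi" if "norm w < 1" "norm z \<le> 1" "0 < r" "r \<le> norm (1 - cnj w * z)" "r \<le> 1" for w z r
  proof -
    have "norm (cnj w * z) \<le> 1 * 1" unfolding norm_mult using that by (intro mult_mono) auto
    then have "norm (1 - cnj w * z) \<le> 2" using norm_triangle_ineq4[of 1 "cnj w * z"] by simp
    then have "norm (Ln (1 - cnj w * z)) \<le> 1 - ln r + pi" using that by (intro norm_Ln_le) auto
    then show ?thesis unfolding L_def using norm_triangle_ineq4[of 1 "Ln (1 - cnj w * z)"] by simp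
  qed
  \<comment> \<open>The bound is W w + 1 + pi, and pi < 4 and W w \<ge> 1 absorb the rest into 6 * W
    w.\<close>
  have LW: "norm (L w z) \<le> 6 * W w" if "norm w < 1" "norm z \<le> 1" for w z
  proof -
    have "norm (L w z) \<le> 2 - ln (1 - norm w) + pi"
      using norm_1_minus_cnj_mult_ge(2)[of w z] that by (intro L_le) auto
    then show ?thesis using W1[OF that(1)] pi_less_4 by (simp add: W_def)
  qed
  \<comment> \<open>12 = 2 * 6: the derivative of the square is 2 L L' / W, where |L| \<le> 6 W
    cancels the division and |L'| \<le> 1 / (1 - |z|).\<close>
  have le: "Lambda_le \<beta> 12 (F w)" if w: "w \<in> unit_disk - {0}" for w
    unfolding Lambda_le_def K
  proof (intro conjI allI impI ballI)
    have w1: "norm w < 1" using w by simp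
    show "F w holomorphic_on unit_disk" by (rule Fd[OF w])
    show "norm ((deriv ^^ i) (F w) 0) \<le> 12" if "i < Suc j" for i
    proof (cases "i = j")
      case True
      have "(deriv ^^ j) (F w) 0 = 1 / of_real (W w)" using F(2)[OF w, of 0] w by (simp add: L_def)
      then have "norm ((deriv ^^ j) (F w) 0) = 1 / W w" using W1[OF w1] by (simp add: norm_divide)
      also have "\<dots> \<le> 1" using W1[OF w1] by simp
      finally show ?thesis using True by simp
    qed (use that F(3)[OF w, of i] in auto)
    fix z :: complex assume z: "z \<in> unit_disk"
    have zS: "z \<in> ?S w" by (rule subsetD[OF sub[OF w]]) (use z in auto)
    have u: "1 - cnj w * z \<noteq> 0" using Re[of w z] w zS by force
    have nonpos: "1 - cnj w * z \<notin> \<real>\<^sub>\<le>\<^sub>0" using Re[of w z] w zS by (force simp: complex_nonpos_Reals_iff)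
    have "((\<lambda>z. L w z ^ 2 / of_real (W w)) has_field_derivative
        (2 * L w z * (cnj w / (1 - cnj w * z)) / of_real (W w))) (at z)"
      unfolding L_def using nonpos u W1[OF w1] by (auto intro!: derivative_eq_intros simp: field_simps)
    then have "((deriv ^^ j) (F w) has_field_derivative (2 * L w z * (cnj w / (1 - cnj w * z)) / of_real (W w))) (at z)"
      by (rule has_field_derivative_transform_within_open[OF _ open_ball zS]) (use F(2)[OF w] in auto)
    then have "(deriv ^^ Suc j) (F w) z = 2 * L w z * (cnj w / (1 - cnj w * z)) / of_real (W w)"
      by (simp add: DERIV_imp_deriv)
    then have "norm ((deriv ^^ Suc j) (F w) z) = 2 * norm (L w z) * (norm w / norm (1 - cnj w * z)) / W w"
      using W1[OF w1] by (simp add: norm_mult norm_divide)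
    also have "\<dots> \<le> 2 * (6 * W w) * (1 / (1 - norm z)) / W w"
      using W1[OF w1] LW[OF w1, of z] z w1 norm_1_minus_cnj_mult_ge(1)[of w z]
      by (intro divide_right_mono mult_mono frac_le) auto
    also have "\<dots> = 12 / (1 - norm z)" using W1[OF w1] by simp
    finally show "norm ((deriv ^^ Suc j) (F w) z) * (1 - norm z) powr (real (Suc j) - \<beta>) \<le> 12"
      using j z by (simp add: field_simps)
  qed
  \<comment> \<open>Since 1 + |w| \<le> 2, the logarithm at w is at least W w - ln 2, hence at least
    (1 - ln 2) * W w; it enters squared.\<close>
  have "test_family \<beta> j ((1 - ln 2) ^ 2) 12 F"
    unfolding test_family_def
  proof (intro conjI ballI impI allI)
    show "0 < (1 - ln 2 :: real) ^ 2" using ln2_le_25_over_36 by simp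
    fix w :: complex assume "w \<in> unit_disk" and "1 / 2 \<le> norm w"
    then have w: "w \<in> unit_disk - {0}" and w1: "norm w < 1" by auto
    show "Lambda_le \<beta> 12 (F w)" by (rule le[OF w])
    show "little \<beta> (F w)" by (rule little_entire[OF F(1)[OF w] open_ball sub[OF w]])
    have pos: "1 - norm w ^ 2 > 0" using w1 by (simp add: power_less_one_iff)
    have cw: "1 - cnj w * w = of_real (1 - norm w ^ 2)"
      by (simp add: complex_norm_square[symmetric] mult.commute)
    have "1 - norm w ^ 2 = (1 - norm w) * (1 + norm w)" by (simp add: power2_eq_square algebra_simps)
    moreover have w0: "0 < 1 + norm w" using norm_ge_zero[of w] by linarith
    ultimately have "ln (1 - norm w ^ 2) = ln (1 - norm w) + ln (1 + norm w)"
      using w1 by (metis ln_mult_pos diff_gt_0_iff_gt)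
    moreover have "ln (1 + norm w) \<le> ln 2" using w0 w1 by (intro ln_mono) auto
    ultimately have "W w - ln 2 \<le> 1 - ln (1 - norm w ^ 2)" by (simp add: W_def)
    moreover have "(1 - ln 2) * W w \<le> W w - ln 2"
      using W1[OF w1] mult_left_mono[of 1 "W w" "ln 2"] by (simp add: algebra_simps)
    ultimately have ge: "(1 - ln 2) * W w \<le> 1 - ln (1 - norm w ^ 2)" by linarith
    have "(deriv ^^ j) (F w) w = L w w ^ 2 / of_real (W w)"
      by (rule F(2)[OF w subsetD[OF sub[OF w]]]) (use w1 in simp)
    also have "L w w = of_real (1 - ln (1 - norm w ^ 2))"
      unfolding L_def cw using pos by (simp add: Ln_of_real del: of_real_diff of_real_power) simp
    finally have eq: "norm ((deriv ^^ j) (F w) w) = (1 - ln (1 - norm w ^ 2)) ^ 2 / W w"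
      using W1[OF w1] by (simp add: norm_divide norm_power del: of_real_diff of_real_power)
    have "(1 - ln 2) ^ 2 * W w = ((1 - ln 2) * W w) ^ 2 / W w"
      using W1[OF w1] by (simp add: power2_eq_square)
    also have "\<dots> \<le> (1 - ln (1 - norm w ^ 2)) ^ 2 / W w"
      using ge W1[OF w1] ln2_le_25_over_36 by (intro divide_right_mono power_mono mult_nonneg_nonneg) auto
    finally show "(1 - ln 2) ^ 2 * Omega j \<beta> (norm w) \<le> norm ((deriv ^^ j) (F w) w)"
      unfolding eq W[OF w1] .
  next
    fix w :: "nat \<Rightarrow> complex"
    assume w: "\<forall>k. w k \<in> unit_disk \<and> 1 / 2 \<le> norm (w k)" and lim: "(\<lambda>k. norm (w k)) \<longlonglongrightarrow> 1"
    have w0: "w k \<in> unit_disk - {0}" for k using w[rule_format, of k] by auto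
    have w1: "norm (w k) < 1" for k using w by simp
    have "norm (w k) \<in> {..<1} \<and> norm (w k) \<noteq> 1" for k using w1[of k] by simp
    then have "filterlim (\<lambda>k. norm (w k)) (at_left 1) sequentially"
      using lim by (simp add: filterlim_at)
    moreover have "filterlim (\<lambda>t::real. 1 - ln (1 - t)) at_top (at_left 1)" by real_asymp
    ultimately have "filterlim (\<lambda>k. W (w k)) at_top sequentially"
      unfolding W_def by (rule filterlim_compose[rotated])
    then have W0: "(\<lambda>k. B / W (w k)) \<longlonglongrightarrow> 0" for B :: real
      by (rule real_tendsto_divide_at_top[OF tendsto_const])
    show null: "loc_null (\<lambda>k. F (w k))"
      unfolding loc_null_def
    proof (intro allI impI)
      fix \<rho> \<epsilon> :: real assume \<rho>: "\<rho> < 1" and \<epsilon>: "\<epsilon> > 0"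
      show "\<forall>\<^sub>F k in sequentially. \<forall>z\<in>cball 0 \<rho>. norm (F (w k) z) < \<epsilon>"
      proof (cases "\<rho> < 0")
        case False
        define B where "B = (2 - ln (1 - \<rho>) + pi) ^ 2"
        have "\<forall>\<^sub>F k in sequentially. B / W (w k) < \<epsilon>" using \<epsilon> W0[of B] by (intro order_tendstoD)
        then show ?thesis
        proof eventually_elim
          case (elim k)
          show ?case
          proof
            fix z :: complex assume z: "z \<in> cball 0 \<rho>"
            have "norm (F (w k) z) \<le> B / W (w k)"
            proof (rule norm_le_iterated_deriv[OF Fd[OF w0] _ \<rho> F(3)[OF w0] _ z])
              fix x :: complex assume x: "x \<in> cball 0 \<rho>"
              then have xS: "x \<in> ?S (w k)" by (intro subsetD[OF sub[OF w0]]) (use \<rho> in auto)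
              have "norm (L (w k) x) \<le> 2 - ln (1 - \<rho>) + pi"
                using norm_1_minus_cnj_mult_ge(1)[of "w k" x] x \<rho> w1[of k] False by (intro L_le) auto
              then have "norm (L (w k) x) ^ 2 \<le> B" unfolding B_def by (intro power_mono) auto
              moreover have "norm ((deriv ^^ j) (F (w k)) x) = norm (L (w k) x) ^ 2 / W (w k)"
                unfolding F(2)[OF w0 xS] using W1[OF w1[of k]] by (simp add: norm_divide norm_power)
              ultimately show "norm ((deriv ^^ j) (F (w k)) x) \<le> B / W (w k)"
                using W1[OF w1[of k]] by (simp add: divide_right_mono)
            qed (use False in auto)
            also have "\<dots> < \<epsilon>" by (rule elim)
            finally show "norm (F (w k) z) < \<epsilon>" .
          qed
        qed
      qed simp
    qed
    fix i assume i: "i < j"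
    \<comment> \<open>Orders below j = \<beta> are uniformly null on the whole disk, so this
      replaces the zero at w of the power case.\<close>
    show "(\<lambda>k. (deriv ^^ i) (F (w k)) (w k)) \<longlonglongrightarrow> 0"
    proof (rule tendstoI)
      fix e :: real assume e: "e > 0"
      have "\<forall>\<^sub>F k in sequentially. \<forall>z\<in>unit_disk. norm ((deriv ^^ i) (F (w k)) z) < e"
        by (rule low_deriv_uniformly_null[OF _ le[OF w0] null e]) (use i j in simp)
      then show "\<forall>\<^sub>F k in sequentially. dist ((deriv ^^ i) (F (w k)) (w k)) 0 < e"
        by eventually_elim (use w1 in auto)
    qed
  qed
  then show ?thesis by blast
qed

section \<open>The lower bound\<close>

lemma test_family_exists: "N_index \<beta> \<le> j \<Longrightarrow> \<exists>c M F. test_family \<beta> j c M F"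
  using power_weight_test_family[of \<beta> j] log_weight_test_family[of \<beta> j] less_N_index_iff[of j \<beta>]
  by (cases "\<beta> = real j") auto

lemma little_disk_restrict: "f holomorphic_on unit_disk \<Longrightarrow> little \<beta> (disk_restrict f) \<longleftrightarrow> little \<beta> f"
  unfolding little_def by (simp add: higher_deriv_disk_restrict)

lemma loc_null_disk_restrict: "loc_null (\<lambda>k. disk_restrict (f k)) \<longleftrightarrow> loc_null f"
proof -
  have "(\<forall>z\<in>cball 0 \<rho>. norm (disk_restrict (f k) z) < \<epsilon>) \<longleftrightarrow> (\<forall>z\<in>cball 0 \<rho>. norm (f k z) < \<epsilon>)"
    if "\<rho> < 1" for \<rho> \<epsilon> k
    using that by (intro ball_cong refl) (simp add: disk_restrict_def)
  then show ?thesis unfolding loc_null_def by simp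
qed

definition G_limsup :: "real \<Rightarrow> real \<Rightarrow> nat \<Rightarrow> (complex \<Rightarrow> complex) \<Rightarrow> (complex \<Rightarrow> complex) \<Rightarrow> nat \<Rightarrow> ennreal" where
  "G_limsup \<beta> \<alpha> J g \<phi> j =
     Limsup_bdry \<phi> (\<lambda>z. ennreal (G_weight \<alpha> J g \<phi> j z * Omega j \<beta> (norm (\<phi> z))))"

text \<open>The terms below \<open>j\<close> vanish in the limit, and those above \<open>j\<close> are already controlled; this is why the
  bounds are established by downward induction on \<open>j\<close>.\<close>

lemma G_limsup_le_step:
  assumes J: "\<alpha> < real J" and j: "N_index \<beta> \<le> j" "j \<le> J"
    and above: "\<And>i. j < i \<Longrightarrow> i \<le> J \<Longrightarrow> 0 \<le> C i" and C2g: "\<And>i. deriv_growth \<beta> i (C2 i)" and CJg: "deriv_growth \<alpha> J CJ"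
    and F: "test_family \<beta> j c M F"
    and adm: "admissible \<beta> \<alpha> g \<phi>" and Q: "Lambda_compact \<beta> \<alpha> Q" and e: "0 \<le> e"
    and TQ: "Lambda_onorm \<beta> \<alpha> (\<lambda>f z. wcomp g \<phi> f z - Q f z) \<le> ennreal e"
    and IH: "\<And>i. j < i \<Longrightarrow> i \<le> J \<Longrightarrow> G_limsup \<beta> \<alpha> J g \<phi> i \<le> ennreal (C i * e)"
  shows "G_limsup \<beta> \<alpha> J g \<phi> j \<le>
    ennreal ((CJ * ((real (Lambda_order \<beta>) + 1) * (M + 1)) + (\<Sum>i\<in>{j<..J}. C2 i * M * C i)) / c * e)"
proof (rule ccontr)
  note C2 = deriv_growth_pos[OF C2g] deriv_growthD[OF C2g]
  note CJ = deriv_growth_pos[OF CJg] deriv_growthD[OF CJg]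
  \<comment> \<open>M + 1 makes the norm bound strictly positive, as
    \<open>Lambda_norm_image_le\<close> asks.\<close>
  let ?K1 = "(real (Lambda_order \<beta>) + 1) * (M + 1)"
  define X where "X = CJ * ?K1 + (\<Sum>i\<in>{j<..J}. C2 i * M * C i)"
  assume "\<not> ?thesis"
  then have "ennreal (X / c * e) < G_limsup \<beta> \<alpha> J g \<phi> j" by (simp add: X_def not_le)
  then obtain y where y: "ennreal (X / c * e) < y" "y < G_limsup \<beta> \<alpha> J g \<phi> j" using dense by blast
  then obtain a where a: "y = ennreal a" "0 \<le> a" by (cases y) auto
  have c: "c > 0" using F by (simp add: test_family_def)
  have gp: "g holomorphic_on unit_disk" "\<phi> holomorphic_on unit_disk" "\<phi> ` unit_disk \<subseteq> unit_disk"
    and Tlin: "Lambda_linear \<beta> \<alpha> (wcomp g \<phi>)"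
    using adm by (auto simp: admissible_def Lambda_bounded_def)
  have Qlin: "Lambda_linear \<beta> \<alpha> Q" using Q by (simp add: Lambda_compact_def)
  have Tim: "wcomp g \<phi> f \<in> Lambda_space \<alpha>" and Qim: "Q f \<in> Lambda_space \<alpha>" if "f \<in> Lambda_space \<beta>" for f
    using Tlin Qlin that by (auto simp: Lambda_linear_def)
  define s where "s k = 1 - 1 / (real k + 2)" for k
  have s: "1 / 2 \<le> s k" "s k < 1" for k by (auto simp: s_def field_simps)
  have slim: "s \<longlonglongrightarrow> 1" unfolding s_def by real_asymp
  have "\<exists>z\<in>unit_disk. s k < norm (\<phi> z) \<and> a < G_weight \<alpha> J g \<phi> j z * Omega j \<beta> (norm (\<phi> z))" for k
  proof -
    have "y < (SUP z\<in>{z \<in> unit_disk. norm (\<phi> z) > s k}. ennreal (G_weight \<alpha> J g \<phi> j z * Omega j \<beta> (norm (\<phi> z))))"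
      using y(2) unfolding G_limsup_def by (rule less_le_trans) (rule Limsup_bdry_le[OF s(2)])
    then obtain z where z: "z \<in> unit_disk" "s k < norm (\<phi> z)" "ennreal a < ennreal (G_weight \<alpha> J g \<phi> j z * Omega j \<beta> (norm (\<phi> z)))"
      by (auto simp: less_SUP_iff a)
    then have "a < G_weight \<alpha> J g \<phi> j z * Omega j \<beta> (norm (\<phi> z))"
      using a(2) by (simp add: ennreal_less_iff)
    with z show ?thesis by blast
  qed
  then obtain z where z: "\<And>k. z k \<in> unit_disk" "\<And>k. s k < norm (\<phi> (z k))"
    "\<And>k. a < G_weight \<alpha> J g \<phi> j (z k) * Omega j \<beta> (norm (\<phi> (z k)))" by metis
  define w where "w k = \<phi> (z k)" for k
  have wD: "w k \<in> unit_disk" for k using gp(3) z(1)[of k] unfolding w_def by blast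
  have w1: "norm (w k) < 1" for k using wD[of k] by simp
  have w2: "1 / 2 \<le> norm (w k)" for k using s(1)[of k] z(2)[of k] by (simp add: w_def)
  have wlim: "(\<lambda>k. norm (w k)) \<longlonglongrightarrow> 1"
    by (rule tendsto_sandwich[OF _ _ slim tendsto_const])
      (use z(2) w1 in \<open>auto simp: w_def intro!: always_eventually less_imp_le\<close>)
  have FL: "Lambda_le \<beta> M (F (w k))" "little \<beta> (F (w k))"
    "c * Omega j \<beta> (norm (w k)) \<le> norm ((deriv ^^ j) (F (w k)) (w k))" for k
    using F wD[of k] w2[of k] by (auto simp: test_family_def)
  have Fnull: "loc_null (\<lambda>k. F (w k))" "\<And>i. i < j \<Longrightarrow> (\<lambda>k. (deriv ^^ i) (F (w k)) (w k)) \<longlonglongrightarrow> 0"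
    using F wD w2 wlim by (auto simp: test_family_def)
  have Fh: "F (w k) holomorphic_on unit_disk" for k using FL(1)[of k] by (simp add: Lambda_le_def)
  have M: "0 \<le> M" using FL(1) by (rule Lambda_le_nonneg)
  define f where "f k = disk_restrict (F (w k))" for k
  have f: "f k \<in> Lambda_space \<beta>" "Lambda_le \<beta> M (f k)" "little \<beta> (f k)" for k
    unfolding f_def using FL Fh by (simp_all add: Lambda_spaceI[OF FL(1)] Lambda_le_disk_restrict little_disk_restrict)
  have fh: "f k holomorphic_on unit_disk" for k using f(2)[of k] by (simp add: Lambda_le_def)
  have fnull: "loc_null f" unfolding f_def using Fnull(1) by (simp add: loc_null_disk_restrict)
  have fd: "(deriv ^^ i) (f k) (w k) = (deriv ^^ i) (F (w k)) (w k)" for i k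
    unfolding f_def by (rule higher_deriv_disk_restrict[OF Fh wD])
  have K1: "?K1 > 0" using M by simp
  have fn: "Lambda_norm \<beta> (f k) \<le> ennreal ?K1" for k
    by (rule Lambda_norm_leI) (use f(2)[of k] in \<open>force simp: Lambda_le_def\<close>)
  have "\<forall>i\<in>{..J}. \<exists>M\<ge>0. \<forall>z\<in>unit_disk. G_weight \<alpha> J g \<phi> i z \<le> M"
    using G_weight_bounded[OF adm J] by auto
  then obtain U where U: "\<And>i z. i \<le> J \<Longrightarrow> z \<in> unit_disk \<Longrightarrow> G_weight \<alpha> J g \<phi> i z \<le> U i"
    "\<And>i. i \<le> J \<Longrightarrow> 0 \<le> U i"
    by (metis atMost_iff)
  \<comment> \<open>The total coefficient of \<eta>: the J-th derivative of the image, the j lower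
    terms, and the errors in the limits superior above j.\<close>
  define Y where "Y = CJ + real j + (\<Sum>i\<in>{j<..J}. C2 i * M)"
  have Y: "Y > 0"
    unfolding Y_def using CJ(1) C2(1) M by (intro add_pos_nonneg sum_nonneg mult_nonneg_nonneg) (auto intro: less_imp_le)
  have main: "c * a \<le> X * e + Y * \<eta>" if \<eta>: "\<eta> > 0" for \<eta>
  proof -
    have "\<forall>\<^sub>F k in sequentially. \<forall>i\<in>{..<j}. norm ((deriv ^^ i) (F (w k)) (w k)) < \<eta> / (U i + 1)"
    proof (intro eventually_ball_finite ballI)
      fix i assume "i \<in> {..<j}"
      then have "i < j" "\<eta> / (U i + 1) > 0" using U(2)[of i] j \<eta> by (auto intro!: divide_pos_pos add_nonneg_pos)
      from tendstoD[OF Fnull(2)[OF this(1)] this(2)]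
      show "\<forall>\<^sub>F k in sequentially. norm ((deriv ^^ i) (F (w k)) (w k)) < \<eta> / (U i + 1)" by simp
    qed simp
    moreover have "\<forall>\<^sub>F k in sequentially. \<forall>i\<in>{j<..J}. G_weight \<alpha> J g \<phi> i (z k) * Omega i \<beta> (norm (w k)) \<le> C i * e + \<eta>"
    proof (intro eventually_ball_finite ballI)
      fix i assume i: "i \<in> {j<..J}"
      then have "0 \<le> C i" using above[of i] by simp
      then have Ce: "0 \<le> C i * e" using e by simp
      have "G_limsup \<beta> \<alpha> J g \<phi> i \<le> ennreal (C i * e)" using IH[of i] i by simp
      also have "\<dots> < ennreal (C i * e + \<eta>)" using Ce \<eta> by (simp add: ennreal_less_iff)
      finally obtain \<delta> where \<delta>: "0 \<le> \<delta>" "\<delta> < 1"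
        "\<And>z. z \<in> unit_disk \<Longrightarrow> \<delta> < norm (\<phi> z) \<Longrightarrow> ennreal (G_weight \<alpha> J g \<phi> i z * Omega i \<beta> (norm (\<phi> z))) < ennreal (C i * e + \<eta>)"
        unfolding G_limsup_def by (rule Limsup_bdry_less) blast
      have "\<forall>\<^sub>F k in sequentially. \<delta> < norm (w k)" using wlim \<delta>(2) by (rule order_tendstoD)
      then show "\<forall>\<^sub>F k in sequentially. G_weight \<alpha> J g \<phi> i (z k) * Omega i \<beta> (norm (w k)) \<le> C i * e + \<eta>"
      proof eventually_elim
        case (elim k)
        then have "ennreal (G_weight \<alpha> J g \<phi> i (z k) * Omega i \<beta> (norm (w k))) \<le> ennreal (C i * e + \<eta>)"
          using \<delta>(3)[OF z(1), of k] by (simp add: w_def less_imp_le)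
        then show ?case by (subst (asm) ennreal_le_iff) (use Ce \<eta> in auto)
      qed
    qed simp
    ultimately have "\<forall>\<^sub>F k in sequentially.
        (\<forall>i\<in>{..<j}. norm ((deriv ^^ i) (F (w k)) (w k)) < \<eta> / (U i + 1)) \<and>
        (\<forall>i\<in>{j<..J}. G_weight \<alpha> J g \<phi> i (z k) * Omega i \<beta> (norm (w k)) \<le> C i * e + \<eta>)"
      by (rule eventually_conj)
    then obtain m where m: "\<And>k. k \<ge> m \<Longrightarrow>
        (\<forall>i\<in>{..<j}. norm ((deriv ^^ i) (F (w k)) (w k)) < \<eta> / (U i + 1)) \<and>
        (\<forall>i\<in>{j<..J}. G_weight \<alpha> J g \<phi> i (z k) * Omega i \<beta> (norm (w k)) \<le> C i * e + \<eta>)"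
      unfolding eventually_sequentially by blast
    \<comment> \<open>\<open>compact_null_sequence\<close> gives only arbitrarily large indices with
      small Q (f k). One index beyond m suffices, because the other conditions hold
      eventually.\<close>
    obtain k where k: "k \<ge> m" "Lambda_norm \<alpha> (Q (f k)) < ennreal \<eta>"
      using compact_null_sequence[OF Q f fnull \<eta>] by blast
    have low: "norm ((deriv ^^ i) (f k) (w k)) < \<eta> / (U i + 1)" if "i < j" for i
      using m[OF k(1)] that by (simp add: fd)
    have high: "G_weight \<alpha> J g \<phi> i (z k) * Omega i \<beta> (norm (w k)) \<le> C i * e + \<eta>" if "j < i" "i \<le> J" for i
      using m[OF k(1)] that by simp
    have Tf: "wcomp g \<phi> (f k) holomorphic_on unit_disk" by (intro wcomp_holomorphic gp fh)
    have D: "(\<lambda>x. wcomp g \<phi> (f k) x - Q (f k) x) \<in> Lambda_space \<alpha>"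
      by (intro Lambda_space_diff Tim Qim f)
    have "Lambda_norm \<alpha> (\<lambda>x. wcomp g \<phi> (f k) x - Q (f k) x)
      \<le> ennreal ?K1 * Lambda_onorm \<beta> \<alpha> (\<lambda>f z. wcomp g \<phi> f z - Q f z)"
    proof (rule Lambda_norm_image_le[OF _ _ f(1) fn K1])
      fix b h assume h: "h \<in> Lambda_space \<beta>"
      show "(\<lambda>z. wcomp g \<phi> (\<lambda>z. b * h z) z - Q (\<lambda>z. b * h z) z) = (\<lambda>z. b * (wcomp g \<phi> h z - Q h z))"
        using Qlin h by (simp add: wcomp_cmult Lambda_linear_def right_diff_distrib)
      show "(\<lambda>z. wcomp g \<phi> h z - Q h z) holomorphic_on unit_disk"
        using Lambda_space_diff[OF Tim[OF h] Qim[OF h]] by (simp add: Lambda_space_def)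
    qed
    also have "\<dots> \<le> ennreal ?K1 * ennreal e" using TQ by (intro mult_left_mono) auto
    also have "\<dots> = ennreal (?K1 * e)" using K1 e by (simp flip: ennreal_mult)
    finally have 1: "Lambda_norm \<alpha> (\<lambda>x. wcomp g \<phi> (f k) x - Q (f k) x) \<le> ennreal (?K1 * e)" .
    have "Lambda_norm \<alpha> (\<lambda>x. (wcomp g \<phi> (f k) x - Q (f k) x) + Q (f k) x)
      \<le> Lambda_norm \<alpha> (\<lambda>x. wcomp g \<phi> (f k) x - Q (f k) x) + Lambda_norm \<alpha> (Q (f k))"
      using D Qim[OF f(1)[of k]] by (intro Lambda_norm_add) (auto simp: Lambda_space_def)
    also have "\<dots> \<le> ennreal (?K1 * e) + ennreal \<eta>" using 1 k(2) by (intro add_mono) auto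
    also have "\<dots> = ennreal (?K1 * e + \<eta>)" using K1 e \<eta> by (intro ennreal_plus[symmetric]) auto
    finally have "Lambda_norm \<alpha> (wcomp g \<phi> (f k)) \<le> ennreal (?K1 * e + \<eta>)" by simp
    then have TL: "Lambda_le \<alpha> (?K1 * e + \<eta>) (wcomp g \<phi> (f k))"
      using K1 e \<eta> by (intro Lambda_norm_leD) auto
    let ?w = "(1 - norm (z k)) powr (real J - \<alpha>)" and ?G = "G_fun g \<phi> J"
    have Tb: "norm ((deriv ^^ J) (wcomp g \<phi> (f k)) (z k)) * ?w \<le> CJ * (?K1 * e + \<eta>)"
      by (subst mult_powr_le_iff) (use z(1)[of k] CJ(2)[OF TL z(1)] J in \<open>auto simp: Omega_alt\<close>)
    let ?t = "\<lambda>i. ?G i (z k) * (deriv ^^ i) (f k) (w k)"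
    have split: "{..J} = insert j ({..<j} \<union> {j<..J})" using j by auto
    have "(deriv ^^ J) (wcomp g \<phi> (f k)) (z k) = (\<Sum>i\<le>J. ?t i)"
      unfolding w_def by (rule higher_deriv_wcomp[OF gp fh z(1)])
    also have "\<dots> = ?t j + ((\<Sum>i<j. ?t i) + (\<Sum>i\<in>{j<..J}. ?t i))"
      unfolding split by (subst sum.insert) (auto intro!: sum.union_disjoint)
    finally have "?t j = (deriv ^^ J) (wcomp g \<phi> (f k)) (z k) - ((\<Sum>i<j. ?t i) + (\<Sum>i\<in>{j<..J}. ?t i))" by simp
    then have "norm (?t j) \<le> norm ((deriv ^^ J) (wcomp g \<phi> (f k)) (z k)) + ((\<Sum>i<j. norm (?t i)) + (\<Sum>i\<in>{j<..J}. norm (?t i)))"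
      by (simp only:) (intro order.trans[OF norm_triangle_ineq4] add_left_mono order.trans[OF norm_triangle_ineq] add_mono norm_sum)
    then have "norm (?t j) * ?w \<le> (norm ((deriv ^^ J) (wcomp g \<phi> (f k)) (z k)) + ((\<Sum>i<j. norm (?t i)) + (\<Sum>i\<in>{j<..J}. norm (?t i)))) * ?w"
      by (rule mult_right_mono) simp
    also have "\<dots> = norm ((deriv ^^ J) (wcomp g \<phi> (f k)) (z k)) * ?w +
        ((\<Sum>i<j. norm (?t i) * ?w) + (\<Sum>i\<in>{j<..J}. norm (?t i) * ?w))"
      unfolding distrib_right sum_distrib_right ..
    also have "\<dots> \<le> CJ * (?K1 * e + \<eta>) + ((\<Sum>i<j. \<eta>) + (\<Sum>i\<in>{j<..J}. C2 i * M * (C i * e + \<eta>)))"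
    proof (intro add_mono Tb sum_mono)
      fix i assume "i \<in> {..<j}"
      then have i: "i < j" "i \<le> J" using j by auto
      have "norm (?t i) * ?w = G_weight \<alpha> J g \<phi> i (z k) * norm ((deriv ^^ i) (f k) (w k))"
        by (simp add: G_weight_def norm_mult mult_ac)
      also have "\<dots> \<le> U i * (\<eta> / (U i + 1))"
        using U[OF i(2)] z(1)[of k] low[OF i(1)] G_weight_nonneg by (intro mult_mono) auto
      also have "\<dots> \<le> \<eta>" using U(2)[OF i(2)] \<eta> by (simp add: field_simps)
      finally show "norm (?t i) * ?w \<le> \<eta>" .
    next
      fix i assume "i \<in> {j<..J}"
      then have i: "j < i" "i \<le> J" by auto
      have "norm (?t i) * ?w = G_weight \<alpha> J g \<phi> i (z k) * norm ((deriv ^^ i) (f k) (w k))"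
        by (simp add: G_weight_def norm_mult mult_ac)
      also have "\<dots> \<le> G_weight \<alpha> J g \<phi> i (z k) * (C2 i * M * Omega i \<beta> (norm (w k)))"
        by (intro mult_left_mono C2(2) f wD G_weight_nonneg)
      also have "\<dots> = C2 i * M * (G_weight \<alpha> J g \<phi> i (z k) * Omega i \<beta> (norm (w k)))" by simp
      also have "\<dots> \<le> C2 i * M * (C i * e + \<eta>)"
        using C2(1)[of i] M by (intro mult_left_mono high i) auto
      finally show "norm (?t i) * ?w \<le> C2 i * M * (C i * e + \<eta>)" .
    qed
    also have "\<dots> = X * e + Y * \<eta>"
      unfolding X_def Y_def distrib_left distrib_right sum.distrib sum_distrib_right
      by (simp add: mult_ac)
    finally have upper: "norm (?t j) * ?w \<le> X * e + Y * \<eta>" .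
    have "c * a \<le> c * (G_weight \<alpha> J g \<phi> j (z k) * Omega j \<beta> (norm (w k)))"
      using z(3)[of k] c by (intro mult_left_mono) (auto simp: w_def)
    also have "\<dots> = G_weight \<alpha> J g \<phi> j (z k) * (c * Omega j \<beta> (norm (w k)))" by simp
    also have "\<dots> \<le> G_weight \<alpha> J g \<phi> j (z k) * norm ((deriv ^^ j) (f k) (w k))"
      using FL(3)[of k] by (intro mult_left_mono G_weight_nonneg) (simp add: fd)
    also have "\<dots> = norm (?t j) * ?w" by (simp add: G_weight_def norm_mult mult_ac)
    finally show ?thesis using upper by linarith
  qed
  have "c * a \<le> X * e"
  proof (rule field_le_epsilon)
    fix \<epsilon> :: real assume "0 < \<epsilon>"
    then show "c * a \<le> X * e + \<epsilon>" using main[of "\<epsilon> / Y"] Y by simp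
  qed
  then have "a \<le> X / c * e" using c by (simp add: field_simps)
  then have "y \<le> ennreal (X / c * e)" unfolding a by (rule ennreal_leI)
  with y(1) show False by simp
qed

section \<open>From a single compact operator to the essential norm\<close>

definition G_limsup_const :: "real \<Rightarrow> real \<Rightarrow> nat \<Rightarrow> nat \<Rightarrow> real \<Rightarrow> bool" where
  "G_limsup_const \<beta> \<alpha> J j C \<longleftrightarrow> 0 \<le> C \<and>
     (\<forall>g \<phi> Q e. admissible \<beta> \<alpha> g \<phi> \<longrightarrow> Lambda_compact \<beta> \<alpha> Q \<longrightarrow> 0 \<le> e \<longrightarrow>
      Lambda_onorm \<beta> \<alpha> (\<lambda>f z. wcomp g \<phi> f z - Q f z) \<le> ennreal e \<longrightarrow>
      G_limsup \<beta> \<alpha> J g \<phi> j \<le> ennreal (C * e))"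

lemma G_limsup_constD:
  assumes "G_limsup_const \<beta> \<alpha> J j C" "admissible \<beta> \<alpha> g \<phi>" "Lambda_compact \<beta> \<alpha> Q" "0 \<le> e"
    "Lambda_onorm \<beta> \<alpha> (\<lambda>f z. wcomp g \<phi> f z - Q f z) \<le> ennreal e"
  shows "G_limsup \<beta> \<alpha> J g \<phi> j \<le> ennreal (C * e)"
  using assms unfolding G_limsup_const_def by blast

lemma G_limsup_const_exists:
  assumes J: "\<alpha> < real J" and j: "N_index \<beta> \<le> j" "j \<le> J"
  shows "\<exists>C. G_limsup_const \<beta> \<alpha> J j C"
  using j
proof (induction "J - j" arbitrary: j rule: less_induct)
  case less
  have "\<forall>i\<in>{j<..J}. \<exists>C. G_limsup_const \<beta> \<alpha> J i C"
    using less by (intro ballI less.hyps) auto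
  from bchoice[OF this] obtain C where C: "\<And>i. i \<in> {j<..J} \<Longrightarrow> G_limsup_const \<beta> \<alpha> J i (C i)" by blast
  have C0: "0 \<le> C i" if "i \<in> {j<..J}" for i using C[OF that] by (simp add: G_limsup_const_def)
  obtain C2 where C2: "\<And>i. deriv_growth \<beta> i (C2 i)" using higher_deriv_growth by metis
  obtain CJ where CJ: "deriv_growth \<alpha> J CJ" using higher_deriv_growth by blast
  obtain c M F where F: "test_family \<beta> j c M F" using test_family_exists[OF less.prems(1)] by blast
  have c: "c > 0" using F by (simp add: test_family_def)
  \<comment> \<open>The point 1/2 is a sample point of the family; it serves only to show 0 \<le>
    M.\<close>
  have "Lambda_le \<beta> M (F (1 / 2))" using F by (auto simp: test_family_def)
  then have M: "0 \<le> M" by (rule Lambda_le_nonneg)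
  define B where "B = (CJ * ((real (Lambda_order \<beta>) + 1) * (M + 1)) + (\<Sum>i\<in>{j<..J}. C2 i * M * C i)) / c"
  have "0 \<le> B"
    unfolding B_def using deriv_growth_pos[OF CJ] M c C0 deriv_growth_pos[OF C2]
    by (intro divide_nonneg_pos add_nonneg_nonneg sum_nonneg mult_nonneg_nonneg) (auto intro: less_imp_le)
  moreover have "G_limsup \<beta> \<alpha> J g \<phi> j \<le> ennreal (B * e)"
    if that: "admissible \<beta> \<alpha> g \<phi>" "Lambda_compact \<beta> \<alpha> Q" "0 \<le> e"
      "Lambda_onorm \<beta> \<alpha> (\<lambda>f z. wcomp g \<phi> f z - Q f z) \<le> ennreal e" for g \<phi> Q e
    unfolding B_def
  proof (rule G_limsup_le_step[OF J less.prems _ C2 CJ F that])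
    fix i assume "j < i" "i \<le> J"
    then have i: "i \<in> {j<..J}" by simp
    show "0 \<le> C i" by (rule C0[OF i])
    show "G_limsup \<beta> \<alpha> J g \<phi> i \<le> ennreal (C i * e)" by (rule G_limsup_constD[OF C[OF i] that])
  qed
  ultimately have "G_limsup_const \<beta> \<alpha> J j B" unfolding G_limsup_const_def by blast
  then show ?case ..
qed

lemma ess_norm_lower:
  assumes J: "\<alpha> < real J"
  obtains C where "C > 0" "\<And>g \<phi> j. admissible \<beta> \<alpha> g \<phi> \<Longrightarrow> j \<in> {N_index \<beta>..J} \<Longrightarrow>
      G_limsup \<beta> \<alpha> J g \<phi> j \<le> ennreal C * Lambda_ess_norm \<beta> \<alpha> (wcomp g \<phi>)"
proof -
  have "\<forall>j\<in>{N_index \<beta>..J}. \<exists>C. G_limsup_const \<beta> \<alpha> J j C"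
    using G_limsup_const_exists[OF J] by auto
  from bchoice[OF this] obtain C where C: "\<And>j. j \<in> {N_index \<beta>..J} \<Longrightarrow> G_limsup_const \<beta> \<alpha> J j (C j)" by blast
  have C0: "0 \<le> C j" if "j \<in> {N_index \<beta>..J}" for j using C[OF that] by (simp add: G_limsup_const_def)
  \<comment> \<open>One constant for all j; adding 1 keeps it positive when the range is
    empty.\<close>
  define D where "D = (\<Sum>j\<in>{N_index \<beta>..J}. C j) + 1"
  have D: "D > 0" unfolding D_def using C0 by (intro add_nonneg_pos sum_nonneg) auto
  have CD: "C j \<le> D" if "j \<in> {N_index \<beta>..J}" for j
    unfolding D_def using member_le_sum[of j "{N_index \<beta>..J}" C] C0 that by force
  show ?thesis
  proof (rule that[OF D])
    fix g \<phi> j assume adm: "admissible \<beta> \<alpha> g \<phi>" and j: "j \<in> {N_index \<beta>..J}"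
    \<comment> \<open>Dividing by D makes the left side a lower bound independent of
      \<open>Q\<close>, so that the infimum over \<open>Q\<close> can be taken.\<close>
    have "G_limsup \<beta> \<alpha> J g \<phi> j / ennreal D \<le> Lambda_onorm \<beta> \<alpha> (\<lambda>f z. wcomp g \<phi> f z - Q f z)"
      if Q: "Lambda_compact \<beta> \<alpha> Q" for Q
    proof (cases "Lambda_onorm \<beta> \<alpha> (\<lambda>f z. wcomp g \<phi> f z - Q f z)")
      case (real e)
      have "G_limsup \<beta> \<alpha> J g \<phi> j \<le> ennreal (C j * e)" by (rule G_limsup_constD[OF C[OF j] adm Q]) (use real in auto)
      also have "\<dots> \<le> ennreal (D * e)" using real CD[OF j] by (intro ennreal_leI mult_right_mono) auto
      finally have "G_limsup \<beta> \<alpha> J g \<phi> j / ennreal D \<le> ennreal (D * e) / ennreal D" by (rule divide_right_mono_ennreal)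
      also have "\<dots> = ennreal e" using D real by (subst divide_ennreal) auto
      finally show ?thesis using real by simp
    qed simp
    then have "G_limsup \<beta> \<alpha> J g \<phi> j / ennreal D \<le> Lambda_ess_norm \<beta> \<alpha> (wcomp g \<phi>)"
      unfolding Lambda_ess_norm_def by (intro INF_greatest) auto
    then have "ennreal D * (G_limsup \<beta> \<alpha> J g \<phi> j / ennreal D) \<le> ennreal D * Lambda_ess_norm \<beta> \<alpha> (wcomp g \<phi>)"
      by (rule mult_left_mono) simp
    then show "G_limsup \<beta> \<alpha> J g \<phi> j \<le> ennreal D * Lambda_ess_norm \<beta> \<alpha> (wcomp g \<phi>)"
      using D by (simp add: ennreal_times_divide mult.commute[of "ennreal D"] mult_divide_eq_ennreal)
  qed
qed

section \<open>Assembling the bounds and the monomial formula\<close>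

lemma G_limsup_less_tail_bound:
  assumes "\<And>j. j \<in> {N_index \<beta>..J} \<Longrightarrow> G_limsup \<beta> \<alpha> J g \<phi> j < ennreal a" and a: "0 \<le> a"
  shows "tail_bound \<beta> \<alpha> J g \<phi> a"
proof -
  have "\<exists>\<delta>. 0 \<le> \<delta> \<and> \<delta> < 1 \<and> (\<forall>z\<in>unit_disk. \<delta> < norm (\<phi> z) \<longrightarrow> G_weight \<alpha> J g \<phi> j z * Omega j \<beta> (norm (\<phi> z)) \<le> a)"
    if j: "j \<in> {N_index \<beta>..J}" for j
  proof -
    obtain \<delta> where \<delta>: "0 \<le> \<delta>" "\<delta> < 1" "\<And>z. z \<in> unit_disk \<Longrightarrow> \<delta> < norm (\<phi> z) \<Longrightarrow>
        ennreal (G_weight \<alpha> J g \<phi> j z * Omega j \<beta> (norm (\<phi> z))) < ennreal a"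
      using Limsup_bdry_less[OF assms(1)[OF j, unfolded G_limsup_def]] by blast
    moreover have "x \<le> a" if "ennreal x < ennreal a" for x
      using that ennreal_leI[of a x] by (cases "x \<le> a") auto
    ultimately show ?thesis by blast
  qed
  then obtain \<delta> where \<delta>: "\<And>j. j \<in> {N_index \<beta>..J} \<Longrightarrow> 0 \<le> \<delta> j" "\<And>j. j \<in> {N_index \<beta>..J} \<Longrightarrow> \<delta> j < 1"
    "\<And>j z. j \<in> {N_index \<beta>..J} \<Longrightarrow> z \<in> unit_disk \<Longrightarrow> \<delta> j < norm (\<phi> z) \<Longrightarrow> G_weight \<alpha> J g \<phi> j z * Omega j \<beta> (norm (\<phi> z)) \<le> a"
    by metis
  \<comment> \<open>Inserting 0 gives the maximum a meaning when no j lies in the range.\<close>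
  define d where "d = Max (insert 0 (\<delta> ` {N_index \<beta>..J}))"
  have "0 \<le> d" "d < 1" using \<delta>(2) by (auto simp: d_def)
  moreover have "\<delta> j \<le> d" if "j \<in> {N_index \<beta>..J}" for j
    unfolding d_def using that by (intro Max_ge) auto
  ultimately show ?thesis
    unfolding tail_bound_def using a \<delta>(3) by (meson le_less_trans)
qed

text \<open>As \<alpha> - J < 0 the order is 0, so the norm is a plain weighted supremum;
  boundedness of \<open>G_weight\<close> and j \<ge> N give the hypotheses of
  \<open>Limsup_bdry_eq_limsup_monomials\<close>.\<close>

lemma G_limsup_eq_monomials:
  assumes adm: "admissible \<beta> \<alpha> g \<phi>" and J: "\<alpha> < real J" and j: "j \<in> {N_index \<beta>..J}"
  shows "G_limsup \<beta> \<alpha> J g \<phi> j = limsup (\<lambda>n. Lambda_norm (\<alpha> - real J) (\<lambda>z. G_fun g \<phi> J j z * \<phi> z ^ n)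
     / growth_norm (Omega j \<beta>) (\<lambda>z. z ^ n))"
proof -
  have gp: "g holomorphic_on unit_disk" "\<phi> holomorphic_on unit_disk" "\<phi> ` unit_disk \<subseteq> unit_disk"
    using adm by (auto simp: admissible_def)
  have "is_G_family g \<phi> J (G_fun g \<phi> J)" by (rule G_fun_family[OF gp])
  then have G: "G_fun g \<phi> J j holomorphic_on unit_disk" using j by (simp add: is_G_family_def)
  have "j \<le> J" using j by simp
  from G_weight_bounded[OF adm J this]
  obtain M where M: "\<And>z. z \<in> unit_disk \<Longrightarrow> G_weight \<alpha> J g \<phi> j z \<le> M" by blast
  have K: "Lambda_order (\<alpha> - real J) = 0"
    using Lambda_order_le[of "\<alpha> - real J" 0] J by simp
  have "Lambda_norm (\<alpha> - real J) (\<lambda>z. G_fun g \<phi> J j z * \<phi> z ^ n)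
      = (SUP z\<in>unit_disk. ennreal (G_weight \<alpha> J g \<phi> j z * norm (\<phi> z) ^ n))" for n
  proof -
    have "(\<lambda>z. G_fun g \<phi> J j z * \<phi> z ^ n) holomorphic_on unit_disk"
      by (intro holomorphic_intros G gp)
    then show ?thesis
      unfolding Lambda_norm_def Let_def K by (simp add: G_weight_def norm_mult norm_power mult_ac)
  qed
  moreover have "G_limsup \<beta> \<alpha> J g \<phi> j =
      limsup (\<lambda>n. (SUP z\<in>unit_disk. ennreal (G_weight \<alpha> J g \<phi> j z * norm (\<phi> z) ^ n)) / growth_norm (Omega j \<beta>) (\<lambda>z. z ^ n))"
    unfolding G_limsup_def
    by (rule Limsup_bdry_eq_limsup_monomials[OF G_weight_nonneg M gp(3) Omega_ge_1 monomial_peaks_Omega])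
      (use j in auto)
  ultimately show ?thesis by simp
qed

theorem theorem3p8:
  fixes \<alpha> \<beta> :: real and J N :: nat
  assumes "real J > \<alpha>" and "N = N_index \<beta>"
  shows "\<exists>C::real. C > 0 \<and>
    (\<forall>g \<phi>. g holomorphic_on unit_disk \<longrightarrow> \<phi> holomorphic_on unit_disk \<longrightarrow>
       \<phi> ` unit_disk \<subseteq> unit_disk \<longrightarrow> Lambda_bounded \<beta> \<alpha> (wcomp g \<phi>) \<longrightarrow>
       (let E = Lambda_ess_norm \<beta> \<alpha> (wcomp g \<phi>);
            A = (SUP j\<in>{N..J}. Limsup_bdry \<phi> (\<lambda>z.
                   ennreal (norm (G_fun g \<phi> J j z) * Omega j \<beta> (norm (\<phi> z))
                     / (1 - norm z) powr (\<alpha> - real J))));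
            B = (SUP j\<in>{N..J}. limsup (\<lambda>n::nat.
                   Lambda_norm (\<alpha> - real J) (\<lambda>z. G_fun g \<phi> J j z * \<phi> z ^ n)
                     / growth_norm (Omega j \<beta>) (\<lambda>z. z ^ n)))
        in ennreal (inverse C) * A \<le> E \<and> E \<le> ennreal C * A \<and> A = B \<and>
           (N > J \<longrightarrow> Lambda_compact \<beta> \<alpha> (wcomp g \<phi>))))"
proof -
  obtain C1 where C1: "C1 > 0" "\<And>g \<phi> a. admissible \<beta> \<alpha> g \<phi> \<Longrightarrow> tail_bound \<beta> \<alpha> J g \<phi> a \<Longrightarrow>
      Lambda_ess_norm \<beta> \<alpha> (wcomp g \<phi>) \<le> ennreal (C1 * a)"
    using ess_norm_upper[OF assms(1)] by metis
  obtain C2 where C2: "C2 > 0" "\<And>g \<phi> j. admissible \<beta> \<alpha> g \<phi> \<Longrightarrow> j \<in> {N_index \<beta>..J} \<Longrightarrow>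
      G_limsup \<beta> \<alpha> J g \<phi> j \<le> ennreal C2 * Lambda_ess_norm \<beta> \<alpha> (wcomp g \<phi>)"
    using ess_norm_lower[OF assms(1)] by metis
  define C where "C = max C1 C2"
  have C: "C > 0" "C1 \<le> C" "C2 \<le> C" using C1 C2 by (auto simp: C_def)
  show ?thesis
    unfolding Let_def
  proof (intro exI[of _ C] conjI allI impI C(1))
    fix g \<phi>
    assume gp: "g holomorphic_on unit_disk" "\<phi> holomorphic_on unit_disk" "\<phi> ` unit_disk \<subseteq> unit_disk"
      and "Lambda_bounded \<beta> \<alpha> (wcomp g \<phi>)"
    then have adm: "admissible \<beta> \<alpha> g \<phi>" by (simp add: admissible_def)
    let ?E = "Lambda_ess_norm \<beta> \<alpha> (wcomp g \<phi>)"
    let ?X = "SUP j\<in>{N..J}. Limsup_bdry \<phi> (\<lambda>z. ennreal (norm (G_fun g \<phi> J j z) * Omega j \<beta> (norm (\<phi> z))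
        / (1 - norm z) powr (\<alpha> - real J)))"
    let ?A = "SUP j\<in>{N_index \<beta>..J}. G_limsup \<beta> \<alpha> J g \<phi> j"
    have "norm (G_fun g \<phi> J j z) * Omega j \<beta> (norm (\<phi> z)) / (1 - norm z) powr (\<alpha> - real J)
        = G_weight \<alpha> J g \<phi> j z * Omega j \<beta> (norm (\<phi> z))" for j z
      using powr_minus_divide[of "1 - norm z" "\<alpha> - real J"] by (simp add: G_weight_def)
    then have A: "?X = ?A"
      by (simp add: G_limsup_def assms(2))
    show "?X =
      (SUP j\<in>{N..J}. limsup (\<lambda>n::nat. Lambda_norm (\<alpha> - real J) (\<lambda>z. G_fun g \<phi> J j z * \<phi> z ^ n)
        / growth_norm (Omega j \<beta>) (\<lambda>z. z ^ n)))"
      unfolding A unfolding assms(2) by (intro SUP_cong refl G_limsup_eq_monomials adm assms(1))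
    have "?A \<le> ennreal C * ?E"
    proof (rule SUP_least)
      fix j assume "j \<in> {N_index \<beta>..J}"
      then have "G_limsup \<beta> \<alpha> J g \<phi> j \<le> ennreal C2 * ?E" by (rule C2(2)[OF adm])
      also have "\<dots> \<le> ennreal C * ?E" using C by (intro mult_right_mono ennreal_leI) auto
      finally show "G_limsup \<beta> \<alpha> J g \<phi> j \<le> ennreal C * ?E" .
    qed
    then have "ennreal (inverse C) * ?A \<le> ennreal (inverse C) * (ennreal C * ?E)"
      by (rule mult_left_mono) simp
    also have "\<dots> = ?E"
      using C(1) by (simp add: mult.assoc[symmetric] flip: ennreal_mult)
    finally show "ennreal (inverse C) * ?X \<le> ?E"
      unfolding A .
    show "?E \<le> ennreal C * ?X"
      unfolding A
    proof (cases ?A)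
      case (real a)
      show "?E \<le> ennreal C * ?A"
      proof (rule ennreal_le_epsilon)
        fix \<epsilon> :: real assume \<epsilon>: "0 < \<epsilon>"
        \<comment> \<open>A value strictly above the limits superior is needed to obtain
          \<open>tail_bound\<close>; the surplus becomes \<epsilon> after multiplication by
          C.\<close>
        define b where "b = a + \<epsilon> / C"
        have b: "a < b" "0 \<le> b" using \<epsilon> C real by (auto simp: b_def intro!: add_nonneg_nonneg)
        have "tail_bound \<beta> \<alpha> J g \<phi> b"
        proof (rule G_limsup_less_tail_bound)
          fix j assume "j \<in> {N_index \<beta>..J}"
          then have "G_limsup \<beta> \<alpha> J g \<phi> j \<le> ?A" by (rule SUP_upper)
          also have "\<dots> < ennreal b" unfolding real(2) using real(1) b by (simp add: ennreal_less_iff)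
          finally show "G_limsup \<beta> \<alpha> J g \<phi> j < ennreal b" .
        qed (use b in simp)
        then have "?E \<le> ennreal (C1 * b)" by (rule C1(2)[OF adm])
        also have "\<dots> \<le> ennreal (C * b)" using C b by (intro ennreal_leI mult_right_mono) auto
        also have "C * b = C * a + \<epsilon>" using C by (simp add: b_def distrib_left)
        also have "ennreal (C * a + \<epsilon>) = ennreal C * ?A + ennreal \<epsilon>"
          unfolding real(2) using C real(1) \<epsilon> by (simp add: ennreal_mult)
        finally show "?E \<le> ennreal C * ?A + ennreal \<epsilon>" .
      qed
    next
      case top
      show "?E \<le> ennreal C * ?A" unfolding top using C(1) by (simp add: ennreal_mult_top)
    qed
    \<comment> \<open>The range of j is now empty, so \<open>tail_bound\<close> holds for every a >
      0.\<close>
    assume "N > J"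
    then show "Lambda_compact \<beta> \<alpha> (wcomp g \<phi>)"
      using assms by (intro wcomp_compact[OF assms(1) adm]) (auto simp: tail_bound_def intro!: exI[of _ 0])
  qed
qed

end
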